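(* Let $\varepsilon\in\{+1,-1\}$, let $m\ge1$ and $k$ be integers, and let $\mathcal{M}=(M,g)$ be a harmonic space whose density function satisfies $\Theta_{\mathcal{M}}=\Theta_\varepsilon(m,k)$, where $\Theta_{+}(m,k)(r)=\sin(r)^{m-1}\cos(r)^k$ and $\Theta_{-}(m,k)(r)=\sinh(r)^{m-1}\cosh(r)^k$. Then: (1) $m=\dim(M)$ and $0\le k\le m-1$. (2) If $k=0$, then $\mathcal{M}$ has constant sectional curvature $\varepsilon$. (3) If $k=m-1$, then $\mathcal{M}$ has constant sectional curvature $4\varepsilon$.
   Context: Let $\mathcal{M}=(M,g)$ be a (smooth) Riemannian manifold with Riemannian measure $\operatorname{dvol}_{\mathcal{M}}$. For $P\in M$ write $\xi\in T_PM$ in polar coordinates $\xi=r\theta$, $r=\|\xi\|>0$, $\|\theta\|=1$. The density $\Theta_{\mathcal{M}}(P;\xi)$ is defined for small $\xi\neq0$ by $\exp_P^*\operatorname{dvol}_{\mathcal{M}}=\Theta_{\mathcal{M}}(P;\xi)\,dr\,d\theta$, where $d\theta$ is the standard measure on the unit sphere of $T_PM$; equivalently $\Theta_{\mathcal{M}}(P;\xi)=r^{\dim(M)-1}\sqrt{\det(g_{ij}(\xi))}$ in geodesic normal coordinates at $P$. $\mathcal{M}$ is a harmonic space if $\Theta_{\mathcal{M}}(P;\xi)$ depends only on $\|\xi\|$, in which case one writes $\Theta_{\mathcal{M}}(r)$, $r=\|\xi\|$. The equality $\Theta_{\mathcal{M}}=\Theta_\varepsilon(m,k)$ is as functions of $r$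 for small $r>0$. No completeness is assumed. Subscripts $\varepsilon=\pm$ are identified with the signs $\pm1$. Curvature signs are normalized so that the round unit sphere has sectional curvature $+1$. *)

theory Defs
  imports "HOL-Analysis.Analysis"
begin

text \<open>C-infinity maps on an open set \<open>S\<close>: all iterated directional derivatives exist and are continuous.\<close>

primrec Ck_on :: "nat \<Rightarrow> 'a::real_normed_vector set \<Rightarrow> ('a \<Rightarrow> 'b::real_normed_vector) \<Rightarrow> bool" where
  "Ck_on 0 S f \<longleftrightarrow> continuous_on S f"
| "Ck_on (Suc n) S f \<longleftrightarrow>
     (\<forall>x\<in>S. f differentiable (at x)) \<and>
     (\<forall>v. Ck_on n S (\<lambda>x. frechet_derivative f (at x) v))"

definition smooth_on :: "'a::real_normed_vector set \<Rightarrow> ('a \<Rightarrow> 'b::real_normed_vector) \<Rightarrow> bool" where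
  "smooth_on S f \<longleftrightarrow> (\<forall>n. Ck_on n S f)"


text \<open>
  A chart is a pair of a domain and a coordinate map.  The dimension of the manifold is
  \<open>CARD('n)\<close>.  The metric tensor is given by its local representations:
  \<open>metric M c x u v\<close> is the inner product of the tangent vectors with coordinates \<open>u\<close>, \<open>v\<close> in the
  chart \<open>c\<close>, at the point whose coordinates in \<open>c\<close> are \<open>x\<close>.
\<close>

type_synonym ('a, 'n) chart = "'a set \<times> ('a \<Rightarrow> real ^ 'n)"

abbreviation dom_of :: "('a, 'n::finite) chart \<Rightarrow> 'a set" where "dom_of c \<equiv> fst c"
abbreviation coord :: "('a, 'n::finite) chart \<Rightarrow> 'a \<Rightarrow> real ^ 'n" where "coord c \<equiv> snd c"

record ('a, 'n::finite) rspace =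
  top_of :: "'a topology"
  atlas :: "('a, 'n) chart set"
  metric :: "('a, 'n) chart \<Rightarrow> real ^ 'n \<Rightarrow> real ^ 'n \<Rightarrow> real ^ 'n \<Rightarrow> real"

abbreviation points :: "('a, 'n::finite) rspace \<Rightarrow> 'a set" where
  "points M \<equiv> topspace (top_of M)"

definition is_chart :: "'a topology \<Rightarrow> ('a, 'n::finite) chart \<Rightarrow> bool" where
  "is_chart X c \<longleftrightarrow>
     openin X (dom_of c) \<and> open (coord c ` dom_of c) \<and>
     homeomorphic_map (subtopology X (dom_of c)) (top_of_set (coord c ` dom_of c)) (coord c)"

definition transition :: "('a, 'n::finite) chart \<Rightarrow> ('a, 'n) chart \<Rightarrow> real ^ 'n \<Rightarrow> real ^ 'n" where
  "transition c c' = coord c' \<circ> inv_into (dom_of c) (coord c)"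

definition smooth_manifold :: "('a, 'n::finite) rspace \<Rightarrow> bool" where
  "smooth_manifold M \<longleftrightarrow>
     points M \<noteq> {} \<and> Hausdorff_space (top_of M) \<and> second_countable (top_of M) \<and>
     (\<forall>c\<in>atlas M. is_chart (top_of M) c) \<and>
     (\<Union>c\<in>atlas M. dom_of c) = points M \<and>
     (\<forall>c\<in>atlas M. \<forall>c'\<in>atlas M.
        smooth_on (coord c ` (dom_of c \<inter> dom_of c')) (transition c c'))"

definition riemannian_manifold :: "('a, 'n::finite) rspace \<Rightarrow> bool" where
  "riemannian_manifold M \<longleftrightarrow>
     smooth_manifold M \<and>
     (\<forall>c\<in>atlas M. \<forall>x\<in>coord c ` dom_of c.
        bilinear (metric M c x) \<and>
        (\<forall>u v. metric M c x u v = metric M c x v u) \<and>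
        (\<forall>u. u \<noteq> 0 \<longrightarrow> metric M c x u u > 0)) \<and>
     (\<forall>c\<in>atlas M. \<forall>u v. smooth_on (coord c ` dom_of c) (\<lambda>x. metric M c x u v)) \<and>
     (\<forall>c\<in>atlas M. \<forall>c'\<in>atlas M. \<forall>p\<in>dom_of c \<inter> dom_of c'. \<forall>u v.
        metric M c (coord c p) u v =
        metric M c' (coord c' p)
          (frechet_derivative (transition c c') (at (coord c p)) u)
          (frechet_derivative (transition c c') (at (coord c p)) v))"


text \<open>
  The Levi-Civita connection in the chart \<open>c\<close> is \<open>\<nabla>\<^sub>u v = D\<^sub>u v + christoffel M c x u v\<close>;
  the defining equation is the Koszul formula for coordinate (constant) vector fields.
\<close>

definition christoffel ::
  "('a, 'n::finite) rspace \<Rightarrow> ('a, 'n) chart \<Rightarrow> real ^ 'n \<Rightarrow> real ^ 'n \<Rightarrow> real ^ 'n \<Rightarrow> real ^ 'n" where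
  "christoffel M c x u v =
     (THE w. \<forall>z. 2 * metric M c x w z =
        frechet_derivative (\<lambda>y. metric M c y v z) (at x) u
      + frechet_derivative (\<lambda>y. metric M c y u z) (at x) v
      - frechet_derivative (\<lambda>y. metric M c y u v) (at x) z)"

definition curvature ::
  "('a, 'n::finite) rspace \<Rightarrow> ('a, 'n) chart \<Rightarrow> real ^ 'n \<Rightarrow> real ^ 'n \<Rightarrow> real ^ 'n \<Rightarrow> real ^ 'n \<Rightarrow> real ^ 'n"
  where
  "curvature M c x u v w =
       frechet_derivative (\<lambda>y. christoffel M c y v w) (at x) u
     - frechet_derivative (\<lambda>y. christoffel M c y u w) (at x) v
     + christoffel M c x u (christoffel M c x v w)
     - christoffel M c x v (christoffel M c x u w)"

definition sectional_curvature ::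
  "('a, 'n::finite) rspace \<Rightarrow> ('a, 'n) chart \<Rightarrow> real ^ 'n \<Rightarrow> real ^ 'n \<Rightarrow> real ^ 'n \<Rightarrow> real" where
  "sectional_curvature M c x u v =
     metric M c x (curvature M c x u v v) u /
     (metric M c x u u * metric M c x v v - (metric M c x u v)\<^sup>2)"

definition constant_sectional_curvature :: "('a, 'n::finite) rspace \<Rightarrow> real \<Rightarrow> bool" where
  "constant_sectional_curvature M \<kappa> \<longleftrightarrow>
     (\<forall>c\<in>atlas M. \<forall>P\<in>dom_of c. \<forall>u v. u \<noteq> v \<and> independent {u, v} \<longrightarrow>
        sectional_curvature M c (coord c P) u v = \<kappa>)"


definition geodesic_on :: "('a, 'n::finite) rspace \<Rightarrow> real set \<Rightarrow> (real \<Rightarrow> 'a) \<Rightarrow> bool" where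
  "geodesic_on M I \<gamma> \<longleftrightarrow>
     open I \<and> is_interval I \<and> continuous_map (top_of_set I) (top_of M) \<gamma> \<and>
     (\<forall>c\<in>atlas M. \<exists>v. \<forall>s\<in>I. \<gamma> s \<in> dom_of c \<longrightarrow>
        ((\<lambda>t. coord c (\<gamma> t)) has_vector_derivative v s) (at s) \<and>
        (v has_vector_derivative - christoffel M c (coord c (\<gamma> s)) (v s) (v s)) (at s))"

text \<open>
  The tangent space at \<open>P\<close> is identified with \<open>real ^ 'n\<close> by means of one fixed chart
  \<open>chart_at M P\<close> around \<open>P\<close>.
\<close>

definition chart_at :: "('a, 'n::finite) rspace \<Rightarrow> 'a \<Rightarrow> ('a, 'n) chart" where
  "chart_at M P = (SOME c. c \<in> atlas M \<and> P \<in> dom_of c)"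

definition tangent_inner :: "('a, 'n::finite) rspace \<Rightarrow> 'a \<Rightarrow> real ^ 'n \<Rightarrow> real ^ 'n \<Rightarrow> real" where
  "tangent_inner M P = metric M (chart_at M P) (coord (chart_at M P) P)"

definition tangent_norm :: "('a, 'n::finite) rspace \<Rightarrow> 'a \<Rightarrow> real ^ 'n \<Rightarrow> real" where
  "tangent_norm M P \<xi> = sqrt (tangent_inner M P \<xi> \<xi>)"

definition riem_exp :: "('a, 'n::finite) rspace \<Rightarrow> 'a \<Rightarrow> real ^ 'n \<Rightarrow> 'a" where
  "riem_exp M P \<xi> =
     (THE q. \<exists>I \<gamma>. {0..1} \<subseteq> I \<and> geodesic_on M I \<gamma> \<and> \<gamma> 0 = P \<and>
        ((\<lambda>t. coord (chart_at M P) (\<gamma> t)) has_vector_derivative \<xi>) (at 0) \<and> \<gamma> 1 = q)"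

text \<open>
  A linear isometry \<open>E\<close> from \<open>real ^ 'n\<close> onto the tangent space at \<open>P\<close> amounts to an orthonormal
  basis of it; geodesic normal coordinates \<open>x\<close> at \<open>P\<close> are then given by \<open>riem_exp M P (E x)\<close>, and
  \<open>normal_metric M P E x\<close> is the matrix of the metric in these coordinates.
\<close>

definition orthonormal_frame :: "('a, 'n::finite) rspace \<Rightarrow> 'a \<Rightarrow> (real ^ 'n \<Rightarrow> real ^ 'n) \<Rightarrow> bool" where
  "orthonormal_frame M P E \<longleftrightarrow>
     linear E \<and> (\<forall>u v. tangent_inner M P (E u) (E v) = u \<bullet> v)"

definition normal_metric ::
  "('a, 'n::finite) rspace \<Rightarrow> 'a \<Rightarrow> (real ^ 'n \<Rightarrow> real ^ 'n) \<Rightarrow> real ^ 'n \<Rightarrow> real ^ 'n ^ 'n" where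
  "normal_metric M P E x =
     (let q = riem_exp M P (E x);
          D = frechet_derivative (\<lambda>y. coord (chart_at M q) (riem_exp M P (E y))) (at x)
      in \<chi> i j. tangent_inner M q (D (axis i 1)) (D (axis j 1)))"

text \<open>The value does not depend on the choice of the frame.\<close>

definition density :: "('a, 'n::finite) rspace \<Rightarrow> 'a \<Rightarrow> real ^ 'n \<Rightarrow> real" where
  "density M P \<xi> =
     (let E = (SOME E. orthonormal_frame M P E)
      in tangent_norm M P \<xi> ^ (CARD('n) - 1) * sqrt (det (normal_metric M P E (inv E \<xi>))))"

text \<open>
  Only the germ of \<open>\<Theta>\<close> at \<open>0\<close> is meaningful: no completeness is assumed, and how small \<open>\<xi>\<close> has to be
  may depend on \<open>P\<close>.
\<close>

definition density_function :: "('a, 'n::finite) rspace \<Rightarrow> (real \<Rightarrow> real) \<Rightarrow> bool" where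
  "density_function M \<Theta> \<longleftrightarrow>
     (\<forall>P\<in>points M. \<exists>\<delta>>0. \<forall>\<xi>. 0 < tangent_norm M P \<xi> \<and> tangent_norm M P \<xi> < \<delta> \<longrightarrow>
        density M P \<xi> = \<Theta> (tangent_norm M P \<xi>))"

definition harmonic_space :: "('a, 'n::finite) rspace \<Rightarrow> bool" where
  "harmonic_space M \<longleftrightarrow> riemannian_manifold M \<and> (\<exists>\<Theta>. density_function M \<Theta>)"

definition model_density :: "int \<Rightarrow> int \<Rightarrow> int \<Rightarrow> real \<Rightarrow> real" where
  "model_density \<epsilon> m k r =
     (if \<epsilon> = 1 then sin r powi (m - 1) * cos r powi k
      else sinh r powi (m - 1) * cosh r powi k)"

end

theory Submission
  imports Defs "HOL-Real_Asymp.Real_Asymp"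
begin

text \<open>
  Along a unit speed geodesic from \<open>P\<close> in direction \<open>\<theta>\<close> let \<open>J\<^sub>i\<close> be the Jacobi fields vanishing at \<open>P\<close>
  whose covariant derivatives \<open>K\<^sub>i\<close> start as an orthonormal basis.  With the Gram matrices
  \<open>G = \<langle>J\<^sub>i, J\<^sub>j\<rangle>\<close>, \<open>H = \<langle>K\<^sub>i, J\<^sub>j\<rangle>\<close> the density satisfies \<open>det G = t\<^sup>2 \<Theta>(t)\<^sup>2\<close>, and
  \<open>G = t\<^sup>2 - R\<^sub>\<theta> t\<^sup>4 / 3 + o(t\<^sup>4)\<close>, where \<open>R\<^sub>\<theta>\<close> is the Jacobi operator at \<open>P\<close>.  The leading terms of the
  determinant give \<open>m = dim M\<close> and that all Ricci curvatures are equal to \<open>\<epsilon> (m - 1 + 3k)\<close>.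

  The matrix \<open>S = G\<inverse> H\<close> of the shape operator of the geodesic spheres satisfies a Riccati equation whose
  trace expresses \<open>tr S\<^sup>2\<close> by \<open>tr S\<close> and the constant Ricci curvature; and \<open>tr S\<close> is \<open>\<Theta>'/\<Theta>\<close> up to the
  radial eigenvalue \<open>1/t\<close> of \<open>S\<close>.  As \<open>S\<close> is self-adjoint, \<open>tr (S - \<phi>)\<^sup>2 \<ge> 0\<close> on the
  orthogonal complement of the radial direction for every number \<open>\<phi>\<close>.  For \<open>\<phi> = cot t - \<xi> tan t\<close> (and its
  hyperbolic analogue) this trace equals \<open>tan\<^sup>2 t (k + (m - 1) \<xi>\<^sup>2 - 2 \<xi> k)\<close>; \<open>\<xi> = 0\<close> gives \<open>k \<ge> 0\<close> and
  \<open>\<xi> = 1\<close> gives \<open>k \<le> m - 1\<close>.  If the trace vanishes, then \<open>S = \<phi>\<close> there, hence \<open>G\<close> is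
  \<open>(sin t cos\<^sup>\<xi> t)\<^sup>2\<close> there, and its \<open>t\<^sup>4\<close> term yields \<open>R\<^sub>\<theta> = \<epsilon> (1 + 3 \<xi>)\<close>.
\<close>

section \<open>Calculus of \<open>C\<^sup>k\<close> maps\<close>

lemma frechet_derivative_cong_open:
  assumes "open S" "x \<in> S" "\<And>y. y \<in> S \<Longrightarrow> f y = g y"
  shows "frechet_derivative f (at x) = frechet_derivative g (at x)"
proof -
  have "(f has_derivative D) (at x) \<longleftrightarrow> (g has_derivative D) (at x)" for D
    using has_derivative_transform_within_open[of f D x UNIV S g]
      has_derivative_transform_within_open[of g D x UNIV S f] assms by auto
  then show ?thesis unfolding frechet_derivative_def by simp
qed

lemma Ck_on_cong:
  assumes "open S" "\<And>y. y \<in> S \<Longrightarrow> f y = g y"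
  shows "Ck_on n S f \<longleftrightarrow> Ck_on n S g"
  using assms(2)
proof (induction n arbitrary: f g)
  case 0
  then show ?case by (auto intro: continuous_on_cong)
next
  case (Suc n)
  have fd: "frechet_derivative f (at x) = frechet_derivative g (at x)" if "x \<in> S" for x
    using frechet_derivative_cong_open[OF assms(1) that] Suc.prems by blast
  have "f differentiable (at x) \<longleftrightarrow> g differentiable (at x)" if "x \<in> S" for x
    unfolding differentiable_def
    using has_derivative_transform_within_open[of f _ x UNIV S g]
      has_derivative_transform_within_open[of g _ x UNIV S f] assms(1) Suc.prems that by metis
  moreover have "Ck_on n S (\<lambda>x. frechet_derivative f (at x) v)
      \<longleftrightarrow> Ck_on n S (\<lambda>x. frechet_derivative g (at x) v)" for v
    by (rule Suc.IH) (simp add: fd)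
  ultimately show ?case by simp
qed

lemma Ck_on_SucI:
  assumes "open S" "\<And>x. x \<in> S \<Longrightarrow> (f has_derivative f' x) (at x)"
    and "\<And>v. Ck_on n S (\<lambda>x. f' x v)"
  shows "Ck_on (Suc n) S f"
proof -
  have fd: "frechet_derivative f (at x) = f' x" if "x \<in> S" for x
    using frechet_derivative_at[OF assms(2)[OF that]] by simp
  have "Ck_on n S (\<lambda>x. frechet_derivative f (at x) v)" for v
    using Ck_on_cong[OF assms(1), of "\<lambda>x. frechet_derivative f (at x) v" "\<lambda>x. f' x v" n] fd assms(3)
    by auto
  then show ?thesis using assms(2) by (auto simp: differentiable_def)
qed

lemma Ck_on_has_derivative:
  "Ck_on (Suc n) S f \<Longrightarrow> x \<in> S \<Longrightarrow> (f has_derivative frechet_derivative f (at x)) (at x)"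
  by (auto simp: frechet_derivative_works)

lemma Ck_on_Suc_imp: "Ck_on (Suc n) S f \<Longrightarrow> Ck_on n S f"
proof (induction n arbitrary: f)
  case 0
  then show ?case
    by (auto intro!: differentiable_imp_continuous_on differentiable_at_imp_differentiable_on)
next
  case (Suc n)
  then show ?case by simp
qed

lemma Ck_on_continuous_on: "Ck_on n S f \<Longrightarrow> continuous_on S f"
  by (induction n) (auto dest: Ck_on_Suc_imp simp del: Ck_on.simps(2))

lemma Ck_on_tendsto_compose:
  assumes "open S" "Ck_on n S f" "(X \<longlongrightarrow> x) F" "x \<in> S"
  shows "((\<lambda>t. f (X t)) \<longlongrightarrow> f x) F"
proof -
  have "isCont f x"
    using Ck_on_continuous_on[OF assms(2)] assms(1,4) by (simp add: continuous_on_eq_continuous_at)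
  then show ?thesis using assms(3) by (rule isCont_tendsto_compose)
qed

lemma Ck_on_const: "open S \<Longrightarrow> Ck_on n S (\<lambda>x. c)"
proof (induction n arbitrary: c)
  case (Suc n)
  then show ?case by (intro Ck_on_SucI[where f'="\<lambda>x v. 0"]) auto
qed simp

lemma Ck_on_add:
  assumes "open S"
  shows "Ck_on n S f \<Longrightarrow> Ck_on n S g \<Longrightarrow> Ck_on n S (\<lambda>x. f x + g x)"
proof (induction n arbitrary: f g)
  case 0
  then show ?case by (simp add: continuous_on_add)
next
  case (Suc n)
  show ?case
    by (rule Ck_on_SucI[OF assms has_derivative_add[OF Ck_on_has_derivative Ck_on_has_derivative]])
      (use Suc in auto)
qed

lemma (in bounded_bilinear) Ck_on:
  assumes "open S"
  shows "Ck_on n S f \<Longrightarrow> Ck_on n S g \<Longrightarrow> Ck_on n S (\<lambda>x. prod (f x) (g x))"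
proof (induction n arbitrary: f g)
  case 0
  then show ?case by (simp add: continuous_on)
next
  case (Suc n)
  show ?case
    by (rule Ck_on_SucI[OF assms FDERIV[OF Ck_on_has_derivative Ck_on_has_derivative]])
      (use Suc Ck_on_Suc_imp[OF Suc.prems(1)] Ck_on_Suc_imp[OF Suc.prems(2)] in
        \<open>auto intro!: Ck_on_add[OF assms]\<close>)
qed

lemmas Ck_on_mult = bounded_bilinear.Ck_on[OF bounded_bilinear_mult]
lemmas Ck_on_scaleR = bounded_bilinear.Ck_on[OF bounded_bilinear_scaleR]

lemma Ck_on_uminus: "open S \<Longrightarrow> Ck_on n S f \<Longrightarrow> Ck_on n S (\<lambda>x. - f x)"
  using Ck_on_scaleR[of S n "\<lambda>_. -1" f] Ck_on_const[of S n "-1::real"] by simp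

lemma Ck_on_diff:
  "open S \<Longrightarrow> Ck_on n S f \<Longrightarrow> Ck_on n S g \<Longrightarrow> Ck_on n S (\<lambda>x. f x - g x)"
  using Ck_on_add[of S n f "\<lambda>x. - g x"] Ck_on_uminus[of S n g] by simp

lemma Ck_on_sum:
  "open S \<Longrightarrow> (\<And>i. i \<in> I \<Longrightarrow> Ck_on n S (f i)) \<Longrightarrow> Ck_on n S (\<lambda>x. \<Sum>i\<in>I. f i x)"
  by (induction I rule: infinite_finite_induct) (auto intro!: Ck_on_const Ck_on_add)

lemma Ck_on_prod:
  fixes f :: "'i \<Rightarrow> 'a::real_normed_vector \<Rightarrow> real"
  shows "open S \<Longrightarrow> (\<And>i. i \<in> I \<Longrightarrow> Ck_on n S (f i)) \<Longrightarrow> Ck_on n S (\<lambda>x. \<Prod>i\<in>I. f i x)"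
  by (induction I rule: infinite_finite_induct) (auto intro!: Ck_on_const Ck_on_mult)

lemma Ck_on_inverse:
  fixes f :: "'a::real_normed_vector \<Rightarrow> real"
  assumes "open S" "\<And>x. x \<in> S \<Longrightarrow> f x \<noteq> 0"
  shows "Ck_on n S f \<Longrightarrow> Ck_on n S (\<lambda>x. inverse (f x))"
proof (induction n)
  case 0
  then show ?case using assms by (auto intro: continuous_on_inverse)
next
  case (Suc n)
  note f = Ck_on_Suc_imp[OF Suc.prems]
  show ?case
    by (rule Ck_on_SucI[OF assms(1) Deriv.has_derivative_inverse[OF _ Ck_on_has_derivative[OF Suc.prems]]])
      (use assms Suc Suc.IH[OF f] in \<open>auto intro!: Ck_on_mult Ck_on_uminus\<close>)
qed

lemma Ck_on_bounded_linear_comp: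
  assumes "bounded_linear h" "open S"
  shows "Ck_on n S f \<Longrightarrow> Ck_on n S (\<lambda>x. h (f x))"
proof (induction n arbitrary: f)
  case 0
  then show ?case using assms by (simp add: bounded_linear.continuous_on)
next
  case (Suc n)
  show ?case
    by (rule Ck_on_SucI[OF assms(2) bounded_linear.has_derivative[OF assms(1) Ck_on_has_derivative]])
      (use Suc in auto)
qed

lemma Ck_on_comp_bounded_linear:
  assumes h: "bounded_linear h" and "open S" "open T" "h ` T \<subseteq> S"
  shows "Ck_on n S f \<Longrightarrow> Ck_on n T (\<lambda>x. f (h x))"
proof (induction n arbitrary: f)
  case 0
  then show ?case
    using continuous_on_compose2[OF _ linear_continuous_on[OF h] assms(4), of f] by simp
next
  case (Suc n)
  have "((\<lambda>x. f (h x)) has_derivative (\<lambda>v. frechet_derivative f (at (h x)) (h v))) (at x)"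
    if "x \<in> T" for x
    by (rule has_derivative_compose[where f=h, OF bounded_linear_imp_has_derivative[OF h]])
      (use Ck_on_has_derivative[OF Suc.prems, of "h x"] that assms(4) in auto)
  then show ?case
    by (rule Ck_on_SucI[OF assms(3)]) (use Suc in auto)
qed

lemma Ck_on_bounded_linear: "bounded_linear h \<Longrightarrow> open S \<Longrightarrow> Ck_on n S h"
proof (induction n)
  case (Suc n)
  show ?case
    by (rule Ck_on_SucI[OF Suc(3) bounded_linear_imp_has_derivative[OF Suc(2)]])
      (simp add: Ck_on_const Suc)
qed (simp add: linear_continuous_on)

lemma Ck_on_Pair:
  assumes "open S" "Ck_on n S f" "Ck_on n S h"
  shows "Ck_on n S (\<lambda>x. (f x, h x))"
proof -
  have "bounded_linear (\<lambda>u::'b. (u, 0::'c))" "bounded_linear (\<lambda>u::'c. (0::'b, u))"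
    by (auto intro!: bounded_linear_Pair bounded_linear_ident bounded_linear_zero)
  then have "Ck_on n S (\<lambda>x. (f x, 0) + (0, h x))"
    using assms by (intro Ck_on_add Ck_on_bounded_linear_comp[of "\<lambda>u. (u, 0)"]
        Ck_on_bounded_linear_comp[of "\<lambda>u. (0, u)"])
  then show ?thesis by simp
qed

lemma Ck_on_componentwise:
  fixes f :: "'a::real_normed_vector \<Rightarrow> real ^ 'n"
  assumes "open S" "\<And>i. Ck_on n S (\<lambda>x. f x $ i)"
  shows "Ck_on n S f"
proof -
  have "Ck_on n S (\<lambda>x. \<Sum>i\<in>UNIV. f x $ i *\<^sub>R axis i (1::real))"
    using assms by (intro Ck_on_sum Ck_on_scaleR Ck_on_const)
  moreover have "(\<Sum>i\<in>UNIV. f x $ i *\<^sub>R axis i (1::real)) = f x" for x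
    by (simp add: scalar_mult_eq_scaleR[symmetric] basis_expansion)
  ultimately show ?thesis by simp
qed

lemma Ck_on_det:
  fixes A :: "'a::real_normed_vector \<Rightarrow> real ^ 'n ^ 'n"
  assumes "open S" "\<And>i j. Ck_on n S (\<lambda>x. A x $ i $ j)"
  shows "Ck_on n S (\<lambda>x. det (A x))"
  unfolding det_def using assms
  by (intro Ck_on_sum Ck_on_mult Ck_on_const Ck_on_prod)

lemma Ck_on_linear_system:
  fixes A :: "'a::real_normed_vector \<Rightarrow> real ^ 'n ^ 'n" and b w :: "'a \<Rightarrow> real ^ 'n"
  assumes S: "open S" and A: "\<And>i j. Ck_on n S (\<lambda>x. A x $ i $ j)"
    and b: "\<And>i. Ck_on n S (\<lambda>x. b x $ i)"
    and "\<And>x. x \<in> S \<Longrightarrow> det (A x) \<noteq> 0" and w: "\<And>x. x \<in> S \<Longrightarrow> A x *v w x = b x"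
  shows "Ck_on n S w"
proof (rule Ck_on_componentwise[OF S])
  fix k
  let ?B = "\<lambda>x. \<chi> i j. if j = k then b x $ i else A x $ i $ j"
  have solution: "w x $ k = det (?B x) * inverse (det (A x))" if "x \<in> S" for x
    using iffD1[OF cramer w] assms(4) that by (simp add: divide_inverse)
  have "Ck_on n S (\<lambda>x. det (?B x) * inverse (det (A x)))"
  proof (intro Ck_on_mult[OF S] Ck_on_inverse[OF S] Ck_on_det[OF S] A)
    fix i j show "Ck_on n S (\<lambda>x. ?B x $ i $ j)" by (cases "j = k") (simp_all add: A b)
  qed (use assms in auto)
  then show "Ck_on n S (\<lambda>x. w x $ k)"
    using Ck_on_cong[OF S, of "\<lambda>x. w x $ k" "\<lambda>x. det (?B x) * inverse (det (A x))"] solution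
    by simp
qed

lemma Blinfun_eq_sum_Basis:
  fixes A :: "'a::euclidean_space \<Rightarrow> 'b::real_normed_vector"
  assumes "bounded_linear A"
  shows "Blinfun A = (\<Sum>b\<in>Basis. blinfun_scaleR_left (A b) o\<^sub>L blinfun_inner_left b)"
proof (rule blinfun_eqI)
  fix u
  have "A (\<Sum>b\<in>Basis. (u \<bullet> b) *\<^sub>R b) = (\<Sum>b\<in>Basis. (u \<bullet> b) *\<^sub>R A b)"
    using bounded_linear.linear[OF assms] by (simp add: linear_sum linear_scale)
  then have "A u = (\<Sum>b\<in>Basis. (u \<bullet> b) *\<^sub>R A b)" by (simp add: euclidean_representation)
  then show "blinfun_apply (Blinfun A) u =
      blinfun_apply (\<Sum>b\<in>Basis. blinfun_scaleR_left (A b) o\<^sub>L blinfun_inner_left b) u"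
    by (simp add: bounded_linear_Blinfun_apply[OF assms] blinfun.sum_left)
qed

lemma Ck_on_Blinfun_frechet_derivative:
  fixes f :: "'a::euclidean_space \<Rightarrow> 'b::real_normed_vector"
  assumes S: "open S" and f: "Ck_on (Suc n) S f"
  shows "Ck_on n S (\<lambda>x. Blinfun (frechet_derivative f (at x)))"
proof -
  have "Ck_on n S (\<lambda>x. \<Sum>b\<in>Basis. blinfun_scaleR_left (frechet_derivative f (at x) b) o\<^sub>L blinfun_inner_left b)"
    using f
    by (intro Ck_on_sum S bounded_bilinear.Ck_on[OF bounded_bilinear_blinfun_compose] Ck_on_const
        Ck_on_bounded_linear_comp[OF bounded_linear_blinfun_scaleR_left]) simp
  then show ?thesis
    using Ck_on_cong[OF S Blinfun_eq_sum_Basis, of "\<lambda>x. frechet_derivative f (at x)"]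
      has_derivative_bounded_linear[OF Ck_on_has_derivative[OF f]] by blast
qed

lemma C1_imp_lipschitz_on_cball:
  fixes f :: "'a::euclidean_space \<Rightarrow> 'b::real_normed_vector"
  assumes S: "open S" "cball p R \<subseteq> S" and f: "Ck_on (Suc 0) S f"
  obtains L where "L-lipschitz_on (cball p R) f"
proof -
  let ?D = "\<lambda>x. Blinfun (frechet_derivative f (at x))"
  have "continuous_on (cball p R) ?D"
    by (rule continuous_on_subset[OF Ck_on_continuous_on[OF Ck_on_Blinfun_frechet_derivative[OF S(1) f]] S(2)])
  then have "bounded (?D ` cball p R)"
    by (intro compact_imp_bounded compact_continuous_image) auto
  then obtain L where L: "0 \<le> L" "\<And>x. x \<in> cball p R \<Longrightarrow> norm (?D x) \<le> L"
    by (auto simp: bounded_pos dest: less_imp_le)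
  have "L-lipschitz_on (cball p R) f"
  proof (rule bounded_derivative_imp_lipschitz)
    fix x assume x: "x \<in> cball p R"
    have d: "(f has_derivative frechet_derivative f (at x)) (at x)"
      using Ck_on_has_derivative[OF f] x S(2) by blast
    then show "(f has_derivative frechet_derivative f (at x)) (at x within cball p R)"
      by (rule has_derivative_at_withinI)
    show "onorm (frechet_derivative f (at x)) \<le> L"
      using L(2)[OF x] bounded_linear_Blinfun_apply[OF has_derivative_bounded_linear[OF d]]
      by (simp add: norm_blinfun.rep_eq)
  qed (use L in auto)
  then show ?thesis by (rule that)
qed

lemma C1_imp_local_lipschitz:
  fixes f :: "'a::euclidean_space \<Rightarrow> 'b::real_normed_vector"
  assumes S: "open S" and f: "Ck_on (Suc 0) S f"
  shows "local_lipschitz T S (\<lambda>_. f)"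
proof (rule local_lipschitzI)
  fix x assume "x \<in> S"
  then obtain R where R: "R > 0" "cball x R \<subseteq> S" using S open_contains_cball by blast
  obtain L where "L-lipschitz_on (cball x R) f" by (rule C1_imp_lipschitz_on_cball[OF S R(2) f])
  then have "L-lipschitz_on (cball x R \<inter> S) f" by (rule lipschitz_on_subset) auto
  with R(1) show "\<exists>u>0. \<exists>L. \<forall>t\<in>cball t u \<inter> T. L-lipschitz_on (cball x u \<inter> S) f" for t by blast
qed

lemma has_real_derivative_along_line:
  assumes "(f has_derivative D) (at (x + s *\<^sub>R u))"
  shows "((\<lambda>s. f (x + s *\<^sub>R u)) has_real_derivative D u) (at s)"
proof -
  have "((\<lambda>s. f (x + s *\<^sub>R u)) has_derivative (\<lambda>h. D (h *\<^sub>R u))) (at s)"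
    by (rule has_derivative_compose[where f="\<lambda>s. x + s *\<^sub>R u", OF _ assms]) (auto intro!: derivative_eq_intros)
  then show ?thesis
    unfolding has_field_derivative_def
    by (rule has_derivative_eq_rhs)
      (simp add: fun_eq_iff linear_scale[OF has_derivative_linear[OF assms]] mult.commute)
qed

lemma second_difference_mean_value:
  fixes f :: "'a::real_normed_vector \<Rightarrow> real"
  assumes f: "Ck_on 2 S f" and t: "t > 0"
    and inS: "\<And>a b. 0 \<le> a \<Longrightarrow> a \<le> t \<Longrightarrow> 0 \<le> b \<Longrightarrow> b \<le> t \<Longrightarrow> x + a *\<^sub>R u + b *\<^sub>R v \<in> S"
  obtains a b where "0 < a" "a < t" "0 < b" "b < t"
    "f (x + t *\<^sub>R u + t *\<^sub>R v) - f (x + t *\<^sub>R u) - f (x + t *\<^sub>R v) + f x =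
     t\<^sup>2 * frechet_derivative (\<lambda>y. frechet_derivative f (at y) u) (at (x + a *\<^sub>R u + b *\<^sub>R v)) v"
proof -
  let ?D = "\<lambda>y. frechet_derivative f (at y) u"
  have df: "(f has_derivative frechet_derivative f (at y)) (at y)"
    and dD: "(?D has_derivative frechet_derivative ?D (at y)) (at y)" if "y \<in> S" for y
    using f that by (auto simp: numeral_2_eq_2 frechet_derivative_works)
  let ?\<Delta> = "\<lambda>a. f (x + t *\<^sub>R v + a *\<^sub>R u) - f (x + a *\<^sub>R u)"
  have "(?\<Delta> has_real_derivative ?D (x + t *\<^sub>R v + a *\<^sub>R u) - ?D (x + a *\<^sub>R u)) (at a)"
    if "0 \<le> a" "a \<le> t" for a
    using inS[of a t] inS[of a 0] that t
    by (intro DERIV_diff has_real_derivative_along_line df) (simp_all add: algebra_simps)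
  from MVT2[OF t this] obtain a where a: "0 < a" "a < t"
    and \<Delta>: "?\<Delta> t - ?\<Delta> 0 = t * (?D (x + t *\<^sub>R v + a *\<^sub>R u) - ?D (x + a *\<^sub>R u))" by auto
  have "((\<lambda>b. ?D (x + a *\<^sub>R u + b *\<^sub>R v)) has_real_derivative
      frechet_derivative ?D (at (x + a *\<^sub>R u + b *\<^sub>R v)) v) (at b)" if "0 \<le> b" "b \<le> t" for b
    using inS[of a b] that a by (intro has_real_derivative_along_line dD) simp
  from MVT2[OF t this] obtain b where b: "0 < b" "b < t"
    and D: "?D (x + a *\<^sub>R u + t *\<^sub>R v) - ?D (x + a *\<^sub>R u) =
      t * frechet_derivative ?D (at (x + a *\<^sub>R u + b *\<^sub>R v)) v" by auto
  show ?thesis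
    by (rule that[OF a b]) (use \<Delta> D in \<open>simp add: algebra_simps power2_eq_square\<close>)
qed

lemma small_parallelogram_subset:
  fixes x u v :: "'a::real_normed_vector"
  assumes "open S" "x \<in> S"
  obtains \<tau> where "\<tau> > 0"
    "\<And>a b t. t < \<tau> \<Longrightarrow> 0 \<le> a \<Longrightarrow> a \<le> t \<Longrightarrow> 0 \<le> b \<Longrightarrow> b \<le> t \<Longrightarrow> x + a *\<^sub>R u + b *\<^sub>R v \<in> S"
proof -
  obtain r where r: "r > 0" "ball x r \<subseteq> S" using assms openE by blast
  define \<tau> where "\<tau> = r / (norm u + norm v + 1)"
  have \<tau>: "\<tau> > 0" "\<tau> * (norm u + norm v + 1) = r"
    using r(1) by (simp_all add: \<tau>_def add_nonneg_pos add_nonneg_eq_0_iff)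
  have "x + a *\<^sub>R u + b *\<^sub>R v \<in> S" if "t < \<tau>" "0 \<le> a" "a \<le> t" "0 \<le> b" "b \<le> t" for a b t
  proof -
    have "norm (a *\<^sub>R u + b *\<^sub>R v) \<le> a * norm u + b * norm v"
      using norm_triangle_ineq[of "a *\<^sub>R u" "b *\<^sub>R v"] that by simp
    also have "\<dots> \<le> \<tau> * norm u + \<tau> * norm v"
      using that by (intro add_mono mult_right_mono) auto
    also have "\<dots> < r" using \<tau> by (simp add: algebra_simps)
    finally show ?thesis using r(2) by (auto simp: dist_norm subset_iff norm_minus_commute add.assoc)
  qed
  then show ?thesis by (rule that[OF \<tau>(1)])
qed

lemma second_difference_quotient_tendsto:
  fixes f :: "'a::real_normed_vector \<Rightarrow> real"
  assumes S: "open S" "x \<in> S" and f: "Ck_on 2 S f"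
  shows "((\<lambda>t. (f (x + t *\<^sub>R u + t *\<^sub>R v) - f (x + t *\<^sub>R u) - f (x + t *\<^sub>R v) + f x) / t\<^sup>2) \<longlongrightarrow>
    frechet_derivative (\<lambda>y. frechet_derivative f (at y) u) (at x) v) (at_right 0)"
proof -
  let ?D2 = "\<lambda>y. frechet_derivative (\<lambda>y. frechet_derivative f (at y) u) (at y) v"
  let ?\<Delta> = "\<lambda>t. f (x + t *\<^sub>R u + t *\<^sub>R v) - f (x + t *\<^sub>R u) - f (x + t *\<^sub>R v) + f x"
  obtain \<tau> where \<tau>: "\<tau> > 0" and inS: "\<And>a b t. t < \<tau> \<Longrightarrow> 0 \<le> a \<Longrightarrow> a \<le> t \<Longrightarrow> 0 \<le> b \<Longrightarrow> b \<le> t \<Longrightarrow>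
      x + a *\<^sub>R u + b *\<^sub>R v \<in> S"
    by (rule small_parallelogram_subset[OF S, of u v], rule that)
  have "\<exists>a b. (0 < a \<and> a < t) \<and> (0 < b \<and> b < t) \<and> ?\<Delta> t / t\<^sup>2 = ?D2 (x + a *\<^sub>R u + b *\<^sub>R v)"
    if t: "t \<in> {0<..<\<tau>}" for t
  proof -
    from t have "0 < t" "t < \<tau>" by auto
    obtain a b where "0 < a" "a < t" "0 < b" "b < t"
      "?\<Delta> t = t\<^sup>2 * ?D2 (x + a *\<^sub>R u + b *\<^sub>R v)"
      by (rule second_difference_mean_value[OF f \<open>0 < t\<close> inS[OF \<open>t < \<tau>\<close>]])
    moreover from this have "?\<Delta> t / t\<^sup>2 = ?D2 (x + a *\<^sub>R u + b *\<^sub>R v)" using \<open>0 < t\<close> by simp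
    ultimately show ?thesis by blast
  qed
  then obtain a b where a: "\<And>t. t \<in> {0<..<\<tau>} \<Longrightarrow> 0 < a t \<and> a t < t"
    and b: "\<And>t. t \<in> {0<..<\<tau>} \<Longrightarrow> 0 < b t \<and> b t < t"
    and \<Delta>: "\<And>t. t \<in> {0<..<\<tau>} \<Longrightarrow> ?\<Delta> t / t\<^sup>2 = ?D2 (x + a t *\<^sub>R u + b t *\<^sub>R v)" by metis
  have near0: "\<forall>\<^sub>F t in at_right 0. t \<in> {0<..<\<tau>}"
    using \<tau> by (rule eventually_at_right_real)
  have squeeze: "(c \<longlongrightarrow> 0) (at_right 0)" if "\<And>t. t \<in> {0<..<\<tau>} \<Longrightarrow> 0 < c t \<and> c t < t" for c
    by (rule tendsto_sandwich[OF _ _ tendsto_const tendsto_ident_at])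
      (use near0 that in \<open>auto elim!: eventually_mono dest: less_imp_le\<close>)
  have "(a \<longlongrightarrow> 0) (at_right 0)" by (rule squeeze) (rule a)
  moreover have "(b \<longlongrightarrow> 0) (at_right 0)" by (rule squeeze) (rule b)
  ultimately have "((\<lambda>t. x + a t *\<^sub>R u + b t *\<^sub>R v) \<longlongrightarrow> x + 0 *\<^sub>R u + 0 *\<^sub>R v) (at_right 0)"
    by (intro tendsto_add tendsto_scaleR tendsto_const)
  then have "((\<lambda>t. x + a t *\<^sub>R u + b t *\<^sub>R v) \<longlongrightarrow> x) (at_right 0)" by simp
  moreover have "isCont ?D2 x"
    using f S by (simp add: numeral_2_eq_2 continuous_on_eq_continuous_at)
  ultimately have "((\<lambda>t. ?D2 (x + a t *\<^sub>R u + b t *\<^sub>R v)) \<longlongrightarrow> ?D2 x) (at_right 0)"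
    by (rule isCont_tendsto_compose[rotated])
  then show ?thesis
    by (rule Lim_transform_eventually) (use near0 in \<open>eventually_elim, simp only: \<Delta>\<close>)
qed

lemma symmetric_second_derivative:
  fixes f :: "'a::real_normed_vector \<Rightarrow> 'b::real_inner"
  assumes S: "open S" "x \<in> S" and f: "Ck_on 2 S f"
  shows "frechet_derivative (\<lambda>y. frechet_derivative f (at y) u) (at x) v =
         frechet_derivative (\<lambda>y. frechet_derivative f (at y) v) (at x) u"
proof -
  let ?D2 = "\<lambda>f u. frechet_derivative (\<lambda>y. frechet_derivative f (at y) u) (at x)"
  have real_case: "?D2 h u v = ?D2 h v u" if h: "Ck_on 2 S h" for h :: "'a \<Rightarrow> real"
  proof (rule tendsto_unique[OF trivial_limit_at_right_real second_difference_quotient_tendsto[OF S h]])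
    show "((\<lambda>t. (h (x + t *\<^sub>R u + t *\<^sub>R v) - h (x + t *\<^sub>R u) - h (x + t *\<^sub>R v) + h x) / t\<^sup>2) \<longlongrightarrow> ?D2 h v u)
        (at_right 0)"
      using second_difference_quotient_tendsto[OF S h, of v u] by (simp add: algebra_simps)
  qed
  have inner: "frechet_derivative (\<lambda>y. h y \<bullet> b) (at y) w = frechet_derivative h (at y) w \<bullet> b"
    if "h differentiable (at y)" for h :: "'a \<Rightarrow> 'b" and y w b
  proof -
    have "((\<lambda>y. h y \<bullet> b) has_derivative (\<lambda>w. frechet_derivative h (at y) w \<bullet> b)) (at y)"
      by (intro bounded_linear.has_derivative[OF bounded_linear_inner_left])
        (use that frechet_derivative_works in blast)
    from frechet_derivative_at[OF this] show ?thesis by metis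
  qed
  have f1: "f differentiable (at y)" if "y \<in> S" for y using f that by (simp add: numeral_2_eq_2)
  have f2: "(\<lambda>y. frechet_derivative f (at y) w) differentiable (at x)" for w
    using f S by (simp add: numeral_2_eq_2)
  have "?D2 (\<lambda>y. f y \<bullet> b) w z = ?D2 f w z \<bullet> b" for w z b
    using frechet_derivative_cong_open[OF S, of "\<lambda>y. frechet_derivative (\<lambda>y. f y \<bullet> b) (at y) w"
        "\<lambda>y. frechet_derivative f (at y) w \<bullet> b"] inner[OF f1] inner[OF f2] by simp
  then have "?D2 f u v \<bullet> b = ?D2 f v u \<bullet> b" for b
    using real_case[OF Ck_on_bounded_linear_comp[OF bounded_linear_inner_left S(1) f]] by metis
  then show ?thesis by (rule iffD1[OF vector_eq_rdot, OF allI])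
qed

lemma difference_quotient_tendsto:
  fixes f :: "'a::real_normed_vector \<Rightarrow> 'b::real_normed_vector"
  assumes f: "(f has_derivative f') (at x)"
    and y: "((\<lambda>t. (y t - x) /\<^sub>R r t) \<longlongrightarrow> d) F"
    and r: "(r \<longlongrightarrow> 0) F" "\<forall>\<^sub>F t in F. r t \<noteq> 0"
  shows "((\<lambda>t. (f (y t) - f x) /\<^sub>R r t) \<longlongrightarrow> f' d) F"
proof -
  interpret f': bounded_linear f' using f by (rule has_derivative_bounded_linear)
  define E where "E z = (f z - f x - f' (z - x)) /\<^sub>R norm (z - x)" for z
  have "E x = 0" by (simp add: E_def f'.zero)
  moreover have "(E \<longlongrightarrow> 0) (at x)"
    using f unfolding has_derivative_at_within E_def[abs_def] by (rule conjunct2)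
  ultimately have "(E \<longlongrightarrow> 0) (nhds x)" using tendsto_at_iff_tendsto_nhds[of E x] by simp
  moreover have "(y \<longlongrightarrow> x) F"
  proof (rule Lim_transform_eventually)
    have "((\<lambda>t. r t *\<^sub>R ((y t - x) /\<^sub>R r t) + x) \<longlongrightarrow> 0 *\<^sub>R d + x) F"
      by (intro tendsto_intros y r)
    then show "((\<lambda>t. r t *\<^sub>R ((y t - x) /\<^sub>R r t) + x) \<longlongrightarrow> x) F" by simp
    show "\<forall>\<^sub>F t in F. r t *\<^sub>R ((y t - x) /\<^sub>R r t) + x = y t"
      using r(2) by eventually_elim simp
  qed
  ultimately have E: "((\<lambda>t. E (y t)) \<longlongrightarrow> 0) F" by (rule filterlim_compose)
  have "((\<lambda>t. norm ((y t - x) /\<^sub>R r t) * norm (E (y t))) \<longlongrightarrow> norm d * norm (0::'b)) F"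
    by (intro tendsto_intros y E)
  then have "((\<lambda>t. norm ((norm (y t - x) / r t) *\<^sub>R E (y t))) \<longlongrightarrow> 0) F"
    by (simp add: divide_inverse abs_mult mult_ac)
  from tendsto_add[OF f'.tendsto[OF y] tendsto_norm_zero_cancel[OF this]]
  have "((\<lambda>t. f' ((y t - x) /\<^sub>R r t) + (norm (y t - x) / r t) *\<^sub>R E (y t)) \<longlongrightarrow> f' d) F" by simp
  moreover have "f' ((y t - x) /\<^sub>R r t) + (norm (y t - x) / r t) *\<^sub>R E (y t) = (f (y t) - f x) /\<^sub>R r t" for t
  proof (cases "y t = x")
    case False
    then have "(norm (y t - x) / r t) *\<^sub>R E (y t) = (f (y t) - f x - f' (y t - x)) /\<^sub>R r t"
      by (simp add: E_def divide_inverse)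
    then show ?thesis unfolding f'.scaleR by (simp add: scaleR_diff_right)
  qed (simp add: f'.zero)
  ultimately show ?thesis by simp
qed

lemma has_vector_derivative_iff_tendsto:
  "(f has_vector_derivative f') (at t within S) \<longleftrightarrow>
    ((\<lambda>s. (f s - f t) /\<^sub>R (s - t)) \<longlongrightarrow> f') (at t within S)"
proof -
  have "norm ((f s - f t - (s - t) *\<^sub>R f') /\<^sub>R norm (s - t)) = norm ((f s - f t) /\<^sub>R (s - t) - f')"
    if "s \<noteq> t" for s
  proof -
    have "(f s - f t) /\<^sub>R (s - t) - f' = (f s - f t - (s - t) *\<^sub>R f') /\<^sub>R (s - t)"
      using that by (simp add: scaleR_diff_right)
    then show ?thesis by simp
  qed
  then have "((\<lambda>s. norm ((f s - f t - (s - t) *\<^sub>R f') /\<^sub>R norm (s - t))) \<longlongrightarrow> 0) (at t within S) \<longleftrightarrow>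
      ((\<lambda>s. norm ((f s - f t) /\<^sub>R (s - t) - f')) \<longlongrightarrow> 0) (at t within S)"
    by (intro tendsto_cong) (simp add: eventually_at_filter)
  then show ?thesis
    by (simp only: has_vector_derivative_def has_derivative_at_within bounded_linear_scaleR_left
        simp_thms tendsto_norm_zero_iff LIM_zero_iff)
qed

lemma has_vector_derivative_scale_arg:
  fixes f :: "real \<Rightarrow> 'a::real_normed_vector"
  assumes "(f has_vector_derivative f') (at (k * t))"
  shows "((\<lambda>t. f (k * t)) has_vector_derivative k *\<^sub>R f') (at t)"
proof -
  have "((\<lambda>t. k * t) has_vector_derivative k) (at t)" by (auto intro!: derivative_eq_intros)
  from vector_diff_chain_at[OF this assms] show ?thesis by (simp add: o_def)
qed

lemma linear_frechet_derivative: "f differentiable (at x) \<Longrightarrow> linear (frechet_derivative f (at x))"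
  using frechet_derivative_works has_derivative_linear by blast

lemma linear_frechet_derivative_param:
  assumes U: "open U" "x \<in> U" and lin: "\<And>y. y \<in> U \<Longrightarrow> linear (\<lambda>u. f u y)"
    and diff: "\<And>u. f u differentiable (at x)"
  shows "linear (\<lambda>u. frechet_derivative (f u) (at x) w)"
proof (rule linearI)
  have d: "(f u has_derivative frechet_derivative (f u) (at x)) (at x)" for u
    using diff frechet_derivative_works by blast
  fix u v and r :: real
  have "frechet_derivative (f (u + v)) (at x) = frechet_derivative (\<lambda>y. f u y + f v y) (at x)"
    by (rule frechet_derivative_cong_open[OF U]) (simp add: linear_add[OF lin])
  also have "\<dots> = (\<lambda>w. frechet_derivative (f u) (at x) w + frechet_derivative (f v) (at x) w)"
    by (rule frechet_derivative_at[symmetric]) (intro has_derivative_add d)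
  finally show "frechet_derivative (f (u + v)) (at x) w =
      frechet_derivative (f u) (at x) w + frechet_derivative (f v) (at x) w" by simp
  have "frechet_derivative (f (r *\<^sub>R u)) (at x) = frechet_derivative (\<lambda>y. r *\<^sub>R f u y) (at x)"
    by (rule frechet_derivative_cong_open[OF U]) (simp add: linear_scale[OF lin])
  also have "\<dots> = (\<lambda>w. r *\<^sub>R frechet_derivative (f u) (at x) w)"
    by (rule frechet_derivative_at[symmetric])
      (intro bounded_linear.has_derivative[OF bounded_linear_scaleR_right] d)
  finally show "frechet_derivative (f (r *\<^sub>R u)) (at x) w = r *\<^sub>R frechet_derivative (f u) (at x) w"
    by simp
qed

lemma linear_expand_axis:
  fixes f :: "real ^ 'n \<Rightarrow> 'b::real_vector"
  assumes "linear f"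
  shows "f u = (\<Sum>i\<in>UNIV. u $ i *\<^sub>R f (axis i 1))"
proof -
  have "f (\<Sum>i\<in>UNIV. u $ i *\<^sub>R axis i 1) = (\<Sum>i\<in>UNIV. u $ i *\<^sub>R f (axis i 1))"
    using assms by (simp add: linear_sum linear_scale)
  then show ?thesis by (simp add: scalar_mult_eq_scaleR[symmetric] basis_expansion)
qed

lemma bilinear_expand_axis:
  fixes B :: "real ^ 'n \<Rightarrow> real ^ 'm \<Rightarrow> 'b::real_vector"
  assumes "bilinear B"
  shows "B u v = (\<Sum>i\<in>UNIV. \<Sum>j\<in>UNIV. (u $ i * v $ j) *\<^sub>R B (axis i 1) (axis j 1))"
proof -
  have linear: "linear (\<lambda>u. B u v)" "linear (B u)" for u v using assms by (simp_all add: bilinear_def)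
  show ?thesis
    by (subst linear_expand_axis[OF linear(1)], subst linear_expand_axis[OF linear(2)])
      (simp add: scaleR_sum_right)
qed

lemma linear_family_tendsto:
  fixes A :: "'s \<Rightarrow> real ^ 'n \<Rightarrow> 'b::real_normed_vector"
  assumes A: "\<forall>\<^sub>F t in F. linear (A t)" "\<And>v. ((\<lambda>t. A t v) \<longlongrightarrow> L v) F" and L: "linear L"
    and a: "(a \<longlongrightarrow> u) F"
  shows "((\<lambda>t. A t (a t)) \<longlongrightarrow> L u) F"
proof -
  have "((\<lambda>t. \<Sum>i\<in>UNIV. a t $ i *\<^sub>R A t (axis i 1)) \<longlongrightarrow> (\<Sum>i\<in>UNIV. u $ i *\<^sub>R L (axis i 1))) F"
    by (intro tendsto_sum tendsto_scaleR tendsto_vec_nth a A(2))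
  then show ?thesis
    unfolding linear_expand_axis[OF L, symmetric]
    by (rule Lim_transform_eventually)
      (use A(1) in \<open>rule eventually_mono, simp only: linear_expand_axis[symmetric]\<close>)
qed

lemma linear_field_has_derivative:
  fixes A :: "'a::real_normed_vector \<Rightarrow> real ^ 'n \<Rightarrow> 'b::real_normed_vector"
  assumes U: "open U" and A: "\<And>y. y \<in> U \<Longrightarrow> linear (A y)"
    and dA: "\<And>u. (\<lambda>y. A y u) differentiable (at (X s))"
    and X: "(X has_derivative X') (at s)" "X s \<in> U" and f: "(f has_derivative f') (at s)"
  shows "((\<lambda>r. A (X r) (f r)) has_derivative
    (\<lambda>w. frechet_derivative (\<lambda>y. A y (f s)) (at (X s)) (X' w) + A (X s) (f' w))) (at s)"
proof -
  let ?DA = "\<lambda>u. frechet_derivative (\<lambda>y. A y u) (at (X s))"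
  have DA: "((\<lambda>y. A y u) has_derivative ?DA u) (at (X s))" for u
    using dA frechet_derivative_works by blast
  have expand: "A y u = (\<Sum>i\<in>UNIV. u $ i *\<^sub>R A y (axis i 1))" if "y \<in> U" for y u
    by (rule linear_expand_axis[OF A[OF that]])
  have "((\<lambda>r. \<Sum>i\<in>UNIV. f r $ i *\<^sub>R A (X r) (axis i 1)) has_derivative
      (\<lambda>w. \<Sum>i\<in>UNIV. f s $ i *\<^sub>R ?DA (axis i 1) (X' w) + f' w $ i *\<^sub>R A (X s) (axis i 1))) (at s)"
    by (intro has_derivative_sum has_derivative_scaleR has_derivative_compose[OF X(1) DA]
        bounded_linear.has_derivative[OF bounded_linear_vec_nth f])
  moreover have "?DA (f s) w = (\<Sum>i\<in>UNIV. f s $ i *\<^sub>R ?DA (axis i 1) w)" for w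
    by (rule linear_expand_axis[OF linear_frechet_derivative_param[OF U X(2) A dA]])
  ultimately have expanded: "((\<lambda>r. \<Sum>i\<in>UNIV. f r $ i *\<^sub>R A (X r) (axis i 1)) has_derivative
      (\<lambda>w. ?DA (f s) (X' w) + A (X s) (f' w))) (at s)"
    by (simp add: sum.distrib expand[OF X(2), symmetric])
  have "(X \<longlongrightarrow> X s) (at s)" using has_derivative_continuous[OF X(1)] by (simp add: continuous_within)
  then have "\<forall>\<^sub>F r in at s. X r \<in> U" using U X(2) by (rule topological_tendstoD)
  then have "\<forall>\<^sub>F r in at s. (\<Sum>i\<in>UNIV. f r $ i *\<^sub>R A (X r) (axis i 1)) = A (X r) (f r)"
    by eventually_elim (simp only: expand[symmetric])
  then show ?thesis
    by (rule has_derivative_transform_eventually[OF expanded]) (simp_all add: expand[OF X(2), symmetric])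
qed

lemma linear_field_has_vector_derivative:
  fixes A :: "'a::real_normed_vector \<Rightarrow> real ^ 'n \<Rightarrow> 'b::real_normed_vector"
  assumes U: "open U" and A: "\<And>y. y \<in> U \<Longrightarrow> linear (A y)"
    and dA: "\<And>u. (\<lambda>y. A y u) differentiable (at (X s))"
    and X: "(X has_vector_derivative X') (at s)" "X s \<in> U" and f: "(f has_vector_derivative f') (at s)"
  shows "((\<lambda>r. A (X r) (f r)) has_vector_derivative
    frechet_derivative (\<lambda>y. A y (f s)) (at (X s)) X' + A (X s) f') (at s)"
  unfolding has_vector_derivative_def
  by (rule has_derivative_eq_rhs[OF linear_field_has_derivative[OF U A dA
          X(1)[unfolded has_vector_derivative_def] X(2) f[unfolded has_vector_derivative_def]]])
    (simp_all add: fun_eq_iff linear_scale[OF linear_frechet_derivative[OF dA]]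
      linear_scale[OF A[OF X(2)]] scaleR_add_right)

lemma bilinear_field_has_derivative:
  fixes B :: "'a::real_normed_vector \<Rightarrow> real ^ 'n \<Rightarrow> real ^ 'm \<Rightarrow> 'b::real_normed_vector"
  assumes U: "open U" and B: "\<And>y. y \<in> U \<Longrightarrow> bilinear (B y)"
    and dB: "\<And>u v y. y \<in> U \<Longrightarrow> (\<lambda>y. B y u v) differentiable (at y)"
    and X: "(X has_derivative X') (at s)" "X s \<in> U"
    and f: "(f has_derivative f') (at s)" and h: "(h has_derivative h') (at s)"
  shows "((\<lambda>r. B (X r) (f r) (h r)) has_derivative
    (\<lambda>w. frechet_derivative (\<lambda>y. B y (f s) (h s)) (at (X s)) (X' w)
        + B (X s) (f' w) (h s) + B (X s) (f s) (h' w))) (at s)"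
proof -
  let ?B = "\<lambda>q u. B (fst q) u (snd q)"
  have dB1: "((\<lambda>q. ?B q u) has_derivative
      (\<lambda>w. frechet_derivative (\<lambda>y. B y u v) (at y) (fst w) + B y u (snd w))) (at (y, v))"
    if "y \<in> U" for u y v
    using linear_field_has_derivative[where X=fst and f=snd and s="(y, v)" and A="\<lambda>y. B y u", OF U _ _
        bounded_linear_imp_has_derivative[OF bounded_linear_fst] _
        bounded_linear_imp_has_derivative[OF bounded_linear_snd]] B dB that
    by (simp add: bilinear_def)
  have "((\<lambda>r. ?B (X r, h r) (f r)) has_derivative
      (\<lambda>w. frechet_derivative (\<lambda>q. ?B q (f s)) (at (X s, h s)) (X' w, h' w) + ?B (X s, h s) (f' w))) (at s)"
  proof (rule linear_field_has_derivative[where U="U \<times> UNIV"])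
    show "linear (?B q)" if "q \<in> U \<times> UNIV" for q using B[of "fst q"] that by (auto simp: bilinear_def)
    show "(\<lambda>q. ?B q u) differentiable (at (X s, h s))" for u
      using dB1[OF X(2)] unfolding differentiable_def by blast
  qed (use U X f h in \<open>auto intro: open_Times has_derivative_Pair\<close>)
  then show ?thesis
    by (simp add: frechet_derivative_at[OF dB1[OF X(2)], symmetric] add_ac)
qed

lemma bilinear_field_has_vector_derivative:
  fixes B :: "'a::real_normed_vector \<Rightarrow> real ^ 'n \<Rightarrow> real ^ 'm \<Rightarrow> 'b::real_normed_vector"
  assumes U: "open U" and B: "\<And>y. y \<in> U \<Longrightarrow> bilinear (B y)"
    and dB: "\<And>u v y. y \<in> U \<Longrightarrow> (\<lambda>y. B y u v) differentiable (at y)"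
    and X: "(X has_vector_derivative X') (at s)" "X s \<in> U"
    and f: "(f has_vector_derivative f') (at s)" and h: "(h has_vector_derivative h') (at s)"
  shows "((\<lambda>r. B (X r) (f r) (h r)) has_vector_derivative
     frechet_derivative (\<lambda>y. B y (f s) (h s)) (at (X s)) X'
        + B (X s) f' (h s) + B (X s) (f s) h') (at s)"
proof -
  have lin: "linear (\<lambda>u. B (X s) u (h s))" "linear (B (X s) (f s))"
    using B[OF X(2)] by (simp_all add: bilinear_def)
  show ?thesis
    unfolding has_vector_derivative_def
    by (intro has_derivative_eq_rhs[OF bilinear_field_has_derivative[OF U B dB
            X(1)[unfolded has_vector_derivative_def] X(2) f[unfolded has_vector_derivative_def]
            h[unfolded has_vector_derivative_def]]])
      (simp_all add: fun_eq_iff linear_scale[OF linear_frechet_derivative[OF dB[OF X(2)]]]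
        linear_scale[OF lin(1)] linear_scale[OF lin(2)] scaleR_add_right)
qed

section \<open>Derivatives of determinants and inverse matrices\<close>

lemma has_vector_derivative_vecI:
  fixes f :: "real \<Rightarrow> 'a::real_normed_vector ^ 'n"
  assumes "\<And>i. ((\<lambda>x. f x $ i) has_vector_derivative f' $ i) (at x within S)"
  shows "(f has_vector_derivative f') (at x within S)"
  using assms unfolding has_vector_derivative_iff_tendsto by (intro vec_tendstoI) simp

lemma prod_mat_1_off_diagonal:
  fixes p :: "'n::finite \<Rightarrow> 'n"
  assumes p: "p permutes UNIV"
  shows "(\<Prod>j\<in>UNIV - {i}. (mat 1 :: real^'n^'n) $ j $ p j) = (if p = id then 1 else 0)"
proof (cases "p = id")
  case False
  then obtain j where "p j \<noteq> j" by (metis eq_id_iff)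
  moreover from this have "p (p j) \<noteq> p j" using permutes_inj[OF p] by (auto dest: injD)
  ultimately have "\<exists>j\<in>UNIV - {i}. p j \<noteq> j" by (cases "j = i") auto
  then have "(\<Prod>j\<in>UNIV - {i}. (mat 1 :: real^'n^'n) $ j $ p j) = 0"
    by (intro prod_zero) (force simp: mat_def)+
  with False show ?thesis by simp
qed (simp add: mat_def)

lemma det_scaleR: "det (r *\<^sub>R A) = r ^ CARD('n) * det (A :: real^'n^'n)"
proof -
  have "r *\<^sub>R A = (\<chi> i. r *s A $ i)" by (simp add: vec_eq_iff)
  then show ?thesis by (simp add: det_rows_mul)
qed

lemma has_derivative_det_one:
  "((det :: real^'n^'n \<Rightarrow> real) has_derivative trace) (at (mat 1))"
proof -
  let ?P = "{p. p permutes (UNIV :: 'n set)}"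
  let ?I = "mat 1 :: real^'n^'n"
  have "((\<lambda>A::real^'n^'n. A $ i $ j) has_derivative (\<lambda>H. H $ i $ j)) F" for i j F
    by (intro bounded_linear_imp_has_derivative bounded_linear_compose[OF bounded_linear_vec_nth]
        bounded_linear_vec_nth)
  then have "((\<lambda>A::real^'n^'n. \<Sum>p\<in>?P. of_int (sign p) * (\<Prod>i\<in>UNIV. A $ i $ p i)) has_derivative
     (\<lambda>H. \<Sum>p\<in>?P. of_int (sign p) * (\<Sum>i\<in>UNIV. H $ i $ p i * (\<Prod>j\<in>UNIV - {i}. ?I $ j $ p j))))
     (at ?I)"
    by (intro has_derivative_sum has_derivative_mult_right Deriv.has_derivative_prod)
  moreover have "(\<Sum>p\<in>?P. of_int (sign p) * (\<Sum>i\<in>UNIV. H $ i $ p i * (\<Prod>j\<in>UNIV - {i}. ?I $ j $ p j)))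
      = trace H" for H :: "real^'n^'n"
  proof -
    have "(\<Sum>p\<in>?P. of_int (sign p) * (\<Sum>i\<in>UNIV. H $ i $ p i * (\<Prod>j\<in>UNIV - {i}. ?I $ j $ p j)))
      = (\<Sum>p\<in>?P. if p = id then trace H else 0)"
      by (intro sum.cong) (auto simp: prod_mat_1_off_diagonal trace_def)
    also have "\<dots> = trace H" by (simp add: permutes_id)
    finally show ?thesis .
  qed
  ultimately show ?thesis unfolding det_def by (simp add: fun_eq_iff)
qed

lemma bounded_bilinear_matrix_mult:
  "bounded_bilinear ((**) :: real^'m^'n \<Rightarrow> real^'k^'m \<Rightarrow> real^'k^'n)"
proof -
  have "bilinear ((**) :: real^'m^'n \<Rightarrow> real^'k^'m \<Rightarrow> real^'k^'n)"
    by (auto simp: bilinear_def linear_iff matrix_matrix_mult_def vec_eq_iff sum.distrib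
        sum_distrib_left algebra_simps)
  then show ?thesis by (simp add: bilinear_conv_bounded_bilinear)
qed

lemmas matrix_mult_simps =
  bounded_bilinear.add_left[OF bounded_bilinear_matrix_mult]
  bounded_bilinear.add_right[OF bounded_bilinear_matrix_mult]
  bounded_bilinear.diff_left[OF bounded_bilinear_matrix_mult]
  bounded_bilinear.diff_right[OF bounded_bilinear_matrix_mult]
  bounded_bilinear.minus_left[OF bounded_bilinear_matrix_mult]
  bounded_bilinear.scaleR_left[OF bounded_bilinear_matrix_mult]
  bounded_bilinear.scaleR_right[OF bounded_bilinear_matrix_mult]

lemma bounded_linear_trace: "bounded_linear (trace :: real^'n^'n \<Rightarrow> real)"
  unfolding linear_conv_bounded_linear[symmetric]
  by (rule linearI) (simp_all add: trace_def sum.distrib sum_distrib_left)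

lemmas trace_scaleR = linear_scale[OF bounded_linear.linear[OF bounded_linear_trace]]

lemma matrix_inv_mult:
  fixes A :: "'a::field^'n^'n"
  assumes "det A \<noteq> 0"
  shows "A ** matrix_inv A = mat 1" "matrix_inv A ** A = mat 1"
  using someI_ex[of "\<lambda>B. A ** B = mat 1 \<and> B ** A = mat 1"] invertible_det_nz[of A] assms
  by (auto simp: invertible_def matrix_inv_def)

lemma det_has_real_derivative:
  fixes A :: "real \<Rightarrow> real^'n^'n"
  assumes A: "(A has_vector_derivative A') (at t within S)" and det: "det (A t) \<noteq> 0"
  shows "((\<lambda>s. det (A s)) has_real_derivative det (A t) * trace (matrix_inv (A t) ** A')) (at t within S)"
proof -
  let ?B = "matrix_inv (A t)"
  have "((\<lambda>s. ?B ** A s) has_derivative (\<lambda>h. h *\<^sub>R (?B ** A'))) (at t within S)"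
    using bounded_linear.has_vector_derivative[OF bounded_bilinear.bounded_linear_right[OF
        bounded_bilinear_matrix_mult] A] by (simp add: has_vector_derivative_def)
  moreover have "(det has_derivative trace) (at (?B ** A t))"
    using has_derivative_det_one matrix_inv_mult[OF det] by simp
  ultimately have "((\<lambda>s. det (?B ** A s)) has_derivative (\<lambda>h. trace (h *\<^sub>R (?B ** A')))) (at t within S)"
    by (rule has_derivative_compose)
  then have "((\<lambda>s. det (?B ** A s)) has_real_derivative trace (?B ** A')) (at t within S)"
    unfolding has_field_derivative_def
    by (rule has_derivative_eq_rhs) (simp add: fun_eq_iff trace_scaleR mult.commute)
  from DERIV_cmult[OF this, of "det (A t)"]
  show ?thesis
    using arg_cong[OF matrix_inv_mult(1)[OF det], of det] by (simp add: det_mul mult.assoc[symmetric])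
qed

lemma tendsto_transpose:
  fixes A :: "'s \<Rightarrow> real^'n^'m"
  assumes "(A \<longlongrightarrow> B) F" shows "((\<lambda>t. transpose (A t)) \<longlongrightarrow> transpose B) F"
  unfolding transpose_def by (intro vec_tendstoI) (simp add: tendsto_vec_nth assms)

lemma tendsto_det:
  fixes A :: "'a \<Rightarrow> real^'n^'n"
  assumes "(A \<longlongrightarrow> B) F" shows "((\<lambda>t. det (A t)) \<longlongrightarrow> det B) F"
  unfolding det_def by (intro tendsto_intros assms)

lemma tendsto_matrix_inv:
  fixes A :: "'a \<Rightarrow> real^'n^'n"
  assumes A: "(A \<longlongrightarrow> B) F" and det: "det B \<noteq> 0"
  shows "((\<lambda>t. matrix_inv (A t)) \<longlongrightarrow> matrix_inv B) F"
proof (intro vec_tendstoI)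
  fix k l
  let ?N = "\<lambda>C :: real^'n^'n. \<chi> i j. if j = k then axis l 1 $ i else C $ i $ j"
  have cramer_inv: "matrix_inv C $ k $ l = det (?N C) / det C" if "det C \<noteq> 0" for C :: "real^'n^'n"
  proof -
    have "C *v (matrix_inv C *v axis l 1) = axis l 1"
      by (simp add: matrix_vector_mul_assoc matrix_inv_mult[OF that])
    then have "(matrix_inv C *v axis l 1) $ k = det (?N C) / det C"
      using cramer[OF that] by simp
    then show ?thesis by (simp add: matrix_vector_mul_component inner_axis)
  qed
  have "((\<lambda>t. ?N (A t)) \<longlongrightarrow> ?N B) F"
    by (intro vec_tendstoI) (simp add: tendsto_vec_nth[OF tendsto_vec_nth[OF A]])
  then have "((\<lambda>t. det (?N (A t)) / det (A t)) \<longlongrightarrow> det (?N B) / det B) F"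
    by (intro tendsto_divide tendsto_det A det)
  moreover have "\<forall>\<^sub>F t in F. det (?N (A t)) / det (A t) = matrix_inv (A t) $ k $ l"
    using tendsto_imp_eventually_ne[OF tendsto_det[OF A] det]
    by (rule eventually_mono) (rule cramer_inv[symmetric])
  ultimately show "((\<lambda>t. matrix_inv (A t) $ k $ l) \<longlongrightarrow> matrix_inv B $ k $ l) F"
    unfolding cramer_inv[OF det] by (rule Lim_transform_eventually)
qed

lemma has_vector_derivative_matrix_inv:
  fixes A :: "real \<Rightarrow> real^'n^'n"
  assumes A: "(A has_vector_derivative A') (at t within S)" and det: "det (A t) \<noteq> 0"
  shows "((\<lambda>s. matrix_inv (A s)) has_vector_derivative
    - (matrix_inv (A t) ** A' ** matrix_inv (A t))) (at t within S)"
  unfolding has_vector_derivative_iff_tendsto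
proof (rule Lim_transform_eventually)
  let ?B = "\<lambda>s. matrix_inv (A s)"
  have "(A \<longlongrightarrow> A t) (at t within S)"
    using has_vector_derivative_continuous[OF A] by (simp add: continuous_within)
  note lim = tendsto_matrix_inv[OF this det] tendsto_imp_eventually_ne[OF tendsto_det[OF this] det]
  show "((\<lambda>s. - (?B s ** ((A s - A t) /\<^sub>R (s - t)) ** ?B t)) \<longlongrightarrow> - (?B t ** A' ** ?B t)) (at t within S)"
    by (intro tendsto_minus bounded_bilinear.tendsto[OF bounded_bilinear_matrix_mult] lim tendsto_const
        A[unfolded has_vector_derivative_iff_tendsto])
  show "\<forall>\<^sub>F s in at t within S. - (?B s ** ((A s - A t) /\<^sub>R (s - t)) ** ?B t) = (?B s - ?B t) /\<^sub>R (s - t)"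
    using lim(2)
  proof eventually_elim
    case (elim s)
    have "?B s ** A s ** ?B t = ?B t" by (simp add: matrix_inv_mult[OF elim])
    moreover have "?B s ** A t ** ?B t = ?B s"
      by (simp add: matrix_mul_assoc[symmetric] matrix_inv_mult[OF det])
    ultimately show ?case by (simp add: matrix_mult_simps matrix_mul_assoc scaleR_diff_right)
  qed
qed

section \<open>Ordinary differential equations\<close>

lemma contraction_fixed_point_on_cbox:
  fixes W :: "('a::euclidean_space \<Rightarrow> 'b::complete_space) \<Rightarrow> 'a \<Rightarrow> 'b"
  assumes box: "cbox a b \<noteq> {}" and K: "closed K" "K \<noteq> {}" and c: "0 \<le> c" "c < 1"
    and W: "\<And>f. continuous_on (cbox a b) f \<Longrightarrow> f ` cbox a b \<subseteq> K \<Longrightarrow>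
      continuous_on (cbox a b) (W f) \<and> W f ` cbox a b \<subseteq> K"
    and contraction: "\<And>f g d x. continuous_on (cbox a b) f \<Longrightarrow> f ` cbox a b \<subseteq> K \<Longrightarrow>
      continuous_on (cbox a b) g \<Longrightarrow> g ` cbox a b \<subseteq> K \<Longrightarrow>
      (\<And>y. y \<in> cbox a b \<Longrightarrow> dist (f y) (g y) \<le> d) \<Longrightarrow> x \<in> cbox a b \<Longrightarrow> dist (W f x) (W g x) \<le> c * d"
  obtains f where "continuous_on (cbox a b) f" "f ` cbox a b \<subseteq> K" "\<And>x. x \<in> cbox a b \<Longrightarrow> W f x = f x"
proof -
  let ?X = "PiC UNIV (\<lambda>_. K) :: ('a \<Rightarrow>\<^sub>C 'b) set"
  have X: "continuous_on (cbox a b) (apply_bcontfun f)" "apply_bcontfun f ` cbox a b \<subseteq> K" if "f \<in> ?X" for f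
    using that by (auto simp: mem_PiC_iff)
  have "\<exists>g. \<forall>x. apply_bcontfun g x = W (apply_bcontfun f) (clamp a b x)" if f: "f \<in> ?X" for f
    using continuous_on_cbox_bcontfunE[of a b "W (apply_bcontfun f)"] W[OF X[OF f]] by metis
  then obtain \<Phi> where \<Phi>: "\<And>f x. f \<in> ?X \<Longrightarrow> apply_bcontfun (\<Phi> f) x = W (apply_bcontfun f) (clamp a b x)"
    by metis
  have clamp: "clamp a b x \<in> cbox a b" for x
    using box by (intro clamp_in_interval) (auto simp: box_ne_empty)
  have "\<exists>!f\<in>?X. \<Phi> f = f"
  proof (rule Banach_fix[OF _ _ c])
    show "complete ?X" by (simp add: complete_eq_closed closed_PiC K(1))
    show "?X \<noteq> {}"
      using K(2) const_bcontfun.rep_eq by (metis (mono_tags, lifting) Pi_I all_not_in_conv mem_PiC_iff)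
    show "\<Phi> ` ?X \<subseteq> ?X"
      using W[OF X] clamp by (force simp: mem_PiC_iff \<Phi>)
    fix f g assume f: "f \<in> ?X" and g: "g \<in> ?X"
    show "dist (\<Phi> f) (\<Phi> g) \<le> c * dist f g"
    proof (rule dist_bound)
      fix x
      show "dist (apply_bcontfun (\<Phi> f) x) (apply_bcontfun (\<Phi> g) x) \<le> c * dist f g"
        unfolding \<Phi>[OF f] \<Phi>[OF g] by (rule contraction[OF X[OF f] X[OF g] dist_bounded clamp])
    qed
  qed
  then obtain f where f: "f \<in> ?X" "\<Phi> f = f" by blast
  show ?thesis
  proof (rule that[OF X[OF f(1)]])
    fix x assume "x \<in> cbox a b"
    then show "W (apply_bcontfun f) x = apply_bcontfun f x" using \<Phi>[OF f(1), of x] f(2) by simp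
  qed
qed

lemma vector_mean_value_bound:
  fixes u :: "real \<Rightarrow> 'a::real_normed_vector"
  assumes "convex S" "\<And>t. t \<in> S \<Longrightarrow> (u has_vector_derivative u' t) (at t within S)"
    and "\<And>t. t \<in> S \<Longrightarrow> norm (u' t) \<le> K" and "s \<in> S" "t \<in> S"
  shows "norm (u t - u s) \<le> K * \<bar>t - s\<bar>"
proof -
  have "norm (u t - u s) \<le> K * norm (t - s)"
    by (rule differentiable_bound[OF assms(1), where f'="\<lambda>t h. h *\<^sub>R u' t"])
      (use assms in \<open>auto simp: has_vector_derivative_def onorm_scaleR_left[OF bounded_linear_ident] onorm_id
        intro!: onorm_le\<close>)
  then show ?thesis by simp
qed

text \<open>On a time interval that is short compared with the Lipschitz constant the mean value
  inequality already gives the Gronwall estimate, without exponentials.\<close>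

lemma short_time_gronwall:
  fixes u :: "real \<Rightarrow> 'a::real_normed_vector"
  assumes u: "\<And>t. t \<in> cball T \<tau> \<Longrightarrow> (u has_vector_derivative u' t) (at t within cball T \<tau>)"
    and u': "\<And>t. t \<in> cball T \<tau> \<Longrightarrow> norm (u' t) \<le> L * norm (u t) + e"
    and L: "0 \<le> L" "\<tau> * L \<le> 1 / 2" and "0 \<le> e" and t: "t \<in> cball T \<tau>"
  shows "norm (u t) \<le> 2 * (norm (u T) + \<tau> * e)"
proof -
  have \<tau>: "0 \<le> \<tau>" "T \<in> cball T \<tau>" using t by (auto intro: order_trans[OF zero_le_dist])
  have "continuous_on (cball T \<tau>) u"
    by (rule continuous_on_vector_derivative[OF u])
  then obtain s where s: "s \<in> cball T \<tau>" and max: "\<And>t. t \<in> cball T \<tau> \<Longrightarrow> norm (u t) \<le> norm (u s)"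
    using continuous_attains_sup[OF compact_cball _ continuous_on_norm] t by blast
  have "norm (u' r) \<le> L * norm (u s) + e" if "r \<in> cball T \<tau>" for r
    using u'[OF that] mult_left_mono[OF max[OF that] L(1)] by linarith
  from vector_mean_value_bound[OF convex_cball u this \<tau>(2) s]
  have "norm (u s - u T) \<le> (L * norm (u s) + e) * \<bar>s - T\<bar>" .
  also have "\<dots> \<le> (L * norm (u s) + e) * \<tau>"
    using s L \<open>0 \<le> e\<close> by (intro mult_left_mono) (auto simp: dist_real_def)
  also have "\<dots> = (\<tau> * L) * norm (u s) + \<tau> * e" by (simp add: algebra_simps)
  also have "\<dots> \<le> 1 / 2 * norm (u s) + \<tau> * e"
    using L by (intro add_right_mono mult_right_mono) auto
  finally have "norm (u s) \<le> 2 * (norm (u T) + \<tau> * e)"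
    using norm_triangle_sub[of "u s" "u T"] by (simp add: algebra_simps)
  with max[OF t] show ?thesis by linarith
qed

lemma antiderivative_with_value:
  fixes h :: "real \<Rightarrow> 'a::banach"
  assumes "continuous_on (cball T \<tau>) h"
  obtains H where "H T = a" "\<And>t. t \<in> cball T \<tau> \<Longrightarrow> (H has_vector_derivative h t) (at t within cball T \<tau>)"
proof -
  obtain H where H: "\<And>t. t \<in> cball T \<tau> \<Longrightarrow> (H has_vector_derivative h t) (at t within cball T \<tau>)"
    using antiderivative_continuous assms unfolding cball_eq_atLeastAtMost by blast
  show ?thesis
    by (rule that[of "\<lambda>t. H t - H T + a"]) (auto intro!: derivative_eq_intros H)
qed

lemma integral_curve_in_cball:
  fixes F :: "'a \<Rightarrow> 'b::real_normed_vector"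
  assumes w: "\<And>t. t \<in> cball 0 \<tau> \<Longrightarrow> (w has_vector_derivative F (f t)) (at t within cball 0 \<tau>)"
    and bd: "\<And>t. t \<in> cball 0 \<tau> \<Longrightarrow> norm (F (f t)) \<le> B"
    and start: "w 0 \<in> cball p (R / 2)" and \<tau>: "\<tau> * B \<le> R / 2" and t: "t \<in> cball (0::real) \<tau>"
  shows "w t \<in> cball p R"
proof -
  have zero: "(0::real) \<in> cball 0 \<tau>" using t by auto
  have "0 \<le> B" using bd[OF zero] norm_ge_zero order_trans by blast
  have "norm (w t - w 0) \<le> B * \<bar>t - 0\<bar>"
    by (rule vector_mean_value_bound[OF convex_cball w bd zero t])
  also have "\<dots> \<le> B * \<tau>" using t \<open>0 \<le> B\<close> by (intro mult_left_mono) auto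
  finally show ?thesis
    using \<tau> start dist_triangle[of p "w t" "w 0"] by (simp add: dist_norm norm_minus_commute mult.commute)
qed

lemma integral_curves_contract:
  fixes F :: "'a::real_normed_vector \<Rightarrow> 'b::real_normed_vector"
  assumes lip: "L-lipschitz_on S F"
    and f: "\<And>t. t \<in> cball 0 \<tau> \<Longrightarrow> f t \<in> S" and g: "\<And>t. t \<in> cball 0 \<tau> \<Longrightarrow> g t \<in> S"
    and w: "\<And>t. t \<in> cball 0 \<tau> \<Longrightarrow> (w has_vector_derivative F (f t)) (at t within cball 0 \<tau>)"
    and z: "\<And>t. t \<in> cball 0 \<tau> \<Longrightarrow> (z has_vector_derivative F (g t)) (at t within cball 0 \<tau>)"
    and start: "w 0 = z 0" and d: "\<And>t. t \<in> cball 0 \<tau> \<Longrightarrow> dist (f t) (g t) \<le> d"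
    and t: "t \<in> cball (0::real) \<tau>"
  shows "dist (w t) (z t) \<le> \<tau> * L * d"
proof -
  have zero: "(0::real) \<in> cball 0 \<tau>" using t by auto
  have "0 \<le> d" using d[OF zero] zero_le_dist order_trans by blast
  have "norm ((w t - z t) - (w 0 - z 0)) \<le> (L * d) * \<bar>t - 0\<bar>"
  proof (rule vector_mean_value_bound[OF convex_cball has_vector_derivative_diff[OF w z] _ zero t])
    fix r :: real assume r: "r \<in> cball 0 \<tau>"
    have "norm (F (f r) - F (g r)) \<le> L * norm (f r - g r)"
      by (rule lipschitz_on_normD[OF lip f[OF r] g[OF r]])
    also have "\<dots> \<le> L * d"
      using d[OF r] lipschitz_on_nonneg[OF lip] by (intro mult_left_mono) (auto simp: dist_norm)
    finally show "norm (F (f r) - F (g r)) \<le> L * d" .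
  qed
  also have "\<dots> \<le> (L * d) * \<tau>"
    using t \<open>0 \<le> d\<close> lipschitz_on_nonneg[OF lip] by (intro mult_left_mono) auto
  finally show ?thesis by (simp add: start dist_norm mult_ac)
qed

lemma picard_lindeloef:
  fixes F :: "'a::banach \<Rightarrow> 'a"
  assumes lip: "L-lipschitz_on (cball p R) F" and bd: "\<And>x. x \<in> cball p R \<Longrightarrow> norm (F x) \<le> B"
    and \<tau>: "0 < \<tau>" "\<tau> * L \<le> 1 / 2" "\<tau> * B \<le> R / 2" and a: "a \<in> cball p (R / 2)"
  obtains z where "z 0 = a" "\<And>t. t \<in> cball 0 \<tau> \<Longrightarrow> z t \<in> cball p R"
    "\<And>t. t \<in> cball 0 \<tau> \<Longrightarrow> (z has_vector_derivative F (z t)) (at t within cball 0 \<tau>)"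
proof -
  let ?I = "cball (0::real) \<tau>"
  have I: "?I = cbox (- \<tau>) \<tau>" "0 \<in> ?I" using \<tau>(1) by (simp_all add: cball_eq_atLeastAtMost)
  have "0 \<le> R" using a order_trans[OF zero_le_dist, of p a "R / 2"] by simp
  have "\<exists>w. w 0 = a \<and> (\<forall>t\<in>?I. (w has_vector_derivative F (f t)) (at t within ?I))"
    if "continuous_on ?I f" "f ` ?I \<subseteq> cball p R" for f
    by (rule antiderivative_with_value[of 0 \<tau> "\<lambda>t. F (f t)" a])
      (use continuous_on_compose2[OF lipschitz_on_continuous_on[OF lip] that] in auto)
  then obtain W where W0: "\<And>f. continuous_on ?I f \<Longrightarrow> f ` ?I \<subseteq> cball p R \<Longrightarrow> W f 0 = a"
    and dW: "\<And>f t. continuous_on ?I f \<Longrightarrow> f ` ?I \<subseteq> cball p R \<Longrightarrow> t \<in> ?I \<Longrightarrow>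
      (W f has_vector_derivative F (f t)) (at t within ?I)"
    by metis
  obtain z where z: "continuous_on ?I z" "z ` ?I \<subseteq> cball p R" "\<And>t. t \<in> ?I \<Longrightarrow> W z t = z t"
  proof (rule contraction_fixed_point_on_cbox[of "- \<tau>" \<tau> "cball p R" "1 / 2" W, folded I(1)])
    fix f assume f: "continuous_on ?I f" "f ` ?I \<subseteq> cball p R"
    have "W f t \<in> cball p R" if "t \<in> ?I" for t
      by (rule integral_curve_in_cball[where F=F and f=f, OF dW[OF f] bd _ \<tau>(3) that])
        (use f a in \<open>auto simp: W0[OF f] image_subset_iff\<close>)
    then show "continuous_on ?I (W f) \<and> W f ` ?I \<subseteq> cball p R"
      using continuous_on_vector_derivative[OF dW[OF f]] by auto
    fix g d t assume g: "continuous_on ?I g" "g ` ?I \<subseteq> cball p R"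
      and d: "\<And>t. t \<in> ?I \<Longrightarrow> dist (f t) (g t) \<le> d" and t: "t \<in> ?I"
    have "0 \<le> d" using d[OF I(2)] zero_le_dist order_trans by blast
    have "dist (W f t) (W g t) \<le> \<tau> * L * d"
      by (rule integral_curves_contract[OF lip _ _ dW[OF f] dW[OF g] _ d t])
        (use f(2) g(2) in \<open>auto simp: W0[OF f] W0[OF g] image_subset_iff\<close>)
    also have "\<dots> \<le> 1 / 2 * d" using \<tau>(2) \<open>0 \<le> d\<close> by (rule mult_right_mono)
    finally show "dist (W f t) (W g t) \<le> 1 / 2 * d" .
  qed (use I \<open>0 \<le> R\<close> in auto)
  show ?thesis
  proof (rule that)
    show "z 0 = a" using z(3)[OF I(2)] W0[OF z(1,2)] by simp
    show "z t \<in> cball p R" if "t \<in> ?I" for t using z(2) that by blast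
    show "(z has_vector_derivative F (z t)) (at t within ?I)" if "t \<in> ?I" for t
      by (rule has_vector_derivative_transform[OF that _ dW[OF z(1,2) that]]) (simp add: z(3))
  qed
qed

lemma lipschitz_local_flow:
  fixes F :: "'a::banach \<Rightarrow> 'a"
  assumes lip: "L-lipschitz_on (cball p R) F" and R: "0 < R"
  obtains \<tau> Z where "0 < \<tau>" "\<tau> * L \<le> 1 / 2" "\<And>a. a \<in> cball p (R / 2) \<Longrightarrow> Z a 0 = a"
    "\<And>a t. a \<in> cball p (R / 2) \<Longrightarrow> t \<in> cball 0 \<tau> \<Longrightarrow> Z a t \<in> cball p R"
    "\<And>a t. a \<in> cball p (R / 2) \<Longrightarrow> t \<in> cball 0 \<tau> \<Longrightarrow>
      (Z a has_vector_derivative F (Z a t)) (at t within cball 0 \<tau>)"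
proof -
  have L: "0 \<le> L" by (rule lipschitz_on_nonneg[OF lip])
  define B where "B = norm (F p) + L * R"
  have B: "0 \<le> B" using L R by (simp add: B_def)
  have bd: "norm (F x) \<le> B" if x: "x \<in> cball p R" for x
  proof -
    have "norm (F x - F p) \<le> L * norm (x - p)" using R x by (intro lipschitz_on_normD[OF lip]) auto
    also have "\<dots> \<le> L * R" using x L by (intro mult_left_mono) (auto simp: dist_norm norm_minus_commute)
    finally show ?thesis using norm_triangle_sub[of "F x" "F p"] by (simp add: B_def)
  qed
  define \<tau> where "\<tau> = min (1 / (2 * (L + 1))) (R / (2 * (B + 1)))"
  have \<tau>: "0 < \<tau>" "\<tau> * L \<le> 1 / 2" "\<tau> * B \<le> R / 2"
  proof -
    show "0 < \<tau>" using L B R by (auto simp: \<tau>_def)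
    have "\<tau> * L \<le> 1 / (2 * (L + 1)) * L" using L by (intro mult_right_mono) (auto simp: \<tau>_def)
    also have "\<dots> \<le> 1 / 2" using L by (simp add: divide_simps)
    finally show "\<tau> * L \<le> 1 / 2" .
    have "\<tau> * B \<le> R / (2 * (B + 1)) * B" using B by (intro mult_right_mono) (auto simp: \<tau>_def)
    also have "\<dots> \<le> R / 2" using B R by (simp add: divide_simps)
    finally show "\<tau> * B \<le> R / 2" .
  qed
  have "\<exists>z. z 0 = a \<and> (\<forall>t\<in>cball 0 \<tau>. z t \<in> cball p R \<and>
      (z has_vector_derivative F (z t)) (at t within cball 0 \<tau>))" if "a \<in> cball p (R / 2)" for a
    by (rule picard_lindeloef[OF lip bd \<tau> that]) auto
  then show ?thesis using that[OF \<tau>(1,2)] by metis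
qed

lemma ode_unique_near:
  fixes z w :: "real \<Rightarrow> 'a::real_normed_vector"
  assumes F: "local_lipschitz (UNIV :: real set) S (\<lambda>_. F)"
    and J: "open J" "T \<in> J" and eq: "z T = w T"
    and z: "\<And>t. t \<in> J \<Longrightarrow> z t \<in> S \<and> (z has_vector_derivative F (z t)) (at t)"
    and w: "\<And>t. t \<in> J \<Longrightarrow> w t \<in> S \<and> (w has_vector_derivative F (w t)) (at t)"
  obtains \<eta> where "\<eta> > 0" "cball T \<eta> \<subseteq> J" "\<And>t. t \<in> cball T \<eta> \<Longrightarrow> z t = w t"
proof -
  obtain r L where r: "r > 0" and lip: "L-lipschitz_on (cball (z T) r \<inter> S) F"
    using local_lipschitzE[OF F UNIV_I, of "z T"] z J by (metis IntI UNIV_I centre_in_cball less_imp_le)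
  have "isCont z T" "isCont w T" using z w J by (auto intro: has_vector_derivative_continuous)
  then have "\<forall>\<^sub>F t in nhds T. dist (z t) (z T) < r \<and> dist (w t) (w T) < r \<and> t \<in> J"
    using J r by (intro eventually_conj eventually_nhds_in_open)
      (auto simp: isCont_def tendsto_at_iff_tendsto_nhds dest: tendstoD)
  then obtain d where d: "d > 0"
    and near: "\<And>t. dist t T < d \<Longrightarrow> dist (z t) (z T) < r \<and> dist (w t) (w T) < r \<and> t \<in> J"
    by (auto simp: eventually_nhds_metric)
  have L: "0 \<le> L" by (rule lipschitz_on_nonneg[OF lip])
  define \<eta> where "\<eta> = min (d / 2) (1 / (2 * (L + 1)))"
  have \<eta>: "\<eta> > 0" "\<eta> < d" using d L by (auto simp: \<eta>_def)
  have "\<eta> * L \<le> 1 / (2 * (L + 1)) * L" using L by (intro mult_right_mono) (auto simp: \<eta>_def)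
  also have "\<dots> \<le> 1 / 2" using L by (simp add: divide_simps)
  finally have \<eta>L: "\<eta> * L \<le> 1 / 2" .
  have close: "z s \<in> cball (z T) r \<inter> S" "w s \<in> cball (z T) r \<inter> S" "s \<in> J" if "s \<in> cball T \<eta>" for s
    using near[of s] that \<eta>(2) eq z[of s] w[of s] by (auto simp: dist_commute)
  show ?thesis
  proof (rule that[OF \<eta>(1)])
    fix t assume t: "t \<in> cball T \<eta>"
    have "norm (z t - w t) \<le> 2 * (norm (z T - w T) + \<eta> * 0)"
    proof (rule short_time_gronwall[OF _ _ L \<eta>L _ t])
      fix s assume s: "s \<in> cball T \<eta>"
      show "((\<lambda>t. z t - w t) has_vector_derivative F (z s) - F (w s)) (at s within cball T \<eta>)"
        using z w close(3)[OF s] by (intro has_vector_derivative_diff)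
          (auto intro: has_vector_derivative_at_within)
      show "norm (F (z s) - F (w s)) \<le> L * norm (z s - w s) + 0"
        using lipschitz_on_normD[OF lip close(1,2)[OF s]] by simp
    qed simp
    then show "z t = w t" by (simp add: eq)
  qed (use close(3) in blast)
qed

lemma ode_unique:
  fixes z w :: "real \<Rightarrow> 'a::real_normed_vector"
  assumes F: "local_lipschitz (UNIV :: real set) S (\<lambda>_. F)"
    and J: "open J" "connected J" "t0 \<in> J" and eq: "z t0 = w t0"
    and z: "\<And>t. t \<in> J \<Longrightarrow> z t \<in> S \<and> (z has_vector_derivative F (z t)) (at t)"
    and w: "\<And>t. t \<in> J \<Longrightarrow> w t \<in> S \<and> (w has_vector_derivative F (w t)) (at t)"
    and t: "t \<in> J"
  shows "z t = w t"
proof -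
  let ?E = "{t\<in>J. z t = w t}"
  have "open ?E"
    unfolding open_contains_cball
  proof
    fix T assume T: "T \<in> ?E"
    show "\<exists>e>0. cball T e \<subseteq> ?E"
      by (rule ode_unique_near[OF F J(1) _ _ z w, of T]) (use T in auto)
  qed
  then have "openin (top_of_set J) ?E" by (rule open_subset[rotated]) auto
  moreover have "closedin (top_of_set J) ?E"
  proof -
    have "continuous_on J z" "continuous_on J w"
      using z w by (auto intro!: continuous_at_imp_continuous_on has_vector_derivative_continuous)
    then have "closedin (top_of_set J) (J \<inter> (\<lambda>t. z t - w t) -` {0})"
      by (intro continuous_closedin_preimage continuous_intros) auto
    moreover have "J \<inter> (\<lambda>t. z t - w t) -` {0} = ?E" by auto
    ultimately show ?thesis by simp
  qed
  ultimately have "?E = {} \<or> ?E = J" using J(2) unfolding connected_clopen by blast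
  with J eq t show ?thesis by blast
qed

lemma has_derivative_quadratic_error:
  assumes D: "bounded_linear D" and "\<delta> > 0"
    and error: "\<And>y. y \<in> ball x \<delta> \<Longrightarrow> norm (f y - f x - D (y - x)) \<le> C * (norm (y - x))\<^sup>2"
  shows "(f has_derivative D) (at x)"
  unfolding has_derivative_at_alt
proof (intro conjI allI impI D)
  fix e :: real assume e: "e > 0"
  show "\<exists>d>0. \<forall>y. norm (y - x) < d \<longrightarrow> norm (f y - f x - D (y - x)) \<le> e * norm (y - x)"
  proof (intro exI[of _ "min \<delta> (e / (\<bar>C\<bar> + 1))"] conjI allI impI)
    fix y assume y: "norm (y - x) < min \<delta> (e / (\<bar>C\<bar> + 1))"
    then have "norm (f y - f x - D (y - x)) \<le> C * (norm (y - x))\<^sup>2"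
      by (intro error) (simp add: dist_norm norm_minus_commute)
    also have "\<dots> \<le> (\<bar>C\<bar> + 1) * norm (y - x) * norm (y - x)"
      by (simp add: power2_eq_square mult.assoc) (intro mult_right_mono; simp)
    also have "\<dots> \<le> e * norm (y - x)"
      using y by (intro mult_right_mono) (auto simp: field_simps)
    finally show "norm (f y - f x - D (y - x)) \<le> e * norm (y - x)" .
  qed (use \<open>\<delta> > 0\<close> e in auto)
qed

lemma linearization_error_lipschitz_derivative:
  fixes F :: "'a::real_normed_vector \<Rightarrow> 'b::real_normed_vector"
  assumes K: "convex K" "x \<in> K" "y \<in> K" and lip: "L-lipschitz_on K F'"
    and F: "\<And>z. z \<in> K \<Longrightarrow> (F has_derivative blinfun_apply (F' z)) (at z)"
  shows "norm (F y - F x - blinfun_apply (F' x) (y - x)) \<le> L * (norm (y - x))\<^sup>2"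
proof -
  have seg: "closed_segment x y \<subseteq> K" using K convex_contains_segment by blast
  have "norm (F y - F x - blinfun_apply (F' x) (y - x)) \<le> norm (y - x) * (L * norm (y - x))"
  proof (rule differentiable_bound_linearization[where f'="\<lambda>z. blinfun_apply (F' z)"
        and S="closed_segment x y"])
    show "x + t *\<^sub>R (y - x) \<in> closed_segment x y" if "t \<in> {0..1}" for t
      using that unfolding closed_segment_def by (auto simp: algebra_simps intro!: exI[of _ t])
    show "(F has_derivative blinfun_apply (F' z)) (at z within closed_segment x y)"
      if "z \<in> closed_segment x y" for z
      using F seg that by (blast intro: has_derivative_at_withinI)
    show "onorm (blinfun_apply (F' z) - blinfun_apply (F' x)) \<le> L * norm (y - x)"
      if z: "z \<in> closed_segment x y" for z
    proof -
      have "blinfun_apply (F' z) - blinfun_apply (F' x) = blinfun_apply (F' z - F' x)"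
        by (simp add: fun_eq_iff blinfun.diff_left)
      then have "onorm (blinfun_apply (F' z) - blinfun_apply (F' x)) = norm (F' z - F' x)"
        by (simp add: norm_blinfun.rep_eq)
      also have "\<dots> \<le> L * norm (z - x)" using lip K(2) seg z by (intro lipschitz_on_normD) auto
      also have "\<dots> \<le> L * norm (y - x)"
        using segment_bound1[OF z] lipschitz_on_nonneg[OF lip] by (intro mult_left_mono) auto
      finally show ?thesis .
    qed
  qed simp
  then show ?thesis by (simp add: power2_eq_square mult_ac)
qed

lemma flow_linearization_error:
  fixes F :: "'a::real_normed_vector \<Rightarrow> 'a" and z w h :: "real \<Rightarrow> 'a"
  assumes K: "convex K" and F: "\<And>x. x \<in> K \<Longrightarrow> (F has_derivative blinfun_apply (F' x)) (at x)"
    and F': "\<And>x. x \<in> K \<Longrightarrow> norm (F' x) \<le> L" and lip: "L'-lipschitz_on K F'"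
    and \<tau>: "\<tau> * L \<le> 1 / 2"
    and z: "\<And>t. t \<in> cball 0 \<tau> \<Longrightarrow> z t \<in> K \<and> (z has_vector_derivative F (z t)) (at t within cball 0 \<tau>)"
    and w: "\<And>t. t \<in> cball 0 \<tau> \<Longrightarrow> w t \<in> K \<and> (w has_vector_derivative F (w t)) (at t within cball 0 \<tau>)"
    and h: "\<And>t. t \<in> cball 0 \<tau> \<Longrightarrow>
      (h has_vector_derivative blinfun_apply (F' (z t)) (h t)) (at t within cball 0 \<tau>)"
    and init: "h 0 = w 0 - z 0" and t: "t \<in> cball 0 \<tau>"
  shows "norm (w t - z t - h t) \<le> 8 * \<tau> * L' * (norm (w 0 - z 0))\<^sup>2"
proof -
  have zero: "0 \<in> cball (0::real) \<tau>" using t by (auto intro: order_trans[OF abs_ge_zero])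
  have L: "0 \<le> L" using F'[of "z 0"] z[OF zero] norm_ge_zero order_trans by blast
  have dist: "norm (w t - z t) \<le> 2 * norm (w 0 - z 0)" if "t \<in> cball 0 \<tau>" for t
  proof -
    have "norm (w t - z t) \<le> 2 * (norm (w 0 - z 0) + \<tau> * 0)"
    proof (rule short_time_gronwall[OF _ _ L \<tau> _ that])
      fix s :: real assume s: "s \<in> cball 0 \<tau>"
      show "((\<lambda>t. w t - z t) has_vector_derivative F (w s) - F (z s)) (at s within cball 0 \<tau>)"
        using z[OF s] w[OF s] by (intro has_vector_derivative_diff) auto
      have "norm (F (w s) - F (z s)) \<le> L * norm (w s - z s)"
        by (rule differentiable_bound[OF K, where f'="\<lambda>x. blinfun_apply (F' x)"])
          (use F F' z[OF s] w[OF s] in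
            \<open>auto simp: norm_blinfun.rep_eq[symmetric] intro: has_derivative_at_withinI\<close>)
      then show "norm (F (w s) - F (z s)) \<le> L * norm (w s - z s) + 0" by simp
    qed simp
    then show ?thesis by simp
  qed
  let ?e = "L' * (2 * norm (w 0 - z 0))\<^sup>2"
  have "norm (w t - z t - h t) \<le> 2 * (norm (w 0 - z 0 - h 0) + \<tau> * ?e)"
  proof (rule short_time_gronwall[OF _ _ L \<tau> _ t])
    fix s :: real assume s: "s \<in> cball 0 \<tau>"
    let ?u' = "F (w s) - F (z s) - blinfun_apply (F' (z s)) (h s)"
    show "((\<lambda>t. w t - z t - h t) has_vector_derivative ?u') (at s within cball 0 \<tau>)"
      using z[OF s] w[OF s] h[OF s] by (intro has_vector_derivative_diff) auto
    have "?u' = (F (w s) - F (z s) - blinfun_apply (F' (z s)) (w s - z s))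
        + blinfun_apply (F' (z s)) (w s - z s - h s)"
      by (simp add: blinfun.diff_right)
    also have "norm \<dots> \<le> L' * (norm (w s - z s))\<^sup>2 + L * norm (w s - z s - h s)"
    proof (rule order_trans[OF norm_triangle_ineq add_mono])
      show "norm (F (w s) - F (z s) - blinfun_apply (F' (z s)) (w s - z s)) \<le> L' * (norm (w s - z s))\<^sup>2"
        using z[OF s] w[OF s] by (intro linearization_error_lipschitz_derivative[OF K _ _ lip F]) auto
      show "norm (blinfun_apply (F' (z s)) (w s - z s - h s)) \<le> L * norm (w s - z s - h s)"
        using z[OF s] F' by (intro order_trans[OF norm_blinfun mult_right_mono]) auto
    qed
    also have "L' * (norm (w s - z s))\<^sup>2 \<le> ?e"
      using dist[OF s] lipschitz_on_nonneg[OF lip] by (intro mult_left_mono power_mono) auto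
    finally show "norm ?u' \<le> L * norm (w s - z s - h s) + ?e" by simp
  qed (use lipschitz_on_nonneg[OF lip] in simp)
  then show ?thesis by (simp add: init power_mult_distrib mult_ac)
qed

lemma (in bounded_bilinear) lipschitz_on_prod:
  assumes f: "A-lipschitz_on X f" "\<And>x. x \<in> X \<Longrightarrow> norm (f x) \<le> a"
    and g: "B-lipschitz_on X g" "\<And>x. x \<in> X \<Longrightarrow> norm (g x) \<le> b"
  obtains C where "C-lipschitz_on X (\<lambda>x. prod (f x) (g x))"
proof -
  obtain K where K: "0 \<le> K" "\<And>u v. norm (prod u v) \<le> norm u * norm v * K" using nonneg_bounded by blast
  have AB: "0 \<le> A" "0 \<le> B" using f g lipschitz_on_nonneg by blast+
  show ?thesis
  proof (rule that, rule lipschitz_onI)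
    fix x y assume x: "x \<in> X" and y: "y \<in> X"
    have ab: "0 \<le> a" "0 \<le> b" using f(2)[OF x] g(2)[OF x] norm_ge_zero order_trans by blast+
    have "prod (f x) (g x) - prod (f y) (g y) = prod (f x - f y) (g x) + prod (f y) (g x - g y)"
      by (simp add: diff_left diff_right)
    also have "norm \<dots> \<le> A * dist x y * b * K + a * (B * dist x y) * K"
    proof (rule order_trans[OF norm_triangle_ineq add_mono])
      show "norm (prod (f x - f y) (g x)) \<le> A * dist x y * b * K"
        using lipschitz_onD[OF f(1) x y] g(2)[OF x] K(1) AB ab
        by (intro order_trans[OF K(2)] mult_right_mono mult_mono) (auto simp: dist_norm)
      show "norm (prod (f y) (g x - g y)) \<le> a * (B * dist x y) * K"
        using lipschitz_onD[OF g(1) x y] f(2)[OF y] K(1) AB ab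
        by (intro order_trans[OF K(2)] mult_right_mono mult_mono) (auto simp: dist_norm)
    qed
    also have "\<dots> \<le> (K * (A * \<bar>b\<bar> + \<bar>a\<bar> * B)) * dist x y" using ab by (simp add: algebra_simps)
    finally show "dist (prod (f x) (g x)) (prod (f y) (g y)) \<le> (K * (A * \<bar>b\<bar> + \<bar>a\<bar> * B)) * dist x y"
      by (simp add: dist_norm)
  qed (use K AB in simp)
qed

definition variational_field ::
  "('a::real_normed_vector \<Rightarrow> 'a) \<Rightarrow> ('a \<Rightarrow> 'a \<Rightarrow>\<^sub>L 'a) \<Rightarrow> 'a \<times> ('a \<Rightarrow>\<^sub>L 'a) \<Rightarrow> 'a \<times> ('a \<Rightarrow>\<^sub>L 'a)" where
  "variational_field F F' q = (F (fst q), F' (fst q) o\<^sub>L snd q)"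

lemma variational_field_lipschitz:
  assumes F: "L-lipschitz_on (cball p R) F" and F': "L'-lipschitz_on (cball p R) F'"
    and bd: "\<And>x. x \<in> cball p R \<Longrightarrow> norm (F' x) \<le> B"
  obtains C where "C-lipschitz_on (cball (p, A) R) (variational_field F F')"
proof -
  let ?X = "cball (p, A) R"
  have lip_fst: "1-lipschitz_on ?X fst" and lip_snd: "1-lipschitz_on ?X snd"
    by (rule lipschitz_onI; simp add: dist_fst_le dist_snd_le)+
  have "fst q \<in> cball p R" if "q \<in> ?X" for q
    using dist_fst_le[of "(p, A)" q] that by simp
  then have fst_mem: "fst ` ?X \<subseteq> cball p R" by blast
  have "norm (snd q) \<le> norm A + R" if "q \<in> ?X" for q
    using dist_snd_le[of "(p, A)" q] that norm_triangle_sub[of "snd q" A]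
    by (auto simp: dist_norm norm_minus_commute)
  then obtain C where "C-lipschitz_on ?X (\<lambda>q. F' (fst q) o\<^sub>L snd q)"
    using bounded_bilinear.lipschitz_on_prod[OF bounded_bilinear_blinfun_compose
        lipschitz_on_compose2[OF lip_fst lipschitz_on_subset[OF F' fst_mem]] _ lip_snd, of B "norm A + R"]
      bd fst_mem by blast
  from lipschitz_on_Pair[OF lipschitz_on_compose2[OF lip_fst lipschitz_on_subset[OF F fst_mem]] this]
  have "(sqrt ((L * 1)\<^sup>2 + C\<^sup>2))-lipschitz_on ?X (variational_field F F')"
    unfolding variational_field_def[abs_def] .
  then show ?thesis by (rule that)
qed

lemma flow_has_derivative:
  fixes F :: "'a::real_normed_vector \<Rightarrow> 'a" and Z :: "'a \<Rightarrow> real \<Rightarrow> 'a" and A :: "real \<Rightarrow> 'a \<Rightarrow>\<^sub>L 'a"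
  assumes K: "convex K" and F: "\<And>x. x \<in> K \<Longrightarrow> (F has_derivative blinfun_apply (F' x)) (at x)"
    and F': "\<And>x. x \<in> K \<Longrightarrow> norm (F' x) \<le> B" and lip: "L-lipschitz_on K F'"
    and \<tau>: "\<tau> * B \<le> 1 / 2" and U: "open U" "a \<in> U"
    and Z: "\<And>b t. b \<in> U \<Longrightarrow> t \<in> cball 0 \<tau> \<Longrightarrow>
      Z b t \<in> K \<and> (Z b has_vector_derivative F (Z b t)) (at t within cball 0 \<tau>)"
    and Z0: "\<And>b. b \<in> U \<Longrightarrow> Z b 0 = b"
    and A: "\<And>t. t \<in> cball 0 \<tau> \<Longrightarrow> (A has_vector_derivative F' (Z a t) o\<^sub>L A t) (at t within cball 0 \<tau>)"
    and A0: "A 0 = id_blinfun" and t: "t \<in> cball 0 \<tau>"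
  shows "((\<lambda>a. Z a t) has_derivative blinfun_apply (A t)) (at a)"
proof -
  obtain \<delta> where \<delta>: "\<delta> > 0" "ball a \<delta> \<subseteq> U" using U openE by blast
  show ?thesis
  proof (rule has_derivative_quadratic_error[OF blinfun.bounded_linear_right \<delta>(1)])
    fix b assume "b \<in> ball a \<delta>"
    then have b: "b \<in> U" using \<delta>(2) by blast
    have "norm (Z b t - Z a t - blinfun_apply (A t) (b - a)) \<le> 8 * \<tau> * L * (norm (Z b 0 - Z a 0))\<^sup>2"
    proof (rule flow_linearization_error[OF K F F' lip \<tau> Z[OF U(2)] Z[OF b] _ _ t])
      fix s :: real assume s: "s \<in> cball 0 \<tau>"
      show "((\<lambda>s. blinfun_apply (A s) (b - a)) has_vector_derivative
          blinfun_apply (F' (Z a s)) (blinfun_apply (A s) (b - a))) (at s within cball 0 \<tau>)"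
        using bounded_linear.has_vector_derivative[OF blinfun.bounded_linear_left A[OF s]] by simp
    qed (simp_all add: A0 Z0 U(2) b)
    then show "norm (Z b t - Z a t - blinfun_apply (A t) (b - a)) \<le> 8 * \<tau> * L * (norm (b - a))\<^sup>2"
      by (simp add: Z0 U(2) b)
  qed
qed

lemma differentiable_local_flow:
  fixes F :: "'a::banach \<Rightarrow> 'a"
  assumes R: "R > 0" and F: "\<And>x. x \<in> cball p R \<Longrightarrow> (F has_derivative blinfun_apply (F' x)) (at x)"
    and B: "\<And>x. x \<in> cball p R \<Longrightarrow> norm (F' x) \<le> B" and lip: "L-lipschitz_on (cball p R) F'"
  obtains \<tau> Z A where "0 < \<tau>" "\<And>a. a \<in> ball p (R / 2) \<Longrightarrow> Z a 0 = a"
    "\<And>a t. a \<in> ball p (R / 2) \<Longrightarrow> t \<in> cball 0 \<tau> \<Longrightarrow>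
      Z a t \<in> cball p R \<and> (Z a has_vector_derivative F (Z a t)) (at t within cball 0 \<tau>)"
    "\<And>a. a \<in> ball p (R / 2) \<Longrightarrow> A a 0 = id_blinfun"
    "\<And>a t. a \<in> ball p (R / 2) \<Longrightarrow> t \<in> cball 0 \<tau> \<Longrightarrow>
      (A a has_vector_derivative F' (Z a t) o\<^sub>L A a t) (at t within cball 0 \<tau>)"
    "\<And>a t. a \<in> ball p (R / 2) \<Longrightarrow> t \<in> cball 0 \<tau> \<Longrightarrow> ((\<lambda>a. Z a t) has_derivative blinfun_apply (A a t)) (at a)"
proof -
  have "0 \<le> B" using B[of p] R norm_ge_zero order_trans by (metis centre_in_cball less_imp_le)
  have "B-lipschitz_on (cball p R) F"
    by (rule bounded_derivative_imp_lipschitz[where f'="\<lambda>x. blinfun_apply (F' x)"])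
      (use F B \<open>0 \<le> B\<close> in \<open>auto simp: norm_blinfun.rep_eq[symmetric] intro: has_derivative_at_withinI\<close>)
  then obtain C where C: "C-lipschitz_on (cball (p, id_blinfun) R) (variational_field F F')"
    by (rule variational_field_lipschitz[OF _ lip B])
  have "(C + B)-lipschitz_on (cball (p, id_blinfun) R) (variational_field F F')"
    by (rule lipschitz_on_le[OF C]) (use \<open>0 \<le> B\<close> in simp)
  from lipschitz_local_flow[OF this R] obtain \<tau> Q where \<tau>: "0 < \<tau>" "\<tau> * (C + B) \<le> 1 / 2"
    and Q0: "\<And>q. q \<in> cball (p, id_blinfun) (R / 2) \<Longrightarrow> Q q 0 = q"
    and Q: "\<And>q t. q \<in> cball (p, id_blinfun) (R / 2) \<Longrightarrow> t \<in> cball 0 \<tau> \<Longrightarrow> Q q t \<in> cball (p, id_blinfun) R"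
    and dQ: "\<And>q t. q \<in> cball (p, id_blinfun) (R / 2) \<Longrightarrow> t \<in> cball 0 \<tau> \<Longrightarrow>
      (Q q has_vector_derivative variational_field F F' (Q q t)) (at t within cball 0 \<tau>)"
    by blast
  define Z where "Z a t = fst (Q (a, id_blinfun) t)" for a t
  define A where "A a t = snd (Q (a, id_blinfun) t)" for a t
  have start: "(a, id_blinfun) \<in> cball (p, id_blinfun) (R / 2)" if "a \<in> ball p (R / 2)" for a
    using that by (simp add: dist_Pair_Pair)
  have init: "Z a 0 = a" "A a 0 = id_blinfun" if "a \<in> ball p (R / 2)" for a
    using Q0[OF start[OF that]] by (simp_all add: Z_def A_def)
  have Z: "Z a t \<in> cball p R \<and> (Z a has_vector_derivative F (Z a t)) (at t within cball 0 \<tau>)"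
    and A: "(A a has_vector_derivative F' (Z a t) o\<^sub>L A a t) (at t within cball 0 \<tau>)"
    if "a \<in> ball p (R / 2)" "t \<in> cball 0 \<tau>" for a t
  proof -
    note dQ = dQ[OF start[OF that(1)] that(2)]
    have "Z a t \<in> cball p R"
      using Q[OF start[OF that(1)] that(2)] dist_fst_le[of "(p, id_blinfun)" "Q (a, id_blinfun) t"]
      by (simp add: Z_def)
    with bounded_linear.has_vector_derivative[OF bounded_linear_fst dQ]
    show "Z a t \<in> cball p R \<and> (Z a has_vector_derivative F (Z a t)) (at t within cball 0 \<tau>)"
      by (simp add: Z_def[abs_def] variational_field_def)
    from bounded_linear.has_vector_derivative[OF bounded_linear_snd dQ]
    show "(A a has_vector_derivative F' (Z a t) o\<^sub>L A a t) (at t within cball 0 \<tau>)"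
      by (simp add: Z_def A_def[abs_def] variational_field_def)
  qed
  have \<tau>B: "\<tau> * B \<le> 1 / 2"
    using \<tau>(2) mult_nonneg_nonneg[OF less_imp_le[OF \<tau>(1)] lipschitz_on_nonneg[OF C]]
    unfolding distrib_left by linarith
  show ?thesis
    by (rule that[OF \<tau>(1) init(1) Z init(2) A
          flow_has_derivative[OF convex_cball F B lip \<tau>B open_ball _ Z init(1) A init(2)]])
qed

lemma C1_flow:
  fixes F :: "'a::euclidean_space \<Rightarrow> 'a"
  assumes S: "open S" and F: "Ck_on 2 S F" and p: "p \<in> S"
  obtains \<rho> \<tau> :: real and Z and D :: "'a \<Rightarrow> real \<Rightarrow> 'a \<Rightarrow> 'a" where "\<rho> > 0" "\<tau> > 0"
    "\<And>a. a \<in> ball p \<rho> \<Longrightarrow> Z a 0 = a"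
    "\<And>a t. a \<in> ball p \<rho> \<Longrightarrow> t \<in> ball 0 \<tau> \<Longrightarrow> Z a t \<in> S"
    "\<And>a t. a \<in> ball p \<rho> \<Longrightarrow> t \<in> ball 0 \<tau> \<Longrightarrow> (Z a has_vector_derivative F (Z a t)) (at t)"
    "\<And>a h. a \<in> ball p \<rho> \<Longrightarrow> D a 0 h = h"
    "\<And>a t h. a \<in> ball p \<rho> \<Longrightarrow> t \<in> ball 0 \<tau> \<Longrightarrow>
       ((\<lambda>t. D a t h) has_vector_derivative frechet_derivative F (at (Z a t)) (D a t h)) (at t)"
    "\<And>a t. a \<in> ball p \<rho> \<Longrightarrow> t \<in> ball 0 \<tau> \<Longrightarrow> ((\<lambda>a. Z a t) has_derivative D a t) (at a)"
proof -
  let ?F' = "\<lambda>x. Blinfun (frechet_derivative F (at x))"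
  obtain R where R: "R > 0" "cball p R \<subseteq> S" using S p open_contains_cball by blast
  have F2: "Ck_on (Suc (Suc 0)) S F" using F by (simp add: numeral_2_eq_2)
  have dF: "(F has_derivative frechet_derivative F (at x)) (at x)" if "x \<in> cball p R" for x
    using Ck_on_has_derivative[OF F2] R(2) that by blast
  have F'_apply: "blinfun_apply (?F' x) = frechet_derivative F (at x)" if "x \<in> cball p R" for x
    by (rule bounded_linear_Blinfun_apply[OF has_derivative_bounded_linear[OF dF[OF that]]])
  obtain L where L: "L-lipschitz_on (cball p R) ?F'"
    by (rule C1_imp_lipschitz_on_cball[OF S R(2) Ck_on_Blinfun_frechet_derivative[OF S F2]])
  then have "bounded (?F' ` cball p R)"
    using lipschitz_on_continuous_on by (intro compact_imp_bounded compact_continuous_image) auto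
  then obtain B where B: "\<And>x. x \<in> cball p R \<Longrightarrow> norm (?F' x) \<le> B" unfolding bounded_iff by blast
  have dF': "(F has_derivative blinfun_apply (?F' x)) (at x)" if "x \<in> cball p R" for x
    using dF[OF that] F'_apply[OF that] by simp
  obtain \<tau> Z A where \<tau>: "0 < \<tau>" and Z0: "\<And>a. a \<in> ball p (R / 2) \<Longrightarrow> Z a 0 = a"
    and Z: "\<And>a t. a \<in> ball p (R / 2) \<Longrightarrow> t \<in> cball 0 \<tau> \<Longrightarrow>
      Z a t \<in> cball p R \<and> (Z a has_vector_derivative F (Z a t)) (at t within cball 0 \<tau>)"
    and A0: "\<And>a. a \<in> ball p (R / 2) \<Longrightarrow> A a 0 = id_blinfun"
    and A: "\<And>a t. a \<in> ball p (R / 2) \<Longrightarrow> t \<in> cball 0 \<tau> \<Longrightarrow>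
      (A a has_vector_derivative ?F' (Z a t) o\<^sub>L A a t) (at t within cball 0 \<tau>)"
    and derivative: "\<And>a t. a \<in> ball p (R / 2) \<Longrightarrow> t \<in> cball 0 \<tau> \<Longrightarrow>
      ((\<lambda>a. Z a t) has_derivative blinfun_apply (A a t)) (at a)"
    by (rule differentiable_local_flow[OF R(1) dF' B L], assumption+, rule that)
  show ?thesis
  proof (rule that[of "R / 2" \<tau> Z "\<lambda>a t. blinfun_apply (A a t)"])
    fix a h and t :: real assume a: "a \<in> ball p (R / 2)" and t: "t \<in> ball 0 \<tau>"
    have t': "t \<in> cball 0 \<tau>" and interior: "at t within cball 0 \<tau> = at t"
      using t interior_cball[of "0::real" \<tau>] by (auto intro: at_within_interior)
    show "Z a t \<in> S" "(Z a has_vector_derivative F (Z a t)) (at t)"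
      using Z[OF a t'] R(2) interior by auto
    show "((\<lambda>t. blinfun_apply (A a t) h) has_vector_derivative
        frechet_derivative F (at (Z a t)) (blinfun_apply (A a t) h)) (at t)"
      using bounded_linear.has_vector_derivative[OF blinfun.bounded_linear_left A[OF a t'], of h]
        F'_apply[of "Z a t"] Z[OF a t'] interior by simp
  qed (use R(1) \<tau> Z0 A0 derivative in auto)
qed

section \<open>Christoffel symbols and curvature in a chart\<close>

locale riem_chart =
  fixes M :: "('a, 'n::finite) rspace" and c :: "('a, 'n) chart"
  assumes riemannian: "riemannian_manifold M" and chart: "c \<in> atlas M"
begin

definition U where "U = coord c ` dom_of c"

abbreviation "g \<equiv> metric M c"
abbreviation "\<Gamma> \<equiv> christoffel M c"
abbreviation "Rm \<equiv> curvature M c"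
abbreviation "dg x u v w \<equiv> frechet_derivative (\<lambda>y. g y u v) (at x) w"
abbreviation "d\<Gamma> x u v w \<equiv> frechet_derivative (\<lambda>y. \<Gamma> y u v) (at x) w"

lemma open_U: "open U"
  using riemannian chart by (auto simp: riemannian_manifold_def smooth_manifold_def is_chart_def U_def)

lemma coord_mem_U: "P \<in> dom_of c \<Longrightarrow> coord c P \<in> U"
  by (simp add: U_def)

lemma g_bilinear: "x \<in> U \<Longrightarrow> bilinear (g x)"
  and g_sym: "x \<in> U \<Longrightarrow> g x u v = g x v u"
  and g_pos: "x \<in> U \<Longrightarrow> u \<noteq> 0 \<Longrightarrow> g x u u > 0"
  using riemannian chart unfolding riemannian_manifold_def U_def by blast+

lemma g_Ck: "Ck_on n U (\<lambda>x. g x u v)"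
  using riemannian chart unfolding riemannian_manifold_def smooth_on_def U_def by blast

lemma g_linear: "x \<in> U \<Longrightarrow> linear (\<lambda>u. g x u v)" "x \<in> U \<Longrightarrow> linear (g x u)"
  using g_bilinear by (auto simp: bilinear_def)

lemmas g_zero = linear_0[OF g_linear(1)] linear_0[OF g_linear(2)]
lemmas g_sum = linear_sum[OF g_linear(1)] linear_sum[OF g_linear(2)]
lemmas g_simps = g_zero linear_add[OF g_linear(1)] linear_add[OF g_linear(2)]
  linear_scale[OF g_linear(1)] linear_scale[OF g_linear(2)]
  linear_neg[OF g_linear(1)] linear_neg[OF g_linear(2)]
  linear_diff[OF g_linear(1)] linear_diff[OF g_linear(2)]

lemma g_eqI: "x \<in> U \<Longrightarrow> (\<And>z. g x a z = g x b z) \<Longrightarrow> a = b"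
  using g_pos[of x "a - b"] by (auto simp: g_simps)

lemma g_differentiable: "x \<in> U \<Longrightarrow> (\<lambda>y. g y u v) differentiable (at x)"
  using g_Ck[of "Suc 0" u v] by simp

lemma dg_linear: assumes "x \<in> U"
  shows "linear (\<lambda>u. dg x u v w)" "linear (\<lambda>v. dg x u v w)" "linear (dg x u v)"
  using linear_frechet_derivative_param[OF open_U assms, of "\<lambda>u y. g y u v" w]
    linear_frechet_derivative_param[OF open_U assms, of "\<lambda>v y. g y u v" w]
    linear_frechet_derivative[OF g_differentiable[OF assms]] g_linear g_differentiable[OF assms]
  by auto

lemmas dg_simps = linear_add[OF dg_linear(1)] linear_add[OF dg_linear(2)] linear_add[OF dg_linear(3)]
  linear_scale[OF dg_linear(1)] linear_scale[OF dg_linear(2)] linear_scale[OF dg_linear(3)]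

lemma dg_sym: "x \<in> U \<Longrightarrow> dg x u v w = dg x v u w"
  using frechet_derivative_cong_open[OF open_U, of x "\<lambda>y. g y u v" "\<lambda>y. g y v u"] g_sym by simp

lemma g_represents:
  assumes x: "x \<in> U" and k: "linear k"
  shows "\<exists>w. \<forall>z. g x w z = k z"
proof -
  define T where "T w = (\<chi> j. g x w (axis j 1))" for w
  have T: "linear T"
    unfolding T_def by (rule linearI) (simp_all add: vec_eq_iff g_simps[OF x])
  have gT: "g x w z = (\<Sum>j\<in>UNIV. z $ j *\<^sub>R T w $ j)" for w z
    using linear_expand_axis[OF g_linear(2)[OF x], of w z] by (simp add: T_def)
  have "inj T"
  proof (subst linear_injective_0[OF T], intro allI impI)
    fix w assume "T w = 0"
    then have "g x w w = 0" by (simp add: gT)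
    then show "w = 0" using g_pos[OF x, of w] by auto
  qed
  then have "surj T" using linear_injective_imp_surjective[OF T] by blast
  then obtain w where "T w = (\<chi> j. k (axis j 1))" by (metis surjD)
  then have "g x w z = k z" for z
    using linear_expand_axis[OF k, of z] by (simp add: gT)
  then show ?thesis by blast
qed

lemma christoffel_eq:
  assumes x: "x \<in> U"
  shows "2 * g x (\<Gamma> x u v) z = dg x v z u + dg x u z v - dg x u v z"
proof -
  let ?k = "\<lambda>z. dg x v z u + dg x u z v - dg x u v z"
  have "linear (\<lambda>z. ?k z / 2)"
    by (intro linearI) (simp_all add: dg_simps[OF x] field_simps)
  from g_represents[OF x this] obtain w where w: "\<And>z. g x w z = ?k z / 2" by blast
  have "\<exists>!w. \<forall>z. 2 * g x w z = ?k z"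
  proof (rule ex1I[of _ w])
    fix w' assume w': "\<forall>z. 2 * g x w' z = ?k z"
    show "w' = w"
    proof (rule g_eqI[OF x])
      fix z
      show "g x w' z = g x w z" using spec[OF w', of z] by (simp add: w)
    qed
  qed (simp add: w)
  from theI'[OF this] show ?thesis unfolding christoffel_def by blast
qed

lemma christoffel_eqI:
  assumes x: "x \<in> U" and w: "\<And>z. 2 * g x w z = dg x v z u + dg x u z v - dg x u v z"
  shows "\<Gamma> x u v = w"
proof (rule g_eqI[OF x])
  fix z show "g x (\<Gamma> x u v) z = g x w z" using christoffel_eq[OF x, of u v z] w[of z] by simp
qed

lemma christoffel_sym: "x \<in> U \<Longrightarrow> \<Gamma> x u v = \<Gamma> x v u"
  by (rule christoffel_eqI) (simp_all add: christoffel_eq dg_sym[of x u v])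

lemma christoffel_bilinear:
  assumes x: "x \<in> U" shows "bilinear (\<Gamma> x)"
proof -
  have lin: "linear (\<lambda>u. \<Gamma> x u v)" for v
  proof (rule linearI; rule christoffel_eqI[OF x])
    fix a b z and r :: real
    show "2 * g x (\<Gamma> x a v + \<Gamma> x b v) z = dg x v z (a + b) + dg x (a + b) z v - dg x (a + b) v z"
      using christoffel_eq[OF x, of a v z] christoffel_eq[OF x, of b v z]
      by (simp add: g_simps[OF x] dg_simps[OF x])
    have "2 * g x (r *\<^sub>R \<Gamma> x a v) z = r * (2 * g x (\<Gamma> x a v) z)" by (simp add: g_simps[OF x])
    then show "2 * g x (r *\<^sub>R \<Gamma> x a v) z = dg x v z (r *\<^sub>R a) + dg x (r *\<^sub>R a) z v - dg x (r *\<^sub>R a) v z"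
      unfolding christoffel_eq[OF x] by (simp add: dg_simps[OF x] algebra_simps)
  qed
  have "linear (\<Gamma> x u)" for u
    by (rule back_subst[of linear, OF lin[of u]]) (rule ext, rule christoffel_sym[OF x])
  with lin show ?thesis by (simp add: bilinear_def)
qed

lemma christoffel_linear: "x \<in> U \<Longrightarrow> linear (\<lambda>u. \<Gamma> x u v)" "x \<in> U \<Longrightarrow> linear (\<Gamma> x u)"
  using christoffel_bilinear by (auto simp: bilinear_def)

lemmas christoffel_simps = linear_add[OF christoffel_linear(1)] linear_add[OF christoffel_linear(2)]
  linear_scale[OF christoffel_linear(1)] linear_scale[OF christoffel_linear(2)]
  linear_neg[OF christoffel_linear(1)] linear_neg[OF christoffel_linear(2)]
  linear_diff[OF christoffel_linear(1)] linear_diff[OF christoffel_linear(2)]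
  linear_0[OF christoffel_linear(1)] linear_0[OF christoffel_linear(2)]

lemma christoffel_Ck: "Ck_on n U (\<lambda>x. \<Gamma> x u v)"
proof (rule Ck_on_linear_system[OF open_U])
  let ?A = "\<lambda>x. \<chi> i j. 2 * g x (axis j 1) (axis i 1) "
  let ?b = "\<lambda>x. \<chi> i. dg x v (axis i 1) u + dg x u (axis i 1) v - dg x u v (axis i 1)"
  have Aw: "?A x *v w = (\<chi> i. 2 * g x w (axis i 1))" if x: "x \<in> U" for x w
    by (simp add: vec_eq_iff matrix_vector_mult_def linear_expand_axis[OF g_linear(1)[OF x], of w]
        sum_distrib_left mult_ac)
  show "Ck_on n U (\<lambda>x. ?A x $ i $ j)" for i j
    using Ck_on_mult[OF open_U Ck_on_const[OF open_U] g_Ck] by simp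
  have "Ck_on n U (\<lambda>x. dg x a b w)" for a b w using g_Ck[of "Suc n" a b] by simp
  then show "Ck_on n U (\<lambda>x. ?b x $ i)" for i
    by simp (intro Ck_on_add Ck_on_diff open_U)
  fix x assume x: "x \<in> U"
  have "\<forall>w. ?A x *v w = 0 \<longrightarrow> w = 0"
  proof (intro allI impI)
    fix w assume "?A x *v w = 0"
    then have "g x w (axis i 1) = 0" for i using Aw[OF x, of w] by (simp add: vec_eq_iff)
    then have "g x w w = 0" using linear_expand_axis[OF g_linear(2)[OF x], of w w] by simp
    then show "w = 0" using g_pos[OF x, of w] by auto
  qed
  then have "invertible (?A x)"
    using matrix_left_invertible_ker invertible_left_inverse by blast
  then show "det (?A x) \<noteq> 0" using invertible_det_nz by blast
  show "?A x *v \<Gamma> x u v = ?b x"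
    unfolding Aw[OF x] by (simp add: vec_eq_iff christoffel_eq[OF x])
qed

lemma christoffel_differentiable: "x \<in> U \<Longrightarrow> (\<lambda>y. \<Gamma> y u v) differentiable (at x)"
  using christoffel_Ck[of "Suc 0" u v] by simp

lemma dchristoffel_linear: assumes "x \<in> U"
  shows "linear (\<lambda>u. d\<Gamma> x u v w)" "linear (\<lambda>v. d\<Gamma> x u v w)" "linear (d\<Gamma> x u v)"
  using linear_frechet_derivative_param[OF open_U assms, of "\<lambda>u y. \<Gamma> y u v" w]
    linear_frechet_derivative_param[OF open_U assms, of "\<lambda>v y. \<Gamma> y u v" w]
    linear_frechet_derivative[OF christoffel_differentiable[OF assms]]
    christoffel_linear christoffel_differentiable[OF assms]
  by auto

lemmas dchristoffel_simps =
  linear_add[OF dchristoffel_linear(1)] linear_add[OF dchristoffel_linear(2)]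
  linear_add[OF dchristoffel_linear(3)]
  linear_scale[OF dchristoffel_linear(1)] linear_scale[OF dchristoffel_linear(2)]
  linear_scale[OF dchristoffel_linear(3)]

lemma dchristoffel_sym: "x \<in> U \<Longrightarrow> d\<Gamma> x u v w = d\<Gamma> x v u w"
  using frechet_derivative_cong_open[OF open_U, of x "\<lambda>y. \<Gamma> y u v" "\<lambda>y. \<Gamma> y v u"] christoffel_sym by simp

lemma metric_compatible: "x \<in> U \<Longrightarrow> dg x u v w = g x (\<Gamma> x w u) v + g x u (\<Gamma> x w v)"
  using christoffel_eq[of x w u v] christoffel_eq[of x w v u] dg_sym[of x v u w]
    g_sym[of x u "\<Gamma> x w v"] by simp

lemmas g_field_derivative =
  bilinear_field_has_derivative[where B=g, OF open_U g_bilinear g_differentiable]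
lemmas g_field_vector_derivative =
  bilinear_field_has_vector_derivative[where B=g, OF open_U g_bilinear g_differentiable]
lemmas christoffel_field_derivative =
  bilinear_field_has_derivative[where B=\<Gamma>, OF open_U christoffel_bilinear christoffel_differentiable]
lemmas christoffel_field_vector_derivative =
  bilinear_field_has_vector_derivative[where B=\<Gamma>, OF open_U christoffel_bilinear christoffel_differentiable]

lemma second_derivative_metric:
  assumes x: "x \<in> U"
  shows "frechet_derivative (\<lambda>y. dg y w z v) (at x) u =
     g x (\<Gamma> x u (\<Gamma> x v w)) z + g x (\<Gamma> x v w) (\<Gamma> x u z) + g x (d\<Gamma> x v w u) z
   + g x (\<Gamma> x u w) (\<Gamma> x v z) + g x w (\<Gamma> x u (\<Gamma> x v z)) + g x w (d\<Gamma> x v z u)"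
proof -
  have d\<Gamma>: "((\<lambda>y. \<Gamma> y v w) has_derivative d\<Gamma> x v w) (at x)" for v w
    using christoffel_differentiable[OF x] frechet_derivative_works by blast
  have "frechet_derivative (\<lambda>y. dg y w z v) (at x) =
      frechet_derivative (\<lambda>y. g y (\<Gamma> y v w) z + g y w (\<Gamma> y v z)) (at x)"
    by (rule frechet_derivative_cong_open[OF open_U x]) (rule metric_compatible)
  also have "\<dots> = (\<lambda>u. (dg x (\<Gamma> x v w) z u + g x (d\<Gamma> x v w u) z + g x (\<Gamma> x v w) 0)
      + (dg x w (\<Gamma> x v z) u + g x 0 (\<Gamma> x v z) + g x w (d\<Gamma> x v z u)))"
    by (rule frechet_derivative_at[symmetric])
      (intro has_derivative_add g_field_derivative has_derivative_ident has_derivative_const d\<Gamma> x)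
  finally show ?thesis by (simp add: metric_compatible[OF x] g_simps[OF x])
qed

lemma curvature_skew_adjoint:
  assumes x: "x \<in> U"
  shows "g x (Rm x u v w) z = - g x w (Rm x u v z)"
proof -
  have "frechet_derivative (\<lambda>y. dg y w z v) (at x) u = frechet_derivative (\<lambda>y. dg y w z u) (at x) v"
    by (rule symmetric_second_derivative[OF open_U x g_Ck])
  then show ?thesis
    unfolding second_derivative_metric[OF x] curvature_def by (simp add: g_simps[OF x])
qed

lemma curvature_skew: "Rm x u v w = - Rm x v u w"
  by (simp add: curvature_def)

lemma curvature_self: "Rm x v v w = 0"
  by (simp add: curvature_def)

lemma curvature_bianchi:
  assumes x: "x \<in> U"
  shows "Rm x u v w + Rm x v w u + Rm x w u v = 0"
  using dchristoffel_sym[OF x, of u v w] dchristoffel_sym[OF x, of v w u] dchristoffel_sym[OF x, of u w v]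
    christoffel_sym[OF x, of u v] christoffel_sym[OF x, of v w] christoffel_sym[OF x, of u w]
  by (simp add: curvature_def)

lemma jacobi_operator_self_adjoint:
  assumes x: "x \<in> U"
  shows "g x (Rm x a v v) b = g x (Rm x b v v) a"
proof -
  have "g x (Rm x a v b + Rm x v b a + Rm x b a v) v = 0"
    by (simp add: curvature_bianchi[OF x] g_zero[OF x])
  moreover have "g x (Rm x b a v) v = 0"
    using curvature_skew_adjoint[OF x, of b a v v] g_sym[OF x, of v "Rm x b a v"] by simp
  ultimately have "g x (Rm x a v b) v = g x (Rm x b v a) v"
    using curvature_skew[of x v b a] by (simp add: g_simps[OF x])
  then show ?thesis
    using curvature_skew_adjoint[OF x, of a v v b] curvature_skew_adjoint[OF x, of b v v a]
      g_sym[OF x, of v] by simp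
qed

lemma curvature_linear:
  assumes x: "x \<in> U"
  shows "linear (\<lambda>u. Rm x u v w)" "linear (\<lambda>v. Rm x u v w)" "linear (\<lambda>w. Rm x u v w)"
  unfolding curvature_def
  by (intro linearI;
      simp add: dchristoffel_simps[OF x] christoffel_simps[OF x] scaleR_diff_right scaleR_add_right)+

lemma g_tendsto:
  assumes X: "(X \<longlongrightarrow> x) F" "x \<in> U" "\<forall>\<^sub>F t in F. X t \<in> U"
    and a: "(a \<longlongrightarrow> u) F" and b: "(b \<longlongrightarrow> v) F"
  shows "((\<lambda>t. g (X t) (a t) (b t)) \<longlongrightarrow> g x u v) F"
  by (rule linear_family_tendsto[OF _ linear_family_tendsto[OF _ Ck_on_tendsto_compose[OF open_U g_Ck]]])
    (use X a b in \<open>auto intro: g_linear elim: eventually_mono\<close>)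

lemma curvature_tendsto:
  assumes X: "(X \<longlongrightarrow> x) F" "x \<in> U" "\<forall>\<^sub>F t in F. X t \<in> U"
    and a: "(a \<longlongrightarrow> u) F" and b: "(b \<longlongrightarrow> v) F" and e: "(e \<longlongrightarrow> w) F"
  shows "((\<lambda>t. Rm (X t) (a t) (b t) (e t)) \<longlongrightarrow> Rm x u v w) F"
proof -
  have \<Gamma>: "((\<lambda>t. \<Gamma> (X t) u v) \<longlongrightarrow> \<Gamma> x u v) F" for u v
    by (rule Ck_on_tendsto_compose[OF open_U christoffel_Ck X(1,2)])
  have "((\<lambda>t. d\<Gamma> (X t) u v w) \<longlongrightarrow> d\<Gamma> x u v w) F" for u v w
    by (rule Ck_on_tendsto_compose[where n=0, OF open_U _ X(1,2)])
      (use christoffel_Ck[of "Suc 0" u v] in simp)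
  moreover have "((\<lambda>t. \<Gamma> (X t) u (\<Gamma> (X t) v w)) \<longlongrightarrow> \<Gamma> x u (\<Gamma> x v w)) F" for u v w
    by (rule linear_family_tendsto[OF _ \<Gamma> _ \<Gamma>])
      (use X in \<open>auto intro: christoffel_linear elim: eventually_mono\<close>)
  ultimately have const: "((\<lambda>t. Rm (X t) u v w) \<longlongrightarrow> Rm x u v w) F" for u v w
    unfolding curvature_def by (intro tendsto_add tendsto_diff)
  have lin: "\<forall>\<^sub>F t in F. linear (\<lambda>u. Rm (X t) u v w)" "\<forall>\<^sub>F t in F. linear (\<lambda>v. Rm (X t) (a t) v w)"
    "\<forall>\<^sub>F t in F. linear (\<lambda>w. Rm (X t) (a t) (b t) w)" for v w
    using X(3) by (auto intro: curvature_linear elim: eventually_mono)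
  note linear = curvature_linear[OF X(2)]
  show ?thesis
    by (rule linear_family_tendsto[OF lin(3) linear_family_tendsto[OF lin(2)
            linear_family_tendsto[OF lin(1) const linear(1) a] linear(2) b] linear(3) e])
qed

definition gram :: "real ^ 'n \<Rightarrow> ('k \<Rightarrow> real ^ 'n) \<Rightarrow> ('l \<Rightarrow> real ^ 'n) \<Rightarrow> real ^ 'l ^ 'k" where
  "gram x a b = (\<chi> i j. g x (a i) (b j))"

lemma gram_component: "gram x a b $ i $ j = g x (a i) (b j)"
  by (simp add: gram_def)

lemma gram_transpose: "x \<in> U \<Longrightarrow> transpose (gram x a b) = gram x b a"
  by (simp add: gram_def transpose_def vec_eq_iff g_sym)

lemma gram_eq_rows:
  fixes a :: "'k::finite \<Rightarrow> real ^ 'n" and b :: "'l::finite \<Rightarrow> real ^ 'n"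
  assumes x: "x \<in> U"
  shows "gram x a b = (\<chi> i. a i) ** gram x (\<lambda>i. axis i 1) (\<lambda>j. axis j 1) ** transpose (\<chi> j. b j)"
proof -
  have "g x u v = (\<Sum>j\<in>UNIV. (\<Sum>i\<in>UNIV. u $ i * g x (axis i 1) (axis j 1)) * v $ j)" for u v
    by (subst bilinear_expand_axis[OF g_bilinear[OF x]], subst sum.swap)
      (simp add: sum_distrib_left sum_distrib_right mult_ac)
  from this[of "a _" "b _"] show ?thesis
    by (simp add: vec_eq_iff gram_def matrix_matrix_mult_def transpose_def)
qed

lemma gram_via_basis:
  fixes f :: "'n \<Rightarrow> real ^ 'n" and a :: "'k::finite \<Rightarrow> real ^ 'n" and b :: "'l::finite \<Rightarrow> real ^ 'n"
  assumes x: "x \<in> U" and f: "det (gram x f f) \<noteq> 0"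
  shows "gram x a b = gram x a f ** matrix_inv (gram x f f) ** gram x f b"
proof -
  let ?M = "gram x (\<lambda>i. axis i 1) (\<lambda>j. axis j 1)" and ?F = "\<chi> i. f i"
  let ?Gi = "matrix_inv (gram x f f)"
  have "(?F ** ?M) ** (transpose ?F ** ?Gi) = mat 1"
    using matrix_inv_mult(1)[OF f] by (simp add: gram_eq_rows[OF x, of f f] matrix_mul_assoc)
  then have "transpose ?F ** ?Gi ** (?F ** ?M) = mat 1" by (rule matrix_left_right_inverse1)
  then have "(\<chi> i. a i) ** ?M ** (transpose ?F ** ?Gi ** (?F ** ?M)) ** transpose (\<chi> j. b j)
      = (\<chi> i. a i) ** ?M ** transpose (\<chi> j. b j)" by simp
  then show ?thesis
    by (simp add: gram_eq_rows[OF x, of a f] gram_eq_rows[OF x, of f b] gram_eq_rows[OF x, of a b]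
        matrix_mul_assoc)
qed

lemma trace_eq_gram:
  fixes f :: "'n \<Rightarrow> real ^ 'n"
  assumes x: "x \<in> U" and f: "det (gram x f f) \<noteq> 0" and T: "linear T"
  shows "trace (matrix T) = trace (matrix_inv (gram x f f) ** gram x (\<lambda>i. T (f i)) f)"
proof -
  let ?M = "gram x (\<lambda>i. axis i 1) (\<lambda>j. axis j 1)" and ?F = "\<chi> i. f i"
  let ?Gi = "matrix_inv (gram x f f)"
  have "?F ** (?M ** transpose ?F ** ?Gi) = mat 1"
    using matrix_inv_mult(1)[OF f] by (simp add: gram_eq_rows[OF x, of f f] matrix_mul_assoc)
  then have inverse: "?M ** transpose ?F ** ?Gi ** ?F = mat 1" by (rule matrix_left_right_inverse1)
  have "(\<chi> i. T (f i)) = ?F ** transpose (matrix T)"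
    by (simp add: vec_eq_iff matrix_matrix_mult_def transpose_def matrix_def
        linear_expand_axis[OF T, of "f _"])
  then have "trace (?Gi ** gram x (\<lambda>i. T (f i)) f) =
      trace ((?Gi ** ?F ** transpose (matrix T)) ** (?M ** transpose ?F))"
    by (simp add: gram_eq_rows[OF x, of "\<lambda>i. T (f i)" f] matrix_mul_assoc)
  also have "\<dots> = trace (?M ** transpose ?F ** ?Gi ** ?F ** transpose (matrix T))"
    by (subst trace_mul_sym) (simp add: matrix_mul_assoc)
  also have "\<dots> = trace (matrix T)"
    unfolding inverse by (simp add: trace_def transpose_def)
  finally show ?thesis by simp
qed

lemma orthogonal_vector_exists:
  fixes f :: "'n \<Rightarrow> real ^ 'n"
  assumes x: "x \<in> U" and "k \<notin> S"
  obtains u where "u \<noteq> 0" "\<And>i. i \<in> S \<Longrightarrow> g x u (f i) = 0"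
proof -
  let ?T = "\<lambda>u. \<chi> i. if i \<in> S then g x u (f i) else 0"
  have T: "linear ?T" by (rule linearI) (simp_all add: vec_eq_iff g_simps[OF x])
  have "\<not> surj ?T"
  proof
    assume "surj ?T"
    then obtain u where "axis k 1 = ?T u" by (rule surjE)
    then have "axis k (1::real) $ k = ?T u $ k" by (rule arg_cong)
    then show False using \<open>k \<notin> S\<close> by simp
  qed
  then have "\<not> inj ?T" using linear_injective_imp_surjective[OF T] by blast
  then obtain u where u: "?T u = 0" "u \<noteq> 0" using linear_injective_0[OF T] by blast
  show ?thesis
  proof (rule that[OF u(2)])
    fix i assume "i \<in> S"
    then show "g x u (f i) = 0" using arg_cong[OF u(1), of "\<lambda>w. w $ i"] by simp
  qed
qed

lemma orthonormal_basis_exists: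
  assumes x: "x \<in> U"
  obtains f :: "'n \<Rightarrow> real ^ 'n" where "gram x f f = mat 1"
proof -
  have "\<exists>f::'n \<Rightarrow> real ^ 'n. \<forall>i\<in>S. \<forall>j\<in>S. g x (f i) (f j) = (if i = j then 1 else 0)" for S :: "'n set"
  proof (induction S rule: finite_induct[OF finite])
    case (2 k S)
    then obtain f :: "'n \<Rightarrow> real ^ 'n"
      where f: "\<And>i j. i \<in> S \<Longrightarrow> j \<in> S \<Longrightarrow> g x (f i) (f j) = (if i = j then 1 else 0)" by blast
    obtain u where u: "u \<noteq> 0" "\<And>i. i \<in> S \<Longrightarrow> g x u (f i) = 0"
      by (rule orthogonal_vector_exists[OF x \<open>k \<notin> S\<close>, of f], rule that)
    then have ortho: "g x (f i) u = 0" if "i \<in> S" for i using that g_sym[OF x] by metis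
    let ?r = "1 / sqrt (g x u u)"
    have "?r * (?r * g x u u) = 1" using g_pos[OF x u(1)] by (simp add: field_simps)
    then have "\<forall>i\<in>insert k S. \<forall>j\<in>insert k S.
        g x ((f(k := ?r *\<^sub>R u)) i) ((f(k := ?r *\<^sub>R u)) j) = (if i = j then 1 else 0)"
      using \<open>k \<notin> S\<close> f u(2) ortho by (auto simp: g_simps[OF x])
    then show ?case by blast
  qed simp
  from this[of UNIV] show ?thesis using that by (auto simp: gram_def mat_def vec_eq_iff)
qed

lemma unit_vector_exists:
  assumes x: "x \<in> U" obtains \<theta> where "g x \<theta> \<theta> = 1"
proof -
  obtain f :: "'n \<Rightarrow> real ^ 'n" where "gram x f f = mat 1" by (rule orthonormal_basis_exists[OF x])
  from arg_cong[OF this, of "\<lambda>A. A $ undefined $ undefined"] show ?thesis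
    by (intro that[of "f undefined"]) (simp add: gram_def mat_def)
qed

definition frame_coords :: "real ^ 'n \<Rightarrow> ('n \<Rightarrow> real ^ 'n) \<Rightarrow> real ^ 'n \<Rightarrow> real ^ 'n" where
  "frame_coords x f u = (\<chi> k. g x u (f k))"

context
  fixes x :: "real ^ 'n" and f :: "'n \<Rightarrow> real ^ 'n"
  assumes x: "x \<in> U" and f: "gram x f f = mat 1"
begin

lemma orthonormal: "g x (f i) (f j) = (if i = j then 1 else 0)"
  using arg_cong[OF f, of "\<lambda>A. A $ i $ j"] by (simp add: gram_def mat_def)

lemma matrix_inv_gram_orthonormal: "matrix_inv (gram x f f) = mat 1"
  using matrix_inv_mult(1)[of "gram x f f"] by (simp add: f)

lemma gram_orthonormal:
  fixes a :: "'k::finite \<Rightarrow> real ^ 'n" and b :: "'l::finite \<Rightarrow> real ^ 'n"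
  shows "gram x a b = gram x a f ** gram x f b"
  using gram_via_basis[OF x, of f a b] by (simp add: matrix_inv_gram_orthonormal) (simp add: f)

lemma parseval: "g x u v = frame_coords x f u \<bullet> frame_coords x f v"
  using arg_cong[OF gram_orthonormal[of "\<lambda>_::unit. u" "\<lambda>_::unit. v"], of "\<lambda>A. A $ () $ ()"]
  by (simp add: gram_def frame_coords_def inner_vec_def matrix_matrix_mult_def g_sym[OF x, of v])

lemma orthonormal_expansion: "u = (\<Sum>k\<in>UNIV. frame_coords x f u $ k *\<^sub>R f k)"
proof (rule g_eqI[OF x])
  fix z
  show "g x u z = g x (\<Sum>k\<in>UNIV. frame_coords x f u $ k *\<^sub>R f k) z"
    unfolding parseval[of u z]
    by (simp add: inner_vec_def frame_coords_def g_sum[OF x] g_simps[OF x] g_sym[OF x, of z])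
qed

lemma quadratic_form_orthonormal:
  assumes T: "linear T"
  shows "g x (T u) u = frame_coords x f u \<bullet> (gram x (\<lambda>i. T (f i)) f *v frame_coords x f u)"
proof -
  have "g x (T u) u = g x (\<Sum>i\<in>UNIV. frame_coords x f u $ i *\<^sub>R T (f i)) u"
    using arg_cong[OF orthonormal_expansion[of u], of T] T by (simp add: linear_sum linear_scale)
  also have "\<dots> = (\<Sum>i\<in>UNIV. frame_coords x f u $ i * (frame_coords x f (T (f i)) \<bullet> frame_coords x f u))"
    by (simp add: g_sum[OF x] g_simps[OF x] parseval[symmetric])
  finally show ?thesis
    by (simp add: inner_vec_def matrix_vector_mult_def gram_def frame_coords_def[of x f "T _"])
qed

lemma trace_orthonormal: "linear T \<Longrightarrow> trace (matrix T) = trace (gram x (\<lambda>i. T (f i)) f)"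
  using trace_eq_gram[OF x, of f T] by (simp add: matrix_inv_gram_orthonormal) (simp add: f)

end

lemma gram_factorization:
  fixes a :: "'n \<Rightarrow> real ^ 'n"
  assumes x: "x \<in> U"
  obtains B :: "real ^ 'n ^ 'n" where "gram x a a = B ** transpose B"
proof -
  obtain f :: "'n \<Rightarrow> real ^ 'n" where "gram x f f = mat 1" by (rule orthonormal_basis_exists[OF x])
  from gram_orthonormal[OF x this, of a a] show ?thesis
    using that[of "gram x a f"] by (simp add: gram_transpose[OF x])
qed

lemma gram_det_nonneg:
  fixes a :: "'n \<Rightarrow> real ^ 'n"
  assumes x: "x \<in> U" shows "det (gram x a a) \<ge> 0"
  by (rule gram_factorization[OF x, of a]) (simp add: det_mul det_transpose)

lemma strict_cauchy_schwarz:
  assumes x: "x \<in> U" and uv: "u \<noteq> v" "independent {u, v}"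
  shows "(g x u v)\<^sup>2 < g x u u * g x v v"
proof -
  have "v \<noteq> 0" using uv(2) dependent_zero[of "{u, v}"] by auto
  then have v: "g x v v > 0" by (rule g_pos[OF x])
  let ?w = "u - (g x u v / g x v v) *\<^sub>R v"
  have w: "?w \<noteq> 0"
  proof
    assume "?w = 0"
    then have "u = (g x u v / g x v v) *\<^sub>R v" by simp
    then have "u \<in> span {v}" by (metis span_base span_scale singletonI)
    then show False using uv by (simp add: independent_insert)
  qed
  have "g x v v * g x ?w ?w > 0" by (rule mult_pos_pos[OF v g_pos[OF x w]])
  moreover have "g x v v * g x ?w ?w = g x u u * g x v v - (g x u v)\<^sup>2"
    using v g_sym[OF x, of v u] by (simp add: g_simps[OF x] field_simps power2_eq_square)
  ultimately show ?thesis by simp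
qed

lemma sectional_curvature_of_radial:
  assumes x: "x \<in> U" and uv: "u \<noteq> v" "independent {u, v}"
    and radial: "\<And>\<theta>. g x \<theta> \<theta> = 1 \<Longrightarrow> g x (Rm x u \<theta> \<theta>) u = \<kappa> * (g x u u - (g x u \<theta>)\<^sup>2)"
  shows "sectional_curvature M c x u v = \<kappa>"
proof -
  have "v \<noteq> 0" using uv(2) dependent_zero[of "{u, v}"] by auto
  define r where "r = sqrt (g x v v)"
  have r: "r > 0" "r\<^sup>2 = g x v v" using g_pos[OF x \<open>v \<noteq> 0\<close>] by (auto simp: r_def)
  define \<theta> where "\<theta> = v /\<^sub>R r"
  have v: "v = r *\<^sub>R \<theta>" using r by (simp add: \<theta>_def)
  have "r\<^sup>2 * g x \<theta> \<theta> = r\<^sup>2" using r(2) by (simp add: v g_simps[OF x] power2_eq_square)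
  then have unit: "g x \<theta> \<theta> = 1" using r(1) by simp
  have "g x (Rm x u v v) u = r\<^sup>2 * g x (Rm x u \<theta> \<theta>) u"
    by (simp add: v linear_scale[OF curvature_linear(2)[OF x]] linear_scale[OF curvature_linear(3)[OF x]]
        g_simps[OF x] power2_eq_square)
  also have "\<dots> = \<kappa> * (g x u u * r\<^sup>2 - (r * g x u \<theta>)\<^sup>2)"
    unfolding radial[OF unit] by (simp add: algebra_simps power2_eq_square)
  also have "\<dots> = \<kappa> * (g x u u * g x v v - (g x u v)\<^sup>2)"
    using r(2) by (simp add: v g_simps[OF x])
  finally show ?thesis
    using strict_cauchy_schwarz[OF x uv] by (simp add: sectional_curvature_def)
qed

definition ricci :: "real ^ 'n \<Rightarrow> real ^ 'n \<Rightarrow> real" where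
  "ricci x v = trace (matrix (\<lambda>a. Rm x a v v))"

end

section \<open>Geodesics and Jacobi fields in a chart\<close>

context riem_chart begin

definition geodesic_field :: "(real ^ 'n) \<times> (real ^ 'n) \<Rightarrow> (real ^ 'n) \<times> (real ^ 'n)" where
  "geodesic_field p = (snd p, - \<Gamma> (fst p) (snd p) (snd p))"

lemma open_phase: "open (U \<times> (UNIV :: (real ^ 'n) set))"
  by (intro open_Times open_U open_UNIV)

lemma geodesic_field_Ck: "Ck_on k (U \<times> UNIV) geodesic_field"
proof -
  let ?e = "\<lambda>i. axis i 1 :: real ^ 'n"
  have "Ck_on k (U \<times> UNIV) (\<lambda>p. \<Sum>i\<in>UNIV. \<Sum>j\<in>UNIV. (snd p $ i * snd p $ j) *\<^sub>R \<Gamma> (fst p) (?e i) (?e j))"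
    by (intro Ck_on_sum Ck_on_scaleR Ck_on_mult open_phase
        Ck_on_comp_bounded_linear[OF bounded_linear_fst open_U open_phase _ christoffel_Ck]
        Ck_on_bounded_linear bounded_linear_compose[OF bounded_linear_vec_nth bounded_linear_snd]) auto
  then have christoffel: "Ck_on k (U \<times> UNIV) (\<lambda>p. \<Gamma> (fst p) (snd p) (snd p))"
    by (subst Ck_on_cong[OF open_phase bilinear_expand_axis[OF christoffel_bilinear]]) auto
  show ?thesis
    unfolding geodesic_field_def
    by (intro Ck_on_Pair Ck_on_uminus open_phase christoffel Ck_on_bounded_linear bounded_linear_snd)
qed

lemma geodesic_field_derivative:
  assumes "x \<in> U"
  shows "frechet_derivative geodesic_field (at (x, v)) (j, w) =
    (w, - (d\<Gamma> x v v j + \<Gamma> x w v + \<Gamma> x v w))"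
proof -
  have "((\<lambda>p. \<Gamma> (fst p) (snd p) (snd p)) has_derivative
     (\<lambda>h. d\<Gamma> (fst (x, v)) (snd (x, v)) (snd (x, v)) (fst h) + \<Gamma> (fst (x, v)) (snd h) (snd (x, v))
        + \<Gamma> (fst (x, v)) (snd (x, v)) (snd h))) (at (x, v))"
    by (intro christoffel_field_derivative bounded_linear_imp_has_derivative bounded_linear_fst
        bounded_linear_snd) (use assms in auto)
  from has_derivative_Pair[OF bounded_linear_imp_has_derivative[OF bounded_linear_snd]
      has_derivative_minus[OF this]]
  have "(geodesic_field has_derivative
      (\<lambda>h. (snd h, - (d\<Gamma> x v v (fst h) + \<Gamma> x (snd h) v + \<Gamma> x v (snd h))))) (at (x, v))"
    by (simp add: geodesic_field_def[abs_def])
  from frechet_derivative_at[OF this, symmetric] show ?thesis by simp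
qed

definition geodesic_in_chart :: "real set \<Rightarrow> (real \<Rightarrow> real ^ 'n) \<Rightarrow> (real \<Rightarrow> real ^ 'n) \<Rightarrow> bool" where
  "geodesic_in_chart I x v \<longleftrightarrow> (\<forall>t\<in>I. x t \<in> U \<and> (x has_vector_derivative v t) (at t) \<and>
     (v has_vector_derivative - \<Gamma> (x t) (v t) (v t)) (at t))"

lemma geodesic_in_chartD:
  assumes "geodesic_in_chart I x v" "t \<in> I"
  shows "x t \<in> U" "(x has_vector_derivative v t) (at t)"
    "(v has_vector_derivative - \<Gamma> (x t) (v t) (v t)) (at t)"
  using assms by (auto simp: geodesic_in_chart_def)

lemma geodesic_in_chart_subset: "geodesic_in_chart I x v \<Longrightarrow> I' \<subseteq> I \<Longrightarrow> geodesic_in_chart I' x v"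
  by (auto simp: geodesic_in_chart_def)

lemma geodesic_in_chart_phase:
  assumes "geodesic_in_chart I x v" "t \<in> I"
  shows "(x t, v t) \<in> U \<times> UNIV \<and> ((\<lambda>t. (x t, v t)) has_vector_derivative geodesic_field (x t, v t)) (at t)"
  unfolding geodesic_field_def
  using has_vector_derivative_Pair[OF geodesic_in_chartD(2,3)[OF assms]] geodesic_in_chartD(1)[OF assms]
  by simp

lemma geodesic_in_chart_of_phase:
  assumes "\<And>t. t \<in> I \<Longrightarrow> z t \<in> U \<times> UNIV"
    and "\<And>t. t \<in> I \<Longrightarrow> (z has_vector_derivative geodesic_field (z t)) (at t)"
  shows "geodesic_in_chart I (\<lambda>t. fst (z t)) (\<lambda>t. snd (z t))"
  unfolding geodesic_in_chart_def
proof (intro ballI conjI)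
  fix t assume t: "t \<in> I"
  show "fst (z t) \<in> U" using assms(1)[OF t] by auto
  show "((\<lambda>t. fst (z t)) has_vector_derivative snd (z t)) (at t)"
    "((\<lambda>t. snd (z t)) has_vector_derivative - \<Gamma> (fst (z t)) (snd (z t)) (snd (z t))) (at t)"
    using bounded_linear.has_vector_derivative[OF bounded_linear_fst assms(2)[OF t]]
      bounded_linear.has_vector_derivative[OF bounded_linear_snd assms(2)[OF t]]
    by (simp_all add: geodesic_field_def)
qed

lemma geodesic_field_lipschitz: "local_lipschitz T (U \<times> UNIV) (\<lambda>_. geodesic_field)"
  by (rule C1_imp_local_lipschitz[OF open_phase geodesic_field_Ck])

lemma geodesic_in_chart_unique:
  assumes "geodesic_in_chart I x v" "geodesic_in_chart I x' v'" "open I" "connected I" "t0 \<in> I"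
    "x t0 = x' t0" "v t0 = v' t0" "t \<in> I"
  shows "x t = x' t" "v t = v' t"
proof -
  have "(x t, v t) = (x' t, v' t)"
    by (rule ode_unique[OF geodesic_field_lipschitz, where J=I and ?t0.0=t0 and z="\<lambda>t. (x t, v t)"
          and w="\<lambda>t. (x' t, v' t)"])
      (use assms geodesic_in_chart_phase in auto)
  then show "x t = x' t" "v t = v' t" by auto
qed

lemma geodesic_in_chart_rescale:
  assumes "geodesic_in_chart I x v" "\<And>t. t \<in> I' \<Longrightarrow> k * t \<in> I"
  shows "geodesic_in_chart I' (\<lambda>t. x (k * t)) (\<lambda>t. k *\<^sub>R v (k * t))"
  unfolding geodesic_in_chart_def
proof (intro ballI conjI)
  fix t assume "t \<in> I'"
  note g = geodesic_in_chartD[OF assms(1) assms(2)[OF this]]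
  show "x (k * t) \<in> U" by (rule g)
  show "((\<lambda>t. x (k * t)) has_vector_derivative k *\<^sub>R v (k * t)) (at t)"
    by (rule has_vector_derivative_scale_arg[OF g(2)])
  show "((\<lambda>t. k *\<^sub>R v (k * t)) has_vector_derivative
      - \<Gamma> (x (k * t)) (k *\<^sub>R v (k * t)) (k *\<^sub>R v (k * t))) (at t)"
    using bounded_linear.has_vector_derivative[OF bounded_linear_scaleR_right
        has_vector_derivative_scale_arg[OF g(3)], of k]
    by (simp add: christoffel_simps[OF g(1)])
qed

text \<open>The Jacobi equation is the variational equation of the geodesic equation, rewritten in terms
  of the covariant derivative \<open>K\<close> of \<open>J\<close>.\<close>

definition jacobi_along ::
  "real set \<Rightarrow> (real \<Rightarrow> real ^ 'n) \<Rightarrow> (real \<Rightarrow> real ^ 'n) \<Rightarrow> (real \<Rightarrow> real ^ 'n) \<Rightarrow> (real \<Rightarrow> real ^ 'n) \<Rightarrow> bool" where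
  "jacobi_along I x v J K \<longleftrightarrow> (\<forall>t\<in>I.
     (J has_vector_derivative K t - \<Gamma> (x t) (v t) (J t)) (at t) \<and>
     (K has_vector_derivative - \<Gamma> (x t) (v t) (K t) - Rm (x t) (J t) (v t) (v t)) (at t))"

lemma jacobi_along_subset: "jacobi_along I x v J K \<Longrightarrow> I' \<subseteq> I \<Longrightarrow> jacobi_along I' x v J K"
  by (auto simp: jacobi_along_def)

lemma jacobi_along_variation:
  assumes geo: "geodesic_in_chart I x v"
    and J: "\<And>t. t \<in> I \<Longrightarrow> (J has_vector_derivative W t) (at t)"
    and W: "\<And>t. t \<in> I \<Longrightarrow> (W has_vector_derivative
       - (d\<Gamma> (x t) (v t) (v t) (J t) + \<Gamma> (x t) (W t) (v t) + \<Gamma> (x t) (v t) (W t))) (at t)"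
  shows "jacobi_along I x v J (\<lambda>t. W t + \<Gamma> (x t) (v t) (J t))"
  unfolding jacobi_along_def
proof (intro ballI conjI)
  fix t assume t: "t \<in> I"
  note g = geodesic_in_chartD[OF geo t]
  show "(J has_vector_derivative W t + \<Gamma> (x t) (v t) (J t) - \<Gamma> (x t) (v t) (J t)) (at t)"
    using J[OF t] by simp
  have "((\<lambda>t. W t + \<Gamma> (x t) (v t) (J t)) has_vector_derivative
     - (d\<Gamma> (x t) (v t) (v t) (J t) + \<Gamma> (x t) (W t) (v t) + \<Gamma> (x t) (v t) (W t)) +
     (d\<Gamma> (x t) (v t) (J t) (v t) + \<Gamma> (x t) (- \<Gamma> (x t) (v t) (v t)) (J t) + \<Gamma> (x t) (v t) (W t))) (at t)"
    by (intro has_vector_derivative_add W t christoffel_field_vector_derivative g J)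
  then show "((\<lambda>t. W t + \<Gamma> (x t) (v t) (J t)) has_vector_derivative
     - \<Gamma> (x t) (v t) (W t + \<Gamma> (x t) (v t) (J t)) - Rm (x t) (J t) (v t) (v t)) (at t)"
    using christoffel_sym[OF g(1), of "W t" "v t"] christoffel_sym[OF g(1), of "J t" "v t"]
      christoffel_sym[OF g(1), of "\<Gamma> (x t) (v t) (v t)" "J t"] dchristoffel_sym[OF g(1), of "J t" "v t" "v t"]
    by (simp add: curvature_def christoffel_simps[OF g(1)] algebra_simps)
qed

lemma jacobi_along_linearized_flow:
  assumes geo: "geodesic_in_chart I (\<lambda>t. fst (z t)) (\<lambda>t. snd (z t))"
    and D: "\<And>t. t \<in> I \<Longrightarrow> (D has_vector_derivative frechet_derivative geodesic_field (at (z t)) (D t)) (at t)"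
  shows "jacobi_along I (\<lambda>t. fst (z t)) (\<lambda>t. snd (z t)) (\<lambda>t. fst (D t))
    (\<lambda>t. snd (D t) + \<Gamma> (fst (z t)) (snd (z t)) (fst (D t)))"
proof (rule jacobi_along_variation[OF geo])
  fix t assume t: "t \<in> I"
  have "frechet_derivative geodesic_field (at (z t)) (D t) = (snd (D t),
      - (d\<Gamma> (fst (z t)) (snd (z t)) (snd (z t)) (fst (D t)) + \<Gamma> (fst (z t)) (snd (D t)) (snd (z t))
         + \<Gamma> (fst (z t)) (snd (z t)) (snd (D t))))"
    using geodesic_field_derivative[OF geodesic_in_chartD(1)[OF geo t], of "snd (z t)" "fst (D t)" "snd (D t)"]
    by simp
  note D = D[OF t, unfolded this]
  show "((\<lambda>t. fst (D t)) has_vector_derivative snd (D t)) (at t)"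
    "((\<lambda>t. snd (D t)) has_vector_derivative
      - (d\<Gamma> (fst (z t)) (snd (z t)) (snd (z t)) (fst (D t)) + \<Gamma> (fst (z t)) (snd (D t)) (snd (z t))
         + \<Gamma> (fst (z t)) (snd (z t)) (snd (D t)))) (at t)"
    using bounded_linear.has_vector_derivative[OF bounded_linear_fst D]
      bounded_linear.has_vector_derivative[OF bounded_linear_snd D]
    by simp_all
qed

end

locale geodesic_variation = riem_chart M c
  for M :: "('a, 'n::finite) rspace" and c :: "('a, 'n) chart" +
  fixes s \<rho> :: real and x0 \<theta> :: "real ^ 'n" and X V :: "real ^ 'n \<Rightarrow> real \<Rightarrow> real ^ 'n"
    and J K :: "real \<Rightarrow> real ^ 'n \<Rightarrow> real ^ 'n"
  assumes s: "s > 0" and \<rho>: "\<rho> > 0"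
    and geodesic: "\<And>\<xi>. \<xi> \<in> ball \<theta> \<rho> \<Longrightarrow> geodesic_in_chart {-s<..<s} (X \<xi>) (V \<xi>)"
    and X0: "\<And>\<xi>. \<xi> \<in> ball \<theta> \<rho> \<Longrightarrow> X \<xi> 0 = x0" and V0: "\<And>\<xi>. \<xi> \<in> ball \<theta> \<rho> \<Longrightarrow> V \<xi> 0 = \<xi>"
    and jacobi: "\<And>\<eta>. jacobi_along {-s<..<s} (X \<theta>) (V \<theta>) (\<lambda>t. J t \<eta>) (\<lambda>t. K t \<eta>)"
    and J0: "\<And>\<eta>. J 0 \<eta> = 0" and K0: "\<And>\<eta>. K 0 \<eta> = \<eta>"
    and variation: "\<And>t. t \<in> {-s<..<s} \<Longrightarrow> ((\<lambda>\<xi>. X \<xi> t) has_derivative J t) (at \<theta>)"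

lemma (in riem_chart) geodesic_variation_exists:
  assumes x0: "x0 \<in> U"
  obtains s \<rho> X V J K where "geodesic_variation M c s \<rho> x0 \<theta> X V J K"
proof -
  have p: "(x0, \<theta>) \<in> U \<times> UNIV" using x0 by simp
  obtain \<rho> s :: real and Z
    and D :: "(real ^ 'n) \<times> (real ^ 'n) \<Rightarrow> real \<Rightarrow> (real ^ 'n) \<times> (real ^ 'n) \<Rightarrow> (real ^ 'n) \<times> (real ^ 'n)"
    where \<rho>: "\<rho> > 0" and s: "s > 0"
    and Z0: "\<And>a. a \<in> ball (x0, \<theta>) \<rho> \<Longrightarrow> Z a 0 = a"
    and ZU: "\<And>a t. a \<in> ball (x0, \<theta>) \<rho> \<Longrightarrow> t \<in> ball 0 s \<Longrightarrow> Z a t \<in> U \<times> UNIV"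
    and dZ: "\<And>a t. a \<in> ball (x0, \<theta>) \<rho> \<Longrightarrow> t \<in> ball 0 s \<Longrightarrow>
       (Z a has_vector_derivative geodesic_field (Z a t)) (at t)"
    and D0: "\<And>a h. a \<in> ball (x0, \<theta>) \<rho> \<Longrightarrow> D a 0 h = h"
    and dD: "\<And>a t h. a \<in> ball (x0, \<theta>) \<rho> \<Longrightarrow> t \<in> ball 0 s \<Longrightarrow> ((\<lambda>t. D a t h) has_vector_derivative
       frechet_derivative geodesic_field (at (Z a t)) (D a t h)) (at t)"
    and variation: "\<And>a t. a \<in> ball (x0, \<theta>) \<rho> \<Longrightarrow> t \<in> ball 0 s \<Longrightarrow> ((\<lambda>a. Z a t) has_derivative D a t) (at a)"
    by (rule C1_flow[OF open_phase geodesic_field_Ck p], rule that)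
  have interval: "{-s<..<s} = ball 0 s" by (simp add: ball_eq_greaterThanLessThan)
  have start: "(x0, \<xi>) \<in> ball (x0, \<theta>) \<rho>" if "\<xi> \<in> ball \<theta> \<rho>" for \<xi>
    using that by (simp add: dist_Pair_Pair)
  have \<theta>: "\<theta> \<in> ball \<theta> \<rho>" using \<rho> by simp
  let ?x = "\<lambda>\<xi> t. fst (Z (x0, \<xi>) t)" and ?v = "\<lambda>\<xi> t. snd (Z (x0, \<xi>) t)"
  let ?J = "\<lambda>t \<eta>. fst (D (x0, \<theta>) t (0, \<eta>))"
  let ?K = "\<lambda>t \<eta>. snd (D (x0, \<theta>) t (0, \<eta>)) + \<Gamma> (?x \<theta> t) (?v \<theta> t) (?J t \<eta>)"
  have geodesic: "geodesic_in_chart {-s<..<s} (?x \<xi>) (?v \<xi>)" if "\<xi> \<in> ball \<theta> \<rho>" for \<xi>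
    unfolding interval
    by (rule geodesic_in_chart_of_phase) (rule ZU[OF start[OF that]] dZ[OF start[OF that]], assumption)+
  show ?thesis
  proof (rule that, unfold_locales)
    show "geodesic_in_chart {-s<..<s} (?x \<xi>) (?v \<xi>)" "?x \<xi> 0 = x0" "?v \<xi> 0 = \<xi>" if "\<xi> \<in> ball \<theta> \<rho>" for \<xi>
      using geodesic[OF that] Z0[OF start[OF that]] by auto
    show "jacobi_along {-s<..<s} (?x \<theta>) (?v \<theta>) (\<lambda>t. ?J t \<eta>) (\<lambda>t. ?K t \<eta>)" for \<eta>
      by (rule jacobi_along_linearized_flow[OF geodesic[OF \<theta>]]) (unfold interval, rule dD[OF start[OF \<theta>]])
    show "?J 0 \<eta> = 0" "?K 0 \<eta> = \<eta>" for \<eta>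
      using D0[OF start[OF \<theta>]] geodesic_in_chartD(1)[OF geodesic[OF \<theta>], of 0] s
      by (simp_all add: christoffel_simps)
    show "((\<lambda>\<xi>. ?x \<xi> t) has_derivative ?J t) (at \<theta>)" if t: "t \<in> {-s<..<s}" for t
    proof -
      have "((\<lambda>\<xi>. (x0, \<xi>)) has_derivative (\<lambda>\<eta>. (0, \<eta>))) (at \<theta>)" by (auto intro!: derivative_eq_intros)
      from has_derivative_compose[OF this variation[OF start[OF \<theta>] t[unfolded interval]]]
      show ?thesis by (rule bounded_linear.has_derivative[OF bounded_linear_fst])
    qed
  qed (fact s \<rho>)+
qed

context geodesic_variation begin

lemma geodesic_variation_shrink:
  assumes "0 < s'" "s' \<le> s"
  shows "geodesic_variation M c s' \<rho> x0 \<theta> X V J K"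
proof -
  have sub: "{-s'<..<s'} \<subseteq> {-s<..<s}" using assms by auto
  show ?thesis
    by unfold_locales
      (use assms \<rho> geodesic_in_chart_subset[OF geodesic sub] jacobi_along_subset[OF jacobi sub]
        X0 V0 J0 K0 variation in auto)
qed

abbreviation "x \<equiv> X \<theta>"
abbreviation "v \<equiv> V \<theta>"

lemma center: "\<theta> \<in> ball \<theta> \<rho>"
  using \<rho> by simp

lemma x_0: "x 0 = x0" and v_0: "v 0 = \<theta>"
  using X0 V0 center by blast+

lemma x_mem_U: "t \<in> {-s<..<s} \<Longrightarrow> x t \<in> U"
  and x_deriv: "t \<in> {-s<..<s} \<Longrightarrow> (x has_vector_derivative v t) (at t)"
  using geodesic_in_chartD[OF geodesic[OF center]] by blast+

lemma x0_mem_U: "x0 \<in> U"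
  using x_mem_U[of 0] s x_0 by simp

lemma J_linear: "t \<in> {-s<..<s} \<Longrightarrow> linear (J t)"
  using variation has_derivative_linear by blast

lemma X_scale:
  assumes k: "k *\<^sub>R \<theta> \<in> ball \<theta> \<rho>" and t: "t \<in> {-s<..<s}" "k * t \<in> {-s<..<s}"
  shows "X (k *\<^sub>R \<theta>) t = x (k * t)"
proof -
  let ?I = "{-s<..<s} \<inter> (\<lambda>r. k * r) -` {-s<..<s}"
  show ?thesis
  proof (rule geodesic_in_chart_unique(1)[where I="?I" and ?t0.0=0 and x="X (k *\<^sub>R \<theta>)"
        and v="V (k *\<^sub>R \<theta>)" and x'="\<lambda>t. x (k * t)" and v'="\<lambda>t. k *\<^sub>R v (k * t)"])
    show "geodesic_in_chart ?I (X (k *\<^sub>R \<theta>)) (V (k *\<^sub>R \<theta>))"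
      by (rule geodesic_in_chart_subset[OF geodesic[OF k]]) auto
    show "geodesic_in_chart ?I (\<lambda>t. x (k * t)) (\<lambda>t. k *\<^sub>R v (k * t))"
      by (rule geodesic_in_chart_rescale[OF geodesic[OF center]]) auto
    show "open ?I" by (intro open_Int open_vimage open_greaterThanLessThan continuous_intros)
    have "convex ((\<lambda>r. k * r) -` {-s<..<s})"
      by (rule convex_linear_vimage) (auto intro: linearI simp: algebra_simps)
    then show "connected ?I" by (intro convex_connected convex_Int) auto
    show "(0::real) \<in> ?I" "t \<in> ?I" using s t by auto
    show "X (k *\<^sub>R \<theta>) 0 = x (k * 0)" "V (k *\<^sub>R \<theta>) 0 = k *\<^sub>R v (k * 0)"
      using X0[OF k] V0[OF k] by (simp_all add: x_0 v_0)
  qed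
qed

lemma J_radial:
  assumes t: "t \<in> {-s<..<s}" shows "J t \<theta> = t *\<^sub>R v t"
proof (rule vector_derivative_unique_at)
  let ?N = "(\<lambda>k. k *\<^sub>R \<theta>) -` ball \<theta> \<rho> \<inter> (\<lambda>k. k * t) -` {-s<..<s}"
  have "((\<lambda>k::real. k *\<^sub>R \<theta>) has_vector_derivative \<theta>) (at 1)" by (auto intro!: derivative_eq_intros)
  from has_derivative_compose[OF this[unfolded has_vector_derivative_def], of "\<lambda>\<xi>. X \<xi> t" "J t"]
  show "((\<lambda>k. X (k *\<^sub>R \<theta>) t) has_vector_derivative J t \<theta>) (at 1)"
    unfolding has_vector_derivative_def
    using variation[OF t] by (simp add: linear_scale[OF J_linear[OF t]])
  have "((\<lambda>k. x (t * k)) has_vector_derivative t *\<^sub>R v t) (at 1)"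
    using x_deriv[OF t] by (intro has_vector_derivative_scale_arg) simp
  then show "((\<lambda>k. X (k *\<^sub>R \<theta>) t) has_vector_derivative t *\<^sub>R v t) (at 1)"
  proof (rule has_vector_derivative_transform_within_open)
    show "open ?N"
      by (intro open_Int open_vimage open_ball open_greaterThanLessThan continuous_intros)
    show "x (t * k) = X (k *\<^sub>R \<theta>) t" if "k \<in> ?N" for k
      using X_scale[of k t] t that by (simp add: mult.commute)
  qed (use t \<rho> in simp)
qed

end

section \<open>Change of charts\<close>

context riem_chart begin

lemma manifold: "smooth_manifold M"
  using riemannian by (simp add: riemannian_manifold_def)

lemma chart_props:
  shows "openin (top_of M) (dom_of c)" "dom_of c \<subseteq> points M"
    "homeomorphic_map (subtopology (top_of M) (dom_of c)) (top_of_set U) (coord c)"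
    "topspace (subtopology (top_of M) (dom_of c)) = dom_of c"
    "inj_on (coord c) (dom_of c)"
proof -
  have "is_chart (top_of M) c" using manifold chart by (auto simp: smooth_manifold_def)
  then show dom_open: "openin (top_of M) (dom_of c)"
    and homeo: "homeomorphic_map (subtopology (top_of M) (dom_of c)) (top_of_set U) (coord c)"
    by (auto simp: is_chart_def U_def)
  show "dom_of c \<subseteq> points M" using openin_subset[OF dom_open] .
  then show dom: "topspace (subtopology (top_of M) (dom_of c)) = dom_of c" by (simp add: Int_absorb1)
  show "inj_on (coord c) (dom_of c)" using homeomorphic_imp_injective_map[OF homeo] dom by simp
qed

definition point_at :: "real ^ 'n \<Rightarrow> 'a" where
  "point_at = inv_into (dom_of c) (coord c)"

lemma point_at: "p \<in> dom_of c \<Longrightarrow> point_at (coord c p) = p"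
  "x \<in> U \<Longrightarrow> coord c (point_at x) = x" "x \<in> U \<Longrightarrow> point_at x \<in> dom_of c"
  unfolding point_at_def U_def
  by (auto simp: inv_into_f_f[OF chart_props(5)] f_inv_into_f inv_into_into)

lemma point_at_continuous: "continuous_map (top_of_set U) (top_of M) point_at"
proof -
  obtain h where h: "homeomorphic_maps (subtopology (top_of M) (dom_of c)) (top_of_set U) (coord c) h"
    using chart_props(3) homeomorphic_map_maps by blast
  have "continuous_map (top_of_set U) (top_of M) h"
    using h by (auto simp: homeomorphic_maps_def continuous_map_in_subtopology)
  moreover have "h x = point_at x" if "x \<in> U" for x
  proof -
    have "h x \<in> dom_of c" "coord c (h x) = x"
      using h that chart_props(4) unfolding homeomorphic_maps_def continuous_map_def
      by (auto simp: Pi_iff)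
    then show ?thesis using point_at(1) by metis
  qed
  ultimately show ?thesis by (rule continuous_map_eq) simp
qed

end

locale riem_chart_pair = riem_chart M c + c': riem_chart M c'
  for M :: "('a, 'n::finite) rspace" and c c' :: "('a, 'n) chart"
begin

abbreviation "\<phi> \<equiv> transition c c'"
abbreviation "D\<phi> x \<equiv> frechet_derivative \<phi> (at x)"
definition V where "V = coord c ` (dom_of c \<inter> dom_of c')"

lemma V_subset: "V \<subseteq> U" by (auto simp: V_def U_def)

lemma open_V: "open V"
proof -
  have "openin (subtopology (top_of M) (dom_of c)) (dom_of c \<inter> dom_of c')"
    by (metis c'.chart_props(1) inf_commute openin_subtopology_Int)
  then have "openin (top_of_set U) V"
    unfolding V_def using homeomorphic_imp_open_map[OF chart_props(3)] by (auto simp: open_map_def)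
  then show ?thesis using open_U openin_open_trans by blast
qed

lemma transition_coord: "p \<in> dom_of c \<Longrightarrow> \<phi> (coord c p) = coord c' p"
  using point_at(1) by (simp add: transition_def point_at_def)

lemma transition_point_at: "x \<in> U \<Longrightarrow> \<phi> x = coord c' (point_at x)"
  using transition_coord[OF point_at(3)] point_at(2) by simp

lemma transition_mem: "x \<in> V \<Longrightarrow> \<phi> x \<in> c'.U"
  by (auto simp: V_def transition_coord c'.U_def)

lemma transition_Ck: "Ck_on k V \<phi>"
  using manifold chart c'.chart by (auto simp: smooth_manifold_def smooth_on_def V_def)

lemma transition_has_derivative: "x \<in> V \<Longrightarrow> (\<phi> has_derivative D\<phi> x) (at x)"
  using transition_Ck[of "Suc 0"] by (rule Ck_on_has_derivative)

lemma transition_linear: "x \<in> V \<Longrightarrow> linear (D\<phi> x)"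
  using transition_has_derivative has_derivative_linear by blast

lemma metric_transition:
  assumes "x \<in> V"
  shows "g x u v = c'.g (\<phi> x) (D\<phi> x u) (D\<phi> x v)"
proof -
  obtain p where p: "x = coord c p" "p \<in> dom_of c \<inter> dom_of c'" using assms by (auto simp: V_def)
  have "g (coord c p) u v = c'.g (coord c' p) (D\<phi> (coord c p) u) (D\<phi> (coord c p) v)"
    using riemannian chart c'.chart p(2) unfolding riemannian_manifold_def by blast
  then show ?thesis using p transition_coord by simp
qed

lemma transition_derivative_surj: assumes x: "x \<in> V" shows "surj (D\<phi> x)"
proof (rule linear_injective_imp_surjective[OF transition_linear[OF x]])
  show "inj (D\<phi> x)"
  proof (subst linear_injective_0[OF transition_linear[OF x]], intro allI impI)
    fix u assume "D\<phi> x u = 0"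
    then have "g x u u = 0" using metric_transition[OF x, of u u] c'.g_zero[OF transition_mem[OF x]] by simp
    then show "u = 0" using g_pos[of x u] x V_subset by auto
  qed
qed simp

abbreviation "D2\<phi> x u v \<equiv> frechet_derivative (\<lambda>y. D\<phi> y v) (at x) u"

lemma transition_derivative_differentiable:
  "x \<in> V \<Longrightarrow> (\<lambda>y. D\<phi> y v) differentiable (at x)"
  using transition_Ck[of "Suc (Suc 0)"] by simp

lemma transition_second_derivative_sym: "x \<in> V \<Longrightarrow> D2\<phi> x u v = D2\<phi> x v u"
  using symmetric_second_derivative[OF open_V _ transition_Ck] by blast

lemma dg_transition:
  assumes x: "x \<in> V"
  shows "dg x u v w = c'.dg (\<phi> x) (D\<phi> x u) (D\<phi> x v) (D\<phi> x w)
    + c'.g (\<phi> x) (D2\<phi> x w u) (D\<phi> x v) + c'.g (\<phi> x) (D\<phi> x u) (D2\<phi> x w v)"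
proof -
  have "frechet_derivative (\<lambda>y. g y u v) (at x) =
      frechet_derivative (\<lambda>y. c'.g (\<phi> y) (D\<phi> y u) (D\<phi> y v)) (at x)"
    by (rule frechet_derivative_cong_open[OF open_V x]) (rule metric_transition)
  also have "\<dots> = (\<lambda>w. c'.dg (\<phi> x) (D\<phi> x u) (D\<phi> x v) (D\<phi> x w)
    + c'.g (\<phi> x) (D2\<phi> x w u) (D\<phi> x v) + c'.g (\<phi> x) (D\<phi> x u) (D2\<phi> x w v))"
    by (rule frechet_derivative_at[symmetric])
      (intro c'.g_field_derivative transition_has_derivative x transition_mem
        transition_derivative_differentiable[THEN iffD1[OF frechet_derivative_works]])
  finally show ?thesis by simp
qed

lemma christoffel_transition:
  assumes x: "x \<in> V"
  shows "D\<phi> x (\<Gamma> x u v) = c'.\<Gamma> (\<phi> x) (D\<phi> x u) (D\<phi> x v) + D2\<phi> x u v"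
proof (rule c'.g_eqI[OF transition_mem[OF x]])
  fix z'
  obtain z where z: "z' = D\<phi> x z" using transition_derivative_surj[OF x] by blast
  note x' = transition_mem[OF x]
  have xU: "x \<in> U" using x V_subset by auto
  have "2 * g x (\<Gamma> x u v) z = 2 * (c'.g (\<phi> x) (c'.\<Gamma> (\<phi> x) (D\<phi> x u) (D\<phi> x v)) (D\<phi> x z)
      + c'.g (\<phi> x) (D2\<phi> x u v) (D\<phi> x z))"
    unfolding christoffel_eq[OF xU] dg_transition[OF x] distrib_left c'.christoffel_eq[OF x']
    using transition_second_derivative_sym[OF x, of u v] transition_second_derivative_sym[OF x, of u z]
      transition_second_derivative_sym[OF x, of v z]
      c'.g_sym[OF x', of "D\<phi> x v" "D2\<phi> x u z"] c'.g_sym[OF x', of "D\<phi> x u" "D2\<phi> x v z"]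
    by simp
  then show "c'.g (\<phi> x) (D\<phi> x (\<Gamma> x u v)) z' =
      c'.g (\<phi> x) (c'.\<Gamma> (\<phi> x) (D\<phi> x u) (D\<phi> x v) + D2\<phi> x u v) z'"
    using metric_transition[OF x, of "\<Gamma> x u v" z] by (simp add: z c'.g_simps[OF x'])
qed

lemma geodesic_transition:
  assumes geo: "geodesic_in_chart I x v" and t: "t \<in> I" "x t \<in> V"
  shows "((\<lambda>t. \<phi> (x t)) has_vector_derivative D\<phi> (x t) (v t)) (at t)"
    "((\<lambda>t. D\<phi> (x t) (v t)) has_vector_derivative
       - c'.\<Gamma> (\<phi> (x t)) (D\<phi> (x t) (v t)) (D\<phi> (x t) (v t))) (at t)"
proof -
  note g = geodesic_in_chartD[OF geo t(1)]
  show "((\<lambda>t. \<phi> (x t)) has_vector_derivative D\<phi> (x t) (v t)) (at t)"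
    unfolding has_vector_derivative_def
    by (rule has_derivative_eq_rhs[OF has_derivative_compose[OF g(2)[unfolded has_vector_derivative_def]
        transition_has_derivative[OF t(2)]]])
      (simp add: linear_scale[OF transition_linear[OF t(2)]])
  have "((\<lambda>t. D\<phi> (x t) (v t)) has_vector_derivative
      D2\<phi> (x t) (v t) (v t) + D\<phi> (x t) (- \<Gamma> (x t) (v t) (v t))) (at t)"
    by (rule linear_field_has_vector_derivative[where A="\<lambda>y. D\<phi> y", OF open_V transition_linear
          transition_derivative_differentiable[OF t(2)] g(2) t(2) g(3)])
  moreover have "D2\<phi> (x t) (v t) (v t) + D\<phi> (x t) (- \<Gamma> (x t) (v t) (v t)) =
      - c'.\<Gamma> (\<phi> (x t)) (D\<phi> (x t) (v t)) (D\<phi> (x t) (v t))"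
    using christoffel_transition[OF t(2)] by (simp add: linear_neg[OF transition_linear[OF t(2)]])
  ultimately show "((\<lambda>t. D\<phi> (x t) (v t)) has_vector_derivative
       - c'.\<Gamma> (\<phi> (x t)) (D\<phi> (x t) (v t)) (D\<phi> (x t) (v t))) (at t)"
    by (simp only:)
qed

end

lemma transition_derivative_inverse:
  assumes "riem_chart M c" "riem_chart M c'" "p \<in> dom_of c" "p \<in> dom_of c'"
  shows "frechet_derivative (transition c' c) (at (coord c' p))
    (frechet_derivative (transition c c') (at (coord c p)) u) = u"
proof -
  interpret a: riem_chart_pair M c c' using assms by (simp add: riem_chart_pair_def)
  interpret b: riem_chart_pair M c' c using assms by (simp add: riem_chart_pair_def)
  have pV: "coord c p \<in> a.V" "coord c' p \<in> b.V" using assms by (auto simp: a.V_def b.V_def)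
  have "((\<lambda>x. transition c' c (transition c c' x)) has_derivative
      (\<lambda>u. b.D\<phi> (coord c' p) (a.D\<phi> (coord c p) u))) (at (coord c p))"
    using has_derivative_compose[OF a.transition_has_derivative[OF pV(1)]]
      b.transition_has_derivative[OF pV(2)] a.transition_coord[OF assms(3)] by simp
  moreover have "((\<lambda>x. transition c' c (transition c c' x)) has_derivative (\<lambda>u. u)) (at (coord c p))"
    by (rule has_derivative_transform_within_open[OF has_derivative_ident a.open_V pV(1)])
      (auto simp: a.V_def a.transition_coord b.transition_coord)
  ultimately show ?thesis using has_derivative_unique by metis
qed

section \<open>The exponential map and the density in a chart\<close>

context riem_chart begin

lemma other_chart: "c' \<in> atlas M \<Longrightarrow> riem_chart_pair M c c'"
  by (simp add: riem_chart_pair_def riem_chart_def riemannian chart)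

lemma geodesic_on_of_chart:
  assumes geo: "geodesic_in_chart I x v" and I: "open I" "is_interval I"
  shows "geodesic_on M I (\<lambda>t. point_at (x t))"
  unfolding geodesic_on_def
proof (intro conjI I ballI)
  have x: "continuous_on I x"
    using geodesic_in_chartD(2)[OF geo]
    by (intro continuous_at_imp_continuous_on ballI) (rule has_vector_derivative_continuous)
  have xU: "x t \<in> U" if "t \<in> I" for t using geodesic_in_chartD(1)[OF geo that] .
  have "continuous_map (top_of_set I) (top_of_set U) x"
    using x xU by (auto simp: continuous_map_in_subtopology)
  from continuous_map_compose[OF this point_at_continuous]
  show "continuous_map (top_of_set I) (top_of M) (\<lambda>t. point_at (x t))" by (simp add: o_def)
  fix c' assume "c' \<in> atlas M"
  then interpret a: riem_chart_pair M c c' by (rule other_chart)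
  show "\<exists>v. \<forall>s\<in>I. point_at (x s) \<in> dom_of c' \<longrightarrow>
        ((\<lambda>t. coord c' (point_at (x t))) has_vector_derivative v s) (at s) \<and>
        (v has_vector_derivative - christoffel M c' (coord c' (point_at (x s))) (v s) (v s)) (at s)"
  proof (intro exI[of _ "\<lambda>s. a.D\<phi> (x s) (v s)"] ballI impI)
    fix s assume s: "s \<in> I" "point_at (x s) \<in> dom_of c'"
    have \<phi>: "coord c' (point_at (x t)) = a.\<phi> (x t)" if "t \<in> I" for t
      using a.transition_point_at[OF xU[OF that]] by simp
    have xV: "x s \<in> a.V"
      unfolding a.V_def using s point_at(2,3)[OF xU[OF s(1)]] by (metis IntI image_eqI)
    show "((\<lambda>t. coord c' (point_at (x t))) has_vector_derivative a.D\<phi> (x s) (v s)) (at s) \<and>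
        ((\<lambda>s. a.D\<phi> (x s) (v s)) has_vector_derivative
          - christoffel M c' (coord c' (point_at (x s))) (a.D\<phi> (x s) (v s)) (a.D\<phi> (x s) (v s))) (at s)"
      unfolding \<phi>[OF s(1)]
      using has_vector_derivative_transform_within_open[OF a.geodesic_transition(1)[OF geo s(1) xV] I(1) s(1)]
        a.geodesic_transition(2)[OF geo s(1) xV] \<phi> by auto
  qed
qed

lemma geodesic_on_imp_in_chart:
  assumes \<gamma>: "geodesic_on M I \<gamma>"
  obtains v where "open {t\<in>I. \<gamma> t \<in> dom_of c}"
    "geodesic_in_chart {t\<in>I. \<gamma> t \<in> dom_of c} (\<lambda>t. coord c (\<gamma> t)) v"
proof -
  have I: "open I" and cont: "continuous_map (top_of_set I) (top_of M) \<gamma>"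
    using \<gamma> by (auto simp: geodesic_on_def)
  have "openin (top_of_set I) {t\<in>I. \<gamma> t \<in> dom_of c}"
    using openin_continuous_map_preimage[OF cont chart_props(1)] by simp
  then have "open {t\<in>I. \<gamma> t \<in> dom_of c}" using I by (rule openin_open_trans)
  moreover obtain v where "\<forall>t\<in>I. \<gamma> t \<in> dom_of c \<longrightarrow>
      ((\<lambda>t. coord c (\<gamma> t)) has_vector_derivative v t) (at t) \<and>
      (v has_vector_derivative - \<Gamma> (coord c (\<gamma> t)) (v t) (v t)) (at t)"
    using \<gamma> chart unfolding geodesic_on_def by blast
  then have "geodesic_in_chart {t\<in>I. \<gamma> t \<in> dom_of c} (\<lambda>t. coord c (\<gamma> t)) v"
    by (simp add: geodesic_in_chart_def coord_mem_U)
  ultimately show ?thesis by (rule that)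
qed

context
  fixes I I' :: "real set" and \<gamma> \<gamma>' :: "real \<Rightarrow> 'a" and v v' :: "real \<Rightarrow> real ^ 'n"
  assumes I: "open {t\<in>I. \<gamma> t \<in> dom_of c}" "open {t\<in>I'. \<gamma>' t \<in> dom_of c}"
    and geo: "geodesic_in_chart {t\<in>I. \<gamma> t \<in> dom_of c} (\<lambda>t. coord c (\<gamma> t)) v"
    and geo': "geodesic_in_chart {t\<in>I'. \<gamma>' t \<in> dom_of c} (\<lambda>t. coord c (\<gamma>' t)) v'"
begin

lemma geodesics_agree_near:
  assumes T: "T \<in> I" "T \<in> I'" "\<gamma> T \<in> dom_of c" and eq: "\<gamma> T = \<gamma>' T" "v T = v' T"
  obtains \<eta> where "\<eta> > 0" "\<And>t. t \<in> cball T \<eta> \<Longrightarrow> \<gamma> t = \<gamma>' t \<and> v t = v' t"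
proof -
  let ?J = "{t\<in>I. \<gamma> t \<in> dom_of c} \<inter> {t\<in>I'. \<gamma>' t \<in> dom_of c}"
  have "open ?J" using I by (rule open_Int)
  moreover have "T \<in> ?J" using T eq by auto
  moreover have "(coord c (\<gamma> T), v T) = (coord c (\<gamma>' T), v' T)" using eq by simp
  ultimately obtain \<eta> where \<eta>: "\<eta> > 0" "cball T \<eta> \<subseteq> ?J"
    "\<And>t. t \<in> cball T \<eta> \<Longrightarrow> (coord c (\<gamma> t), v t) = (coord c (\<gamma>' t), v' t)"
    by (rule ode_unique_near[OF geodesic_field_lipschitz])
      (use geodesic_in_chart_phase[OF geo] geodesic_in_chart_phase[OF geo'] in blast)+
  show ?thesis
  proof (rule that[OF \<eta>(1)])
    fix t assume t: "t \<in> cball T \<eta>"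
    then have "\<gamma> t \<in> dom_of c" "\<gamma>' t \<in> dom_of c" using \<eta>(2) by auto
    then show "\<gamma> t = \<gamma>' t \<and> v t = v' t" using \<eta>(3)[OF t] inj_onD[OF chart_props(5)] by auto
  qed
qed

lemma geodesics_agreement_closed:
  assumes cont: "continuous_map (top_of_set S) (top_of M) \<gamma>" "continuous_map (top_of_set S) (top_of M) \<gamma>'"
    and S: "S \<subseteq> I" "S \<subseteq> I'" and dom: "\<And>t. t \<in> S \<Longrightarrow> \<gamma> t \<in> dom_of c"
  shows "closedin (top_of_set S) {t\<in>S. \<gamma> t = \<gamma>' t \<and> v t = v' t}"
proof (rule closedin_trans)
  let ?A = "{t\<in>S. \<gamma> t = \<gamma>' t}"
  have "Hausdorff_space (top_of M)" using manifold by (simp add: smooth_manifold_def)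
  then show "closedin (top_of_set S) ?A"
    using closedin_continuous_maps_eq[of "top_of M" "top_of_set S" \<gamma> \<gamma>'] cont by simp
  have "isCont v t" "isCont v' t" if "t \<in> ?A" for t
  proof -
    have "t \<in> {t\<in>I. \<gamma> t \<in> dom_of c}" "t \<in> {t\<in>I'. \<gamma>' t \<in> dom_of c}" using that S dom[of t] by auto
    then show "isCont v t" "isCont v' t"
      using geodesic_in_chartD(3)[OF geo] geodesic_in_chartD(3)[OF geo'] has_vector_derivative_continuous
      by blast+
  qed
  then have "continuous_on ?A v" "continuous_on ?A v'" by (simp_all add: continuous_at_imp_continuous_on)
  then have "closedin (top_of_set ?A) (?A \<inter> (\<lambda>t. v t - v' t) -` {0})"
    by (intro continuous_closedin_preimage continuous_intros) auto
  moreover have "?A \<inter> (\<lambda>t. v t - v' t) -` {0} = {t\<in>S. \<gamma> t = \<gamma>' t \<and> v t = v' t}" by auto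
  ultimately show "closedin (top_of_set ?A) {t\<in>S. \<gamma> t = \<gamma>' t \<and> v t = v' t}" by simp
qed

end

lemma geodesic_on_agree:
  assumes \<gamma>: "geodesic_on M I \<gamma>" and \<gamma>': "geodesic_on M I' \<gamma>'"
    and S: "connected S" "0 \<in> S" "S \<subseteq> I" "S \<subseteq> I'" and dom: "\<And>t. t \<in> S \<Longrightarrow> \<gamma> t \<in> dom_of c"
    and init: "\<gamma> 0 = \<gamma>' 0" "((\<lambda>t. coord c (\<gamma> t)) has_vector_derivative w) (at 0)"
      "((\<lambda>t. coord c (\<gamma>' t)) has_vector_derivative w) (at 0)"
    and t: "t \<in> S"
  shows "\<gamma> t = \<gamma>' t"
proof -
  obtain v where v: "open {t\<in>I. \<gamma> t \<in> dom_of c}"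
    "geodesic_in_chart {t\<in>I. \<gamma> t \<in> dom_of c} (\<lambda>t. coord c (\<gamma> t)) v"
    by (rule geodesic_on_imp_in_chart[OF \<gamma>])
  obtain v' where v': "open {t\<in>I'. \<gamma>' t \<in> dom_of c}"
    "geodesic_in_chart {t\<in>I'. \<gamma>' t \<in> dom_of c} (\<lambda>t. coord c (\<gamma>' t)) v'"
    by (rule geodesic_on_imp_in_chart[OF \<gamma>'])
  let ?E = "{t\<in>S. \<gamma> t = \<gamma>' t \<and> v t = v' t}"
  have "v 0 = w" "v' 0 = w"
    using geodesic_in_chartD(2)[OF v(2), of 0] geodesic_in_chartD(2)[OF v'(2), of 0] init S dom[OF S(2)]
    by (auto intro: vector_derivative_unique_at)
  then have "0 \<in> ?E" using S(2) init(1) by simp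
  moreover have "openin (top_of_set S) ?E"
  proof (subst openin_contains_ball, intro conjI ballI)
    fix T assume T: "T \<in> ?E"
    obtain \<eta> where \<eta>: "\<eta> > 0" "\<And>t. t \<in> cball T \<eta> \<Longrightarrow> \<gamma> t = \<gamma>' t \<and> v t = v' t"
      by (rule geodesics_agree_near[OF v(1) v'(1) v(2) v'(2), of T]) (use T S dom[of T] in auto)
    then show "\<exists>e>0. ball T e \<inter> S \<subseteq> ?E" by (intro exI[of _ \<eta>]) auto
  qed auto
  moreover have "closedin (top_of_set S) ?E"
    using \<gamma> \<gamma>' S unfolding geodesic_on_def
    by (intro geodesics_agreement_closed[OF v(1) v'(1) v(2) v'(2)] dom)
      (auto intro: continuous_map_from_subtopology_mono)
  ultimately have "?E = S" using S(1) unfolding connected_clopen by blast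
  with t show ?thesis by blast
qed

lemma chart_at: "P \<in> points M \<Longrightarrow> chart_at M P \<in> atlas M \<and> P \<in> dom_of (chart_at M P)"
proof -
  assume "P \<in> points M"
  moreover have "(\<Union>c\<in>atlas M. dom_of c) = points M" using manifold by (simp add: smooth_manifold_def)
  ultimately have "\<exists>c. c \<in> atlas M \<and> P \<in> dom_of c" by blast
  then show ?thesis unfolding chart_at_def by (rule someI_ex)
qed

definition to_chart :: "'a \<Rightarrow> real ^ 'n \<Rightarrow> real ^ 'n" where
  "to_chart P = frechet_derivative (transition (chart_at M P) c) (at (coord (chart_at M P) P))"

lemma chart_at_pairs:
  assumes "P \<in> dom_of c"
  shows "riem_chart_pair M (chart_at M P) c" "riem_chart_pair M c (chart_at M P)"
    "P \<in> dom_of (chart_at M P)"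
  using chart_at[of P] chart_props(2) assms
  by (auto simp: riem_chart_pair_def riem_chart_def riemannian chart)

lemma to_chart:
  assumes P: "P \<in> dom_of c"
  shows "linear (to_chart P)" "surj (to_chart P)"
    "tangent_inner M P u v = g (coord c P) (to_chart P u) (to_chart P v)"
proof -
  interpret a: riem_chart_pair M "chart_at M P" c by (rule chart_at_pairs[OF P])
  have PV: "coord (chart_at M P) P \<in> a.V" using P chart_at_pairs(3)[OF P] by (auto simp: a.V_def)
  show "linear (to_chart P)" "surj (to_chart P)"
    unfolding to_chart_def by (rule a.transition_linear[OF PV], rule a.transition_derivative_surj[OF PV])
  show "tangent_inner M P u v = g (coord c P) (to_chart P u) (to_chart P v)"
    unfolding to_chart_def tangent_inner_def
    using a.metric_transition[OF PV] a.transition_coord[OF chart_at_pairs(3)[OF P]] by simp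
qed

lemma coord_deriv_to_chart:
  assumes P: "P \<in> dom_of c" and \<gamma>: "geodesic_on M I \<gamma>" "0 \<in> I" "\<gamma> 0 = P"
    and deriv: "((\<lambda>t. coord (chart_at M P) (\<gamma> t)) has_vector_derivative \<xi>) (at 0)"
  shows "((\<lambda>t. coord c (\<gamma> t)) has_vector_derivative to_chart P \<xi>) (at 0)"
proof -
  let ?c = "chart_at M P"
  interpret a: riem_chart_pair M ?c c by (rule chart_at_pairs[OF P])
  note P' = chart_at_pairs(3)[OF P]
  obtain v where N: "open {t\<in>I. \<gamma> t \<in> dom_of ?c}"
    by (rule a.geodesic_on_imp_in_chart[OF \<gamma>(1)])
  have "coord ?c P \<in> a.V" using P P' by (auto simp: a.V_def)
  then have "(a.\<phi> has_derivative to_chart P) (at (coord ?c (\<gamma> 0)))"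
    unfolding to_chart_def \<gamma>(3) by (rule a.transition_has_derivative)
  from has_derivative_compose[OF deriv[unfolded has_vector_derivative_def] this]
  have "((\<lambda>t. a.\<phi> (coord ?c (\<gamma> t))) has_vector_derivative to_chart P \<xi>) (at 0)"
    unfolding has_vector_derivative_def
    by (rule has_derivative_eq_rhs) (simp add: linear_scale[OF to_chart(1)[OF P]])
  then show ?thesis
  proof (rule has_vector_derivative_transform_within_open[OF _ N])
    show "0 \<in> {t\<in>I. \<gamma> t \<in> dom_of ?c}" using \<gamma>(2,3) P' by simp
    show "a.\<phi> (coord ?c (\<gamma> t)) = coord c (\<gamma> t)" if "t \<in> {t\<in>I. \<gamma> t \<in> dom_of ?c}" for t
      using that by (simp add: a.transition_coord)
  qed
qed

lemma geodesic_initial_velocity: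
  assumes P: "P \<in> dom_of c" and geo: "geodesic_in_chart I x v" "open I" "0 \<in> I"
    and x0: "x 0 = coord c P" and v0: "v 0 = to_chart P \<xi>"
  shows "((\<lambda>t. coord (chart_at M P) (point_at (x t))) has_vector_derivative \<xi>) (at 0)"
proof -
  let ?c = "chart_at M P"
  interpret b: riem_chart_pair M c ?c by (rule chart_at_pairs[OF P])
  have "x 0 \<in> b.V" unfolding b.V_def x0 using P chart_at_pairs(3)[OF P] by auto
  from b.geodesic_transition(1)[OF geo(1,3) this]
  have "((\<lambda>t. b.\<phi> (x t)) has_vector_derivative b.D\<phi> (x 0) (v 0)) (at 0)" .
  moreover have "b.D\<phi> (x 0) (v 0) = \<xi>"
    unfolding x0 v0 to_chart_def
    by (rule transition_derivative_inverse)
      (use P chart_at_pairs[OF P] in \<open>auto simp: riem_chart_pair_def\<close>)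
  ultimately have "((\<lambda>t. b.\<phi> (x t)) has_vector_derivative \<xi>) (at 0)" by simp
  then show ?thesis
  proof (rule has_vector_derivative_transform_within_open[OF _ geo(2,3)])
    fix t assume "t \<in> I"
    from geodesic_in_chartD(1)[OF geo(1) this] show "b.\<phi> (x t) = coord ?c (point_at (x t))"
      by (rule b.transition_point_at)
  qed
qed

lemma riem_exp_eq:
  assumes P: "P \<in> dom_of c" and geo: "geodesic_in_chart I x v"
    and I: "open I" "is_interval I" "{0..1} \<subseteq> I"
    and x0: "x 0 = coord c P" and v0: "v 0 = to_chart P \<xi>"
  shows "riem_exp M P \<xi> = point_at (x 1)"
  unfolding riem_exp_def
proof (rule the_equality)
  let ?c = "chart_at M P" and ?\<gamma> = "\<lambda>t. point_at (x t)"
  have I0: "0 \<in> I" using I(3) by auto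
  have xU: "x t \<in> U" if "t \<in> I" for t using geodesic_in_chartD(1)[OF geo that] .
  have geoM: "geodesic_on M I ?\<gamma>" by (rule geodesic_on_of_chart[OF geo I(1,2)])
  have \<gamma>0: "?\<gamma> 0 = P" using x0 point_at(1)[OF P] by simp
  note d0 = geodesic_initial_velocity[OF P geo I(1) I0 x0 v0]
  show "\<exists>I \<gamma>. {0..1} \<subseteq> I \<and> geodesic_on M I \<gamma> \<and> \<gamma> 0 = P \<and>
      ((\<lambda>t. coord ?c (\<gamma> t)) has_vector_derivative \<xi>) (at 0) \<and> \<gamma> 1 = point_at (x 1)"
    by (intro exI[of _ I] exI[of _ ?\<gamma>] conjI I(3) geoM \<gamma>0 d0) simp
  fix q assume "\<exists>I \<gamma>. {0..1} \<subseteq> I \<and> geodesic_on M I \<gamma> \<and> \<gamma> 0 = P \<and>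
      ((\<lambda>t. coord ?c (\<gamma> t)) has_vector_derivative \<xi>) (at 0) \<and> \<gamma> 1 = q"
  then obtain I' \<gamma> where I': "{0..1} \<subseteq> I'" and \<gamma>: "geodesic_on M I' \<gamma>" "\<gamma> 0 = P"
    "((\<lambda>t. coord ?c (\<gamma> t)) has_vector_derivative \<xi>) (at 0)" "\<gamma> 1 = q" by blast
  have I'0: "0 \<in> I'" using I' by auto
  have "?\<gamma> 1 = \<gamma> 1"
  proof (rule geodesic_on_agree[OF geoM \<gamma>(1) connected_Icc _ I(3) I'])
    show "?\<gamma> t \<in> dom_of c" if "t \<in> {0..1}" for t using point_at(3)[OF xU, of t] I(3) that by auto
    show "?\<gamma> 0 = \<gamma> 0" using \<gamma>0 \<gamma>(2) by simp
    show "((\<lambda>t. coord c (?\<gamma> t)) has_vector_derivative to_chart P \<xi>) (at 0)"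
      by (rule coord_deriv_to_chart[OF P geoM I0 \<gamma>0 d0])
    show "((\<lambda>t. coord c (\<gamma> t)) has_vector_derivative to_chart P \<xi>) (at 0)"
      by (rule coord_deriv_to_chart[OF P \<gamma>(1) I'0 \<gamma>(2,3)])
  qed auto
  then show "q = point_at (x 1)" using \<gamma>(4) by simp
qed

lemma orthonormal_frame_exists:
  assumes P: "P \<in> dom_of c"
  obtains E where "orthonormal_frame M P E"
proof -
  interpret c0: riem_chart M "chart_at M P"
    using chart_at_pairs(1)[OF P] by (simp add: riem_chart_pair_def)
  let ?x = "coord (chart_at M P) P"
  have x: "?x \<in> c0.U" by (rule c0.coord_mem_U[OF chart_at_pairs(3)[OF P]])
  obtain f :: "'n \<Rightarrow> real ^ 'n" where f: "c0.gram ?x f f = mat 1" by (rule c0.orthonormal_basis_exists[OF x])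
  show ?thesis
  proof (rule that)
    have "linear (\<lambda>u. \<Sum>k\<in>UNIV. u $ k *\<^sub>R f k)"
      by (rule linearI) (simp_all add: scaleR_add_left sum.distrib scaleR_sum_right)
    moreover have "tangent_inner M P (\<Sum>k\<in>UNIV. u $ k *\<^sub>R f k) (\<Sum>k\<in>UNIV. v $ k *\<^sub>R f k) = u \<bullet> v" for u v
      unfolding tangent_inner_def
      by (simp add: c0.g_sum[OF x] c0.g_simps[OF x] c0.orthonormal[OF x f] if_distrib inner_vec_def
          mult.commute cong: if_cong)
    ultimately show "orthonormal_frame M P (\<lambda>u. \<Sum>k\<in>UNIV. u $ k *\<^sub>R f k)"
      by (simp add: orthonormal_frame_def)
  qed
qed

definition frame_at :: "'a \<Rightarrow> 'n \<Rightarrow> real ^ 'n" where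
  "frame_at P i = to_chart P ((SOME E. orthonormal_frame M P E) (axis i 1))"

context
  fixes P E assumes P: "P \<in> dom_of c" and E: "E = (SOME E. orthonormal_frame M P E)"
begin

lemma orthonormal_frame_some: "orthonormal_frame M P E"
  unfolding E by (rule orthonormal_frame_exists[OF P]) (rule someI[of "orthonormal_frame M P"])

lemma frame_linear: "linear E"
  using orthonormal_frame_some by (simp add: orthonormal_frame_def)

lemma g_to_chart_frame: "g (coord c P) (to_chart P (E u)) (to_chart P (E v)) = u \<bullet> v"
  using orthonormal_frame_some to_chart(3)[OF P] by (simp add: orthonormal_frame_def)

lemma frame_surj: "surj E"
proof (rule linear_injective_imp_surjective[OF frame_linear])
  show "inj E"
  proof (subst linear_injective_0[OF frame_linear], intro allI impI)
    fix u assume "E u = 0"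
    then have "to_chart P (E u) = 0" using linear_0[OF to_chart(1)[OF P]] by simp
    then show "u = 0" using g_to_chart_frame[of u u] g_zero[OF coord_mem_U[OF P]] by simp
  qed
qed simp

end

lemma frame_at_orthonormal: "P \<in> dom_of c \<Longrightarrow> gram (coord c P) (frame_at P) (frame_at P) = mat 1"
  by (simp add: gram_def frame_at_def g_to_chart_frame inner_axis_axis mat_def vec_eq_iff)

end

context geodesic_variation begin

context
  fixes P assumes P: "P \<in> dom_of c" and x0: "x0 = coord c P"
begin

lemma riem_exp_variation:
  assumes \<xi>: "\<xi> \<in> ball \<theta> \<rho>" and t: "t \<in> {0<..<s}" and \<zeta>: "to_chart P \<zeta> = t *\<^sub>R \<xi>"
  shows "riem_exp M P \<zeta> = point_at (X \<xi> t)"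
proof -
  let ?I = "{- (s / t)<..<s / t}"
  have geo: "geodesic_in_chart ?I (\<lambda>r. X \<xi> (t * r)) (\<lambda>r. t *\<^sub>R V \<xi> (t * r))"
    by (rule geodesic_in_chart_rescale[OF geodesic[OF \<xi>]]) (use t in \<open>auto simp: field_simps\<close>)
  have "1 < s / t" using t by simp
  then have I: "{0..1} \<subseteq> ?I" by auto
  have "riem_exp M P \<zeta> = point_at (X \<xi> (t * 1))"
    by (rule riem_exp_eq[OF P geo _ _ I]) (use X0[OF \<xi>] V0[OF \<xi>] \<zeta> x0 in \<open>simp_all add: is_interval_oo\<close>)
  then show ?thesis by simp
qed

lemma normal_metric_eq_gram:
  assumes E: "linear E" and t: "t \<in> {0<..<s}" and y: "to_chart P (E y) = t *\<^sub>R \<theta>"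
  shows "normal_metric M P E y =
    (1 / t\<^sup>2) *\<^sub>R gram (x t) (\<lambda>i. J t (to_chart P (E (axis i 1)))) (\<lambda>i. J t (to_chart P (E (axis i 1))))"
proof -
  let ?L = "\<lambda>y. to_chart P (E y) /\<^sub>R t"
  have tI: "t \<in> {-s<..<s}" and t0: "t \<noteq> 0" using t by auto
  have q: "riem_exp M P (E y) = point_at (x t)" by (rule riem_exp_variation[OF center t y])
  have qd: "point_at (x t) \<in> dom_of c" and cq: "coord c (point_at (x t)) = x t"
    using point_at(2,3)[OF x_mem_U[OF tI]] by auto
  let ?c = "chart_at M (point_at (x t))"
  interpret b: riem_chart_pair M c ?c by (rule chart_at_pairs[OF qd])
  have xV: "x t \<in> b.V" unfolding b.V_def using qd chart_at_pairs(3)[OF qd] cq by (metis IntI image_eqI)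
  have "linear ?L"
    using linear_compose_scale_right[OF linear_compose[OF E to_chart(1)[OF P]]] by (simp add: o_def)
  then have L: "bounded_linear ?L" by (simp add: linear_conv_bounded_linear)
  have Ly: "?L y = \<theta>" using y t0 by simp
  have "((\<lambda>y. b.\<phi> (X (?L y) t)) has_derivative (\<lambda>h. b.D\<phi> (x t) (J t (?L h)))) (at y)"
    by (rule has_derivative_compose[OF has_derivative_compose[OF bounded_linear_imp_has_derivative[OF L]]])
      (simp_all only: Ly variation[OF tI] b.transition_has_derivative[OF xV])
  then have "((\<lambda>y. coord ?c (riem_exp M P (E y))) has_derivative (\<lambda>h. b.D\<phi> (x t) (J t (?L h)))) (at y)"
  proof (rule has_derivative_transform_within_open)
    show "open (?L -` ball \<theta> \<rho>)"
      using linear_continuous_on[OF L] by (intro open_vimage open_ball)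
    show "y \<in> ?L -` ball \<theta> \<rho>" using Ly center by simp
    show "b.\<phi> (X (?L y) t) = coord ?c (riem_exp M P (E y))" if "y \<in> ?L -` ball \<theta> \<rho>" for y
    proof -
      have L: "?L y \<in> ball \<theta> \<rho>" using that by simp
      have "to_chart P (E y) = t *\<^sub>R ?L y" using t0 by simp
      from riem_exp_variation[OF L t this] geodesic_in_chartD(1)[OF geodesic[OF L] tI]
      show ?thesis using b.transition_point_at by simp
    qed
  qed
  from frechet_derivative_at[OF this, symmetric]
  have D: "frechet_derivative (\<lambda>y. coord ?c (riem_exp M P (E y))) (at y) = (\<lambda>h. b.D\<phi> (x t) (J t (?L h)))" .
  have "tangent_inner M (point_at (x t)) (b.D\<phi> (x t) a) (b.D\<phi> (x t) b) = g (x t) a b" for a b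
    unfolding tangent_inner_def using b.metric_transition[OF xV, of a b] b.transition_coord[OF qd] cq by simp
  then show ?thesis
    unfolding normal_metric_def Let_def q D
    by (simp add: gram_def vec_eq_iff linear_scale[OF J_linear[OF tI]] g_simps[OF x_mem_U[OF tI]]
        power2_eq_square divide_inverse)
qed

lemma det_gram_eq_density:
  assumes \<theta>: "g x0 \<theta> \<theta> = 1" and t: "t \<in> {0<..<s}" and \<xi>: "to_chart P \<xi> = t *\<^sub>R \<theta>"
  shows "tangent_norm M P \<xi> = t"
    "det (gram (x t) (\<lambda>i. J t (frame_at P i)) (\<lambda>i. J t (frame_at P i))) = t\<^sup>2 * (density M P \<xi>)\<^sup>2"
proof -
  let ?n = "CARD('n)" and ?G = "gram (x t) (\<lambda>i. J t (frame_at P i)) (\<lambda>i. J t (frame_at P i))"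
  let ?E = "SOME E. orthonormal_frame M P E"
  have tI: "t \<in> {-s<..<s}" and t0: "t > 0" using t by auto
  show norm: "tangent_norm M P \<xi> = t"
    unfolding tangent_norm_def to_chart(3)[OF P] \<xi> using t0 \<theta> x0_mem_U
    by (simp add: g_simps x0[symmetric] real_sqrt_mult)
  have "?E (inv ?E \<xi>) = \<xi>" by (rule surj_f_inv_f[OF frame_surj[OF P refl]])
  then have "normal_metric M P ?E (inv ?E \<xi>) = (1 / t\<^sup>2) *\<^sub>R ?G"
    unfolding frame_at_def by (intro normal_metric_eq_gram frame_linear[OF P refl] t) (simp add: \<xi>)
  then have "density M P \<xi> = t ^ (?n - 1) * sqrt ((1 / t\<^sup>2) ^ ?n * det ?G)"
    unfolding density_def Let_def norm by (simp only: det_scaleR)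
  then have "t\<^sup>2 * (density M P \<xi>)\<^sup>2 = (t * t ^ (?n - 1))\<^sup>2 * (1 / t\<^sup>2) ^ ?n * det ?G"
    using gram_det_nonneg[OF x_mem_U[OF tI]] by (simp add: power_mult_distrib)
  also have "t * t ^ (?n - 1) = t ^ ?n" using power_Suc[of t "?n - 1"] by simp
  also have "(t ^ ?n)\<^sup>2 * (1 / t\<^sup>2) ^ ?n = 1"
    using t0 by (simp add: power_divide power_mult[symmetric] mult.commute)
  finally show "det ?G = t\<^sup>2 * (density M P \<xi>)\<^sup>2" by simp
qed

lemma det_gram_eq_density_function:
  assumes \<theta>: "g x0 \<theta> \<theta> = 1" and \<Theta>: "density_function M \<Theta>"
  shows "\<forall>\<^sub>F t in at_right 0.
    det (gram (x t) (\<lambda>i. J t (frame_at P i)) (\<lambda>i. J t (frame_at P i))) = t\<^sup>2 * (\<Theta> t)\<^sup>2"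
proof -
  have "P \<in> points M" using P chart_props(2) by blast
  then obtain \<delta> where \<delta>: "\<delta> > 0" "\<And>\<xi>. 0 < tangent_norm M P \<xi> \<Longrightarrow> tangent_norm M P \<xi> < \<delta> \<Longrightarrow>
      density M P \<xi> = \<Theta> (tangent_norm M P \<xi>)"
    using \<Theta> unfolding density_function_def by blast
  have "\<forall>\<^sub>F t in at_right 0. t \<in> {0<..<min s \<delta>}" by (rule eventually_at_right_real) (use s \<delta> in simp)
  then show ?thesis
  proof (rule eventually_mono)
    fix t assume t: "t \<in> {0<..<min s \<delta>}"
    obtain \<xi> where "to_chart P \<xi> = t *\<^sub>R \<theta>" using to_chart(2)[OF P] by (metis surjD)
    from det_gram_eq_density[OF \<theta> _ this] t \<delta>(2)[of \<xi>]
    show "det (gram (x t) (\<lambda>i. J t (frame_at P i)) (\<lambda>i. J t (frame_at P i))) = t\<^sup>2 * (\<Theta> t)\<^sup>2" by simp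
  qed
qed

end

end

section \<open>Second order expansions\<close>

definition second_order :: "(real \<Rightarrow> real) \<Rightarrow> real \<Rightarrow> bool" where
  "second_order a A \<longleftrightarrow> ((\<lambda>t. (a t - 1) / t\<^sup>2) \<longlongrightarrow> A) (at_right 0)"

lemma second_order_tendsto_1:
  assumes "second_order a A" shows "(a \<longlongrightarrow> 1) (at_right 0)"
proof -
  have "((\<lambda>t. (a t - 1) / t\<^sup>2 * t\<^sup>2 + 1) \<longlongrightarrow> A * 0\<^sup>2 + 1) (at_right 0)"
    using assms unfolding second_order_def by (intro tendsto_intros)
  then have "((\<lambda>t. (a t - 1) / t\<^sup>2 * t\<^sup>2 + 1) \<longlongrightarrow> 1) (at_right 0)" by simp
  then show ?thesis
    by (rule Lim_transform_eventually)
      (use eventually_at_right_less[of "0::real"] in \<open>eventually_elim, simp\<close>)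
qed

lemma second_order_unique:
  assumes a: "second_order a A" and b: "second_order b B" and eq: "\<forall>\<^sub>F t in at_right 0. a t = b t"
  shows "A = B"
proof (rule tendsto_unique[OF trivial_limit_at_right_real])
  show "((\<lambda>t. (a t - 1) / t\<^sup>2) \<longlongrightarrow> A) (at_right 0)" using a by (simp add: second_order_def)
  show "((\<lambda>t. (a t - 1) / t\<^sup>2) \<longlongrightarrow> B) (at_right 0)"
    using b[unfolded second_order_def]
    by (rule Lim_transform_eventually) (use eq in \<open>eventually_elim, simp\<close>)
qed

lemma power_quotient_tendsto_1_unique:
  fixes h :: "real \<Rightarrow> real"
  assumes a: "((\<lambda>t. h t / t ^ a) \<longlongrightarrow> 1) (at_right 0)" and b: "((\<lambda>t. h t / t ^ b) \<longlongrightarrow> 1) (at_right 0)"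
  shows "a = b"
proof -
  have False if "i < j" and i: "((\<lambda>t. h t / t ^ i) \<longlongrightarrow> 1) (at_right 0)"
    and j: "((\<lambda>t. h t / t ^ j) \<longlongrightarrow> 1) (at_right 0)" for i j
  proof -
    have "((\<lambda>t. h t / t ^ j * t ^ (j - i)) \<longlongrightarrow> 1 * 0 ^ (j - i)) (at_right 0)"
      by (intro tendsto_intros j)
    moreover have "\<forall>\<^sub>F t in at_right 0. h t / t ^ j * t ^ (j - i) = h t / t ^ i"
      using eventually_at_right_less[of "0::real"]
      by eventually_elim (use \<open>i < j\<close> in \<open>simp add: power_diff\<close>)
    ultimately have "((\<lambda>t. h t / t ^ i) \<longlongrightarrow> 1 * 0 ^ (j - i)) (at_right 0)"
      by (rule Lim_transform_eventually)
    from tendsto_unique[OF trivial_limit_at_right_real i this] show False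
      using \<open>i < j\<close> by (simp add: zero_power)
  qed
  from this[OF _ a b] this[OF _ b a] show ?thesis by (meson linorder_neqE_nat)
qed

lemma second_order_mult:
  assumes "second_order a A" "second_order b B" shows "second_order (\<lambda>t. a t * b t) (A + B)"
proof -
  have "((\<lambda>t. (a t - 1) / t\<^sup>2 * b t + (b t - 1) / t\<^sup>2) \<longlongrightarrow> A * 1 + B) (at_right 0)"
    using assms second_order_tendsto_1[OF assms(2)] unfolding second_order_def by (intro tendsto_intros)
  moreover have "(a t - 1) / t\<^sup>2 * b t + (b t - 1) / t\<^sup>2 = (a t * b t - 1) / t\<^sup>2" for t
    by (simp add: add_divide_distrib[symmetric] algebra_simps)
  ultimately show ?thesis unfolding second_order_def by simp
qed

lemma square_tendsto_0_at_right: "((\<lambda>t::real. t\<^sup>2) \<longlongrightarrow> 0) (at_right 0)"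
  and eventually_square_nonzero_at_right: "\<forall>\<^sub>F t::real in at_right 0. t\<^sup>2 \<noteq> 0"
  by real_asymp (use eventually_at_right_less[of "0::real"] in \<open>eventually_elim, simp\<close>)

lemma second_order_compose:
  assumes a: "second_order a A" and h: "(h has_real_derivative D) (at 1)" "h 1 = 1"
  shows "second_order (\<lambda>t. h (a t)) (D * A)"
proof -
  have "((\<lambda>t. (h (a t) - h 1) /\<^sub>R t\<^sup>2) \<longlongrightarrow> D * A) (at_right 0)"
    using a by (intro difference_quotient_tendsto[OF h(1)[unfolded has_field_derivative_def]]
        square_tendsto_0_at_right eventually_square_nonzero_at_right)
      (simp add: second_order_def divide_inverse_commute)
  then show ?thesis by (simp add: second_order_def h(2) divide_inverse_commute)
qed

lemma second_order_power: "second_order a A \<Longrightarrow> second_order (\<lambda>t. a t ^ n) (of_nat n * A)"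
  by (rule second_order_compose[where h="\<lambda>x. x ^ n"]) (auto intro!: derivative_eq_intros)

lemma second_order_powi: "second_order a A \<Longrightarrow> second_order (\<lambda>t. a t powi k) (of_int k * A)"
  by (rule second_order_compose[where h="\<lambda>x. x powi k"]) (auto intro!: derivative_eq_intros)

lemma second_order_powr: "second_order a A \<Longrightarrow> second_order (\<lambda>t. a t powr r) (r * A)"
  by (rule second_order_compose[where h="\<lambda>x. x powr r"]) (auto intro!: derivative_eq_intros)

lemma second_order_det:
  fixes N :: "real \<Rightarrow> real^'n^'n"
  assumes "((\<lambda>t. (N t - mat 1) /\<^sub>R t\<^sup>2) \<longlongrightarrow> B) (at_right 0)"
  shows "second_order (\<lambda>t. det (N t)) (trace B)"
  using difference_quotient_tendsto[OF has_derivative_det_one assms square_tendsto_0_at_right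
      eventually_square_nonzero_at_right]
  by (simp add: second_order_def divide_inverse_commute)

lemma lhopital_right_0_power:
  fixes f :: "real \<Rightarrow> 'a::euclidean_space"
  assumes f: "(f \<longlongrightarrow> 0) (at_right 0)"
    and f': "\<forall>\<^sub>F t in at_right 0. (f has_vector_derivative f' t) (at t)"
    and lim: "((\<lambda>t. f' t /\<^sub>R t ^ n) \<longlongrightarrow> c) (at_right 0)"
  shows "((\<lambda>t. f t /\<^sub>R t ^ Suc n) \<longlongrightarrow> c /\<^sub>R of_nat (Suc n)) (at_right 0)"
proof (subst tendsto_componentwise_iff, intro ballI)
  fix b :: 'a
  have "((\<lambda>t. f t \<bullet> b / t ^ Suc n) \<longlongrightarrow> c \<bullet> b / of_nat (Suc n)) (at_right 0)"
  proof (rule lhopital_right_0)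
    show "((\<lambda>t. f t \<bullet> b) \<longlongrightarrow> 0) (at_right 0)" using tendsto_inner[OF f tendsto_const, of b] by simp
    show "((\<lambda>t::real. t ^ Suc n) \<longlongrightarrow> 0) (at_right 0)"
      using tendsto_power[OF tendsto_ident_at, of "Suc n" "0::real" "{0<..}"] by simp
    show "\<forall>\<^sub>F t in at_right 0. ((\<lambda>t. f t \<bullet> b) has_real_derivative f' t \<bullet> b) (at t)"
      using f' by (rule eventually_mono)
        (simp add: has_real_derivative_iff_has_vector_derivative
          bounded_linear.has_vector_derivative[OF bounded_linear_inner_left])
    show "\<forall>\<^sub>F t::real in at_right 0. ((\<lambda>t. t ^ Suc n) has_real_derivative of_nat (Suc n) * t ^ n) (at t)"
      using DERIV_pow[of "Suc n"] by simp
    have "((\<lambda>t. (f' t /\<^sub>R t ^ n) \<bullet> b / of_nat (Suc n)) \<longlongrightarrow> c \<bullet> b / of_nat (Suc n)) (at_right 0)"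
      by (intro tendsto_intros lim) simp
    then show "((\<lambda>t. f' t \<bullet> b / (of_nat (Suc n) * t ^ n)) \<longlongrightarrow> c \<bullet> b / of_nat (Suc n)) (at_right 0)"
      by (simp add: field_simps)
  qed (use eventually_at_right_less[of "0::real"] in \<open>eventually_elim, simp\<close>)+
  then show "((\<lambda>t. (f t /\<^sub>R t ^ Suc n) \<bullet> b) \<longlongrightarrow> (c /\<^sub>R of_nat (Suc n)) \<bullet> b) (at_right 0)"
    by (simp add: divide_inverse_commute)
qed

section \<open>Self-adjoint matrices\<close>

lemma trace_square_symmetric:
  fixes Z :: "real^'n^'n"
  assumes "transpose Z = Z"
  shows "trace (Z ** Z) = (\<Sum>i\<in>UNIV. \<Sum>j\<in>UNIV. (Z $ i $ j)\<^sup>2)"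
proof -
  have "Z $ j $ i = Z $ i $ j" for i j using arg_cong[OF assms, of "\<lambda>A. A $ i $ j"] by (simp add: transpose_def)
  then show ?thesis by (simp add: trace_def matrix_matrix_mult_def power2_eq_square)
qed

lemma matrix_inv_unique:
  fixes A B :: "'a::field^'n^'n"
  assumes "A ** B = mat 1" shows "matrix_inv A = B"
proof -
  have "det A \<noteq> 0" using arg_cong[OF assms, of det] by (auto simp: det_mul)
  then have "matrix_inv A ** (A ** B) = B" by (simp add: matrix_mul_assoc matrix_inv_mult)
  then show ?thesis by (simp add: assms)
qed

text \<open>\<open>G\<inverse> W\<close> is self-adjoint with respect to the inner product defined by \<open>G\<close>.\<close>

lemma trace_square_self_adjoint:
  fixes B G W :: "real^'n^'n"
  assumes G: "G = B ** transpose B" "det G \<noteq> 0" and W: "transpose W = W"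
  defines "Y \<equiv> matrix_inv G ** W"
  shows "0 \<le> trace (Y ** Y)" "trace (Y ** Y) = 0 \<Longrightarrow> W = 0"
proof -
  define C where "C = matrix_inv B"
  have B: "det B \<noteq> 0" using G by (auto simp: det_mul)
  have BC: "B ** C = mat 1" "C ** B = mat 1" using matrix_inv_mult[OF B] by (simp_all add: C_def)
  have BCT: "transpose B ** transpose C = mat 1" "transpose C ** transpose B = mat 1"
    using arg_cong[OF BC(1), of transpose] arg_cong[OF BC(2), of transpose]
    by (simp_all add: matrix_transpose_mul transpose_mat)
  have "G ** (transpose C ** C) = B ** (transpose B ** transpose C) ** C"
    by (simp add: G(1) matrix_mul_assoc)
  then have Gi: "matrix_inv G = transpose C ** C" by (intro matrix_inv_unique) (simp add: BC BCT)
  define Z where "Z = C ** W ** transpose C"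
  have Z: "transpose Z = Z" by (simp add: Z_def matrix_transpose_mul W matrix_mul_assoc)
  have "trace (Y ** Y) = trace (transpose C ** (C ** W ** transpose C ** C ** W))"
    by (simp add: Y_def Gi matrix_mul_assoc)
  also have "\<dots> = trace (Z ** Z)" by (subst trace_mul_sym) (simp add: Z_def matrix_mul_assoc)
  finally have tr: "trace (Y ** Y) = (\<Sum>i\<in>UNIV. \<Sum>j\<in>UNIV. (Z $ i $ j)\<^sup>2)"
    unfolding trace_square_symmetric[OF Z] .
  show "0 \<le> trace (Y ** Y)" unfolding tr by (simp add: sum_nonneg)
  assume "trace (Y ** Y) = 0"
  then have "Z = 0" unfolding tr by (simp add: sum_nonneg_eq_0_iff sum_nonneg vec_eq_iff)
  moreover have "B ** Z ** transpose B = (B ** C) ** W ** (transpose C ** transpose B)"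
    by (simp add: Z_def matrix_mul_assoc)
  ultimately show "W = 0" by (simp add: BC BCT)
qed

lemma trace_square_diff_projection:
  fixes S P :: "real^'n^'n" and c \<phi> :: real
  assumes P: "P ** P = P" "trace P = 1" and S: "S ** P = c *\<^sub>R P" "P ** S = c *\<^sub>R P"
  defines "Z \<equiv> S - c *\<^sub>R P - \<phi> *\<^sub>R (mat 1 - P)"
  shows "trace (Z ** Z) = trace (S ** S) - c\<^sup>2 + \<phi>\<^sup>2 * (real CARD('n) - 1) - 2 * \<phi> * (trace S - c)"
  unfolding Z_def
  by (simp only: matrix_mult_simps P S matrix_mul_lid matrix_mul_rid trace_sub trace_scaleR trace_I)
    (simp add: power2_eq_square algebra_simps)

definition outer :: "real^'n \<Rightarrow> real^'n \<Rightarrow> real^'n^'n" where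
  "outer u v = (\<chi> i j. u $ i * v $ j)"

lemma matrix_mult_outer: "A ** outer u v = outer (A *v u) v"
  by (simp add: outer_def matrix_matrix_mult_def matrix_vector_mult_def vec_eq_iff sum_distrib_right
      mult.assoc)

lemma transpose_outer: "transpose (outer u v) = outer v u"
  by (simp add: outer_def transpose_def vec_eq_iff mult.commute)

lemma trace_outer: "trace (outer u v) = u \<bullet> v"
  by (simp add: outer_def trace_def inner_vec_def)

lemma outer_mult_vector: "outer u v *v w = (v \<bullet> w) *\<^sub>R u"
  by (simp add: outer_def matrix_vector_mult_def vec_eq_iff inner_vec_def sum_distrib_left
      sum_distrib_right mult_ac)

lemma outer_scaleR_left: "outer (r *\<^sub>R u) v = r *\<^sub>R outer u v"
  by (simp add: outer_def vec_eq_iff)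

lemma transpose_diff: "transpose (A - B) = transpose A - transpose (B :: real^'n^'m)"
  and transpose_scaleR: "transpose (r *\<^sub>R A) = r *\<^sub>R transpose (A :: real^'n^'m)"
  by (simp_all add: transpose_def vec_eq_iff)

section \<open>Gram matrices of Jacobi fields\<close>

context riem_chart begin

lemma covariant_product_rule:
  assumes x: "(x has_vector_derivative v) (at t)" "x t \<in> U"
    and a: "(a has_vector_derivative A - \<Gamma> (x t) v (a t)) (at t)"
    and b: "(b has_vector_derivative B - \<Gamma> (x t) v (b t)) (at t)"
  shows "((\<lambda>t. g (x t) (a t) (b t)) has_real_derivative g (x t) A (b t) + g (x t) (a t) B) (at t)"
proof -
  have "((\<lambda>t. g (x t) (a t) (b t)) has_vector_derivative dg (x t) (a t) (b t) v
      + g (x t) (A - \<Gamma> (x t) v (a t)) (b t) + g (x t) (a t) (B - \<Gamma> (x t) v (b t))) (at t)"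
    by (rule g_field_vector_derivative[OF _ _ x a b])
  then show ?thesis
    unfolding has_real_derivative_iff_has_vector_derivative
    by (simp add: metric_compatible[OF x(2)] g_simps[OF x(2)])
qed

lemma gram_has_vector_derivative:
  fixes a :: "'k::finite \<Rightarrow> real \<Rightarrow> real ^ 'n" and b :: "'l::finite \<Rightarrow> real \<Rightarrow> real ^ 'n"
  assumes x: "(x has_vector_derivative v) (at t)" "x t \<in> U"
    and a: "\<And>i. (a i has_vector_derivative A i - \<Gamma> (x t) v (a i t)) (at t)"
    and b: "\<And>j. (b j has_vector_derivative B j - \<Gamma> (x t) v (b j t)) (at t)"
  shows "((\<lambda>t. gram (x t) (\<lambda>i. a i t) (\<lambda>j. b j t)) has_vector_derivative
    gram (x t) A (\<lambda>j. b j t) + gram (x t) (\<lambda>i. a i t) B) (at t)"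
  by (intro has_vector_derivative_vecI)
    (use covariant_product_rule[OF x a b] in
      \<open>simp add: gram_component has_real_derivative_iff_has_vector_derivative\<close>)

lemma gram_zero:
  assumes "x \<in> U" shows "gram x (\<lambda>_. 0) b = 0" "gram x a (\<lambda>_. 0) = 0"
  by (simp_all add: vec_eq_iff gram_component g_zero[OF assms])

lemma gram_tendsto:
  fixes a :: "'s \<Rightarrow> 'k::finite \<Rightarrow> real ^ 'n" and b :: "'s \<Rightarrow> 'l::finite \<Rightarrow> real ^ 'n"
  assumes X: "(X \<longlongrightarrow> x) F" "x \<in> U" "\<forall>\<^sub>F t in F. X t \<in> U"
    and a: "\<And>i. ((\<lambda>t. a t i) \<longlongrightarrow> u i) F" and b: "\<And>j. ((\<lambda>t. b t j) \<longlongrightarrow> w j) F"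
  shows "((\<lambda>t. gram (X t) (a t) (b t)) \<longlongrightarrow> gram x u w) F"
  by (intro vec_tendstoI) (simp add: gram_component g_tendsto[OF X a b])

end

locale jacobi_frame = geodesic_variation M c s \<rho> x0 \<theta> X V J K
  for M :: "('a, 'n::finite) rspace" and c s \<rho> x0 \<theta> X V J K +
  fixes f :: "'n \<Rightarrow> real ^ 'n"
  assumes unit: "g x0 \<theta> \<theta> = 1" and frame: "gram x0 f f = mat 1"
begin

abbreviation "I \<equiv> {-s<..<s}"
abbreviation "Jf t i \<equiv> J t (f i)"
abbreviation "Kf t i \<equiv> K t (f i)"
abbreviation "RJ t i \<equiv> Rm (x t) (Jf t i) (v t) (v t)"

definition "\<omega> = frame_coords x0 f \<theta>"
definition "G t = gram (x t) (Jf t) (Jf t)"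
definition "H t = gram (x t) (Kf t) (Jf t)"
definition "L t = gram (x t) (Kf t) (Kf t)"
definition "R t = gram (x t) (RJ t) (Jf t)"
definition "R0 = gram x0 (\<lambda>i. Rm x0 (f i) \<theta> \<theta>) f"

abbreviation "P \<equiv> outer \<omega> \<omega>"

lemma v_deriv: "t \<in> I \<Longrightarrow> (v has_vector_derivative 0 - \<Gamma> (x t) (v t) (v t)) (at t)"
  using geodesic_in_chartD(3)[OF geodesic[OF center]] by simp

lemma J_deriv: "t \<in> I \<Longrightarrow> ((\<lambda>t. J t \<eta>) has_vector_derivative K t \<eta> - \<Gamma> (x t) (v t) (J t \<eta>)) (at t)"
  and K_deriv: "t \<in> I \<Longrightarrow>
    ((\<lambda>t. K t \<eta>) has_vector_derivative - Rm (x t) (J t \<eta>) (v t) (v t) - \<Gamma> (x t) (v t) (K t \<eta>)) (at t)"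
  using jacobi[of \<eta>] unfolding jacobi_along_def by (blast, metis minus_diff_commute)

lemma g_along_deriv:
  assumes t: "t \<in> I" and a: "(a has_vector_derivative A - \<Gamma> (x t) (v t) (a t)) (at t)"
    and b: "(b has_vector_derivative B - \<Gamma> (x t) (v t) (b t)) (at t)"
  shows "((\<lambda>t. g (x t) (a t) (b t)) has_real_derivative g (x t) A (b t) + g (x t) (a t) B) (at t)"
  by (rule covariant_product_rule[OF x_deriv[OF t] x_mem_U[OF t] a b])

lemma gram_along_deriv:
  fixes a :: "'k::finite \<Rightarrow> real \<Rightarrow> real ^ 'n" and b :: "'l::finite \<Rightarrow> real \<Rightarrow> real ^ 'n"
  assumes t: "t \<in> I" and a: "\<And>i. (a i has_vector_derivative A i - \<Gamma> (x t) (v t) (a i t)) (at t)"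
    and b: "\<And>j. (b j has_vector_derivative B j - \<Gamma> (x t) (v t) (b j t)) (at t)"
  shows "((\<lambda>t. gram (x t) (\<lambda>i. a i t) (\<lambda>j. b j t)) has_vector_derivative
    gram (x t) A (\<lambda>j. b j t) + gram (x t) (\<lambda>i. a i t) B) (at t)"
  by (rule gram_has_vector_derivative[OF x_deriv[OF t] x_mem_U[OF t] a b])

lemma constant_on_I:
  assumes "\<And>t. t \<in> I \<Longrightarrow> (h has_real_derivative 0) (at t)" "t \<in> I"
  shows "h t = h 0"
proof -
  obtain c where "\<And>t. t \<in> I \<Longrightarrow> h t = c"
    using has_field_derivative_zero_constant[of I h] assms(1)
    by (metis convex_real_interval(8) has_field_derivative_at_within)
  then show ?thesis using assms(2) s by simp
qed

lemma unit_speed: assumes t: "t \<in> I" shows "g (x t) (v t) (v t) = 1"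
proof -
  have "((\<lambda>t. g (x t) (v t) (v t)) has_real_derivative 0) (at t)" if "t \<in> I" for t
    using g_along_deriv[OF that v_deriv[OF that] v_deriv[OF that]]
    by (simp add: g_simps[OF x_mem_U[OF that]])
  from constant_on_I[OF this t] show ?thesis using unit by (simp add: x_0 v_0)
qed

lemma g_K_velocity: assumes t: "t \<in> I" shows "g (x t) (K t \<eta>) (v t) = g x0 \<eta> \<theta>"
proof -
  have "((\<lambda>t. g (x t) (K t \<eta>) (v t)) has_real_derivative 0) (at t)" if "t \<in> I" for t
    using g_along_deriv[OF that K_deriv[OF that] v_deriv[OF that], of \<eta>]
      jacobi_operator_self_adjoint[OF x_mem_U[OF that], of "J t \<eta>" "v t" "v t"]
    by (simp add: curvature_self g_simps[OF x_mem_U[OF that]])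
  from constant_on_I[OF this t] show ?thesis by (simp add: K0 x_0 v_0)
qed

lemma gauss_lemma: assumes t: "t \<in> I" shows "g (x t) (J t \<eta>) (v t) = t * g x0 \<eta> \<theta>"
proof -
  have "((\<lambda>t. g (x t) (J t \<eta>) (v t) - t * g x0 \<eta> \<theta>) has_real_derivative 0) (at t)" if "t \<in> I" for t
    using DERIV_diff[OF g_along_deriv[OF that J_deriv[OF that] v_deriv[OF that]]
        DERIV_cmult_right[OF DERIV_ident], of \<eta> "g x0 \<eta> \<theta>"] g_K_velocity[OF that]
    by (simp add: g_simps[OF x_mem_U[OF that]])
  from constant_on_I[OF this t] show ?thesis by (simp add: J0 x_0 g_zero[OF x0_mem_U])
qed

lemma jacobi_wronskian: assumes t: "t \<in> I" shows "g (x t) (K t \<eta>) (J t \<zeta>) = g (x t) (K t \<zeta>) (J t \<eta>)"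
proof -
  have "((\<lambda>t. g (x t) (K t \<eta>) (J t \<zeta>) - g (x t) (J t \<eta>) (K t \<zeta>)) has_real_derivative 0) (at t)"
    if "t \<in> I" for t
    using DERIV_diff[OF g_along_deriv[OF that K_deriv[OF that] J_deriv[OF that]]
        g_along_deriv[OF that J_deriv[OF that] K_deriv[OF that]], of \<eta> \<zeta> \<eta> \<zeta>]
      jacobi_operator_self_adjoint[OF x_mem_U[OF that], of "J t \<eta>" "v t" "J t \<zeta>"]
      g_sym[OF x_mem_U[OF that], of "J t \<eta>"]
    by (simp add: g_simps[OF x_mem_U[OF that]])
  from constant_on_I[OF this t] show ?thesis
    by (simp add: J0 x_0 g_zero[OF x0_mem_U] g_sym[OF x_mem_U[OF t], of "J t \<eta>"])
qed

lemma H_transpose: "t \<in> I \<Longrightarrow> transpose (H t) = H t"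
  by (simp add: H_def gram_transpose[OF x_mem_U] vec_eq_iff gram_component jacobi_wronskian
      g_sym[OF x_mem_U, of t "Jf t _"])

lemma G_transpose: "t \<in> I \<Longrightarrow> transpose (G t) = G t"
  by (simp add: G_def gram_transpose[OF x_mem_U])

lemma gram_Jf_Kf: "t \<in> I \<Longrightarrow> gram (x t) (Jf t) (Kf t) = H t"
  using H_transpose[of t] by (simp add: H_def gram_transpose[OF x_mem_U])

lemma G_deriv: assumes t: "t \<in> I" shows "(G has_vector_derivative 2 *\<^sub>R H t) (at t)"
  using gram_along_deriv[OF t J_deriv[OF t] J_deriv[OF t], of f f]
  unfolding G_def[abs_def] gram_Jf_Kf[OF t] by (simp add: H_def scaleR_2)

lemma gram_RJ_neg: "t \<in> I \<Longrightarrow> gram (x t) (\<lambda>i. - RJ t i) b = - gram (x t) (RJ t) b"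
  by (simp add: vec_eq_iff gram_component g_simps[OF x_mem_U])

lemma H_deriv: assumes t: "t \<in> I" shows "(H has_vector_derivative L t - R t) (at t)"
  using gram_along_deriv[OF t K_deriv[OF t] J_deriv[OF t], of f f]
  unfolding H_def[abs_def] L_def R_def gram_RJ_neg[OF t] by simp

lemma L_deriv: assumes t: "t \<in> I"
  shows "(L has_vector_derivative - gram (x t) (RJ t) (Kf t) - transpose (gram (x t) (RJ t) (Kf t))) (at t)"
proof -
  have "gram (x t) (Kf t) (\<lambda>i. - RJ t i) = - transpose (gram (x t) (RJ t) (Kf t))"
    by (simp add: gram_transpose[OF x_mem_U[OF t]] vec_eq_iff gram_component g_simps[OF x_mem_U[OF t]])
  then show ?thesis
    using gram_along_deriv[OF t K_deriv[OF t] K_deriv[OF t], of f f]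
    unfolding L_def[abs_def] gram_RJ_neg[OF t] by simp
qed

lemma \<omega>_unit: "\<omega> \<bullet> \<omega> = 1"
  unfolding \<omega>_def parseval[OF x0_mem_U frame, symmetric] by (rule unit)

lemma J_expand_radial: "t \<in> I \<Longrightarrow> (\<Sum>j\<in>UNIV. \<omega> $ j *\<^sub>R Jf t j) = t *\<^sub>R v t"
  using arg_cong[OF orthonormal_expansion[OF x0_mem_U frame, of \<theta>], of "J t"] J_radial[of t] J_linear[of t]
  by (simp add: \<omega>_def linear_sum linear_scale)

lemma gram_mult_\<omega>:
  assumes t: "t \<in> I" shows "gram (x t) a (Jf t) *v \<omega> = (\<chi> i. t * g (x t) (a i) (v t))"
proof -
  have "(\<Sum>j\<in>UNIV. g (x t) (a i) (Jf t j) * \<omega> $ j) = t * g (x t) (a i) (v t)" for i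
    using arg_cong[OF J_expand_radial[OF t], of "g (x t) (a i)"]
    by (simp add: g_sum[OF x_mem_U[OF t]] g_simps[OF x_mem_U[OF t]] mult.commute)
  then show ?thesis by (simp add: vec_eq_iff matrix_vector_mult_def gram_component)
qed

lemma G_mult_\<omega>: "t \<in> I \<Longrightarrow> G t *v \<omega> = t\<^sup>2 *\<^sub>R \<omega>"
  by (simp add: G_def gram_mult_\<omega> gauss_lemma)
    (simp add: vec_eq_iff \<omega>_def frame_coords_def power2_eq_square g_sym[OF x0_mem_U, of \<theta>])

lemma H_mult_\<omega>: "t \<in> I \<Longrightarrow> H t *v \<omega> = t *\<^sub>R \<omega>"
  by (simp add: H_def gram_mult_\<omega> g_K_velocity)
    (simp add: vec_eq_iff \<omega>_def frame_coords_def g_sym[OF x0_mem_U, of \<theta>])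

lemma eventually_in_I: "\<forall>\<^sub>F t in at_right 0. t \<in> {0<..<s}"
  using s by (rule eventually_at_right_real)

lemma eventually_x_mem_U: "\<forall>\<^sub>F t in at_right 0. x t \<in> U"
  using eventually_in_I by (rule eventually_mono) (simp add: x_mem_U)

lemma tendsto_at_right_0:
  assumes "\<And>t. t \<in> I \<Longrightarrow> (h has_vector_derivative h' t) (at t)"
  shows "(h \<longlongrightarrow> h 0) (at_right 0)"
  using has_vector_derivative_continuous[OF assms, of 0] s
  by (auto simp: continuous_within intro: tendsto_within_subset[OF _ subset_UNIV])

lemma x_tendsto: "(x \<longlongrightarrow> x0) (at_right 0)" and v_tendsto: "(v \<longlongrightarrow> \<theta>) (at_right 0)"
  using tendsto_at_right_0[OF x_deriv] tendsto_at_right_0[OF v_deriv] by (simp_all add: x_0 v_0)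

lemma J_tendsto: "((\<lambda>t. J t \<eta>) \<longlongrightarrow> 0) (at_right 0)" and K_tendsto: "((\<lambda>t. K t \<eta>) \<longlongrightarrow> \<eta>) (at_right 0)"
  using tendsto_at_right_0[OF J_deriv, of \<eta>] tendsto_at_right_0[OF K_deriv, of \<eta>] by (simp_all add: J0 K0)

lemma J_quotient_tendsto: "((\<lambda>t. J t \<eta> /\<^sub>R t) \<longlongrightarrow> \<eta>) (at_right 0)"
proof -
  have "((\<lambda>t. J t \<eta>) has_vector_derivative \<eta>) (at 0)"
    using J_deriv[of 0 \<eta>] s x0_mem_U by (simp add: J0 K0 x_0 christoffel_simps)
  then have "((\<lambda>t. J t \<eta>) has_vector_derivative \<eta>) (at 0 within {0<..})"
    by (rule has_vector_derivative_at_within)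
  then show ?thesis by (simp add: has_vector_derivative_iff_tendsto J0)
qed

lemmas gram_tendsto_0 = gram_tendsto[OF x_tendsto x0_mem_U eventually_x_mem_U]

lemma RJ_quotient_tendsto:
  "((\<lambda>t. Rm (x t) (Jf t i /\<^sub>R t) (v t) (v t)) \<longlongrightarrow> Rm x0 (f i) \<theta> \<theta>) (at_right 0)"
  by (intro curvature_tendsto x_tendsto x0_mem_U eventually_x_mem_U J_quotient_tendsto v_tendsto)

lemma RJ_scale: "t \<in> I \<Longrightarrow> Rm (x t) (Jf t i /\<^sub>R r) (v t) (v t) = RJ t i /\<^sub>R r"
  by (rule linear_scale[OF curvature_linear(1)[OF x_mem_U]])

lemma R_quotient_tendsto: "((\<lambda>t. R t /\<^sub>R t\<^sup>2) \<longlongrightarrow> R0) (at_right 0)"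
proof (rule Lim_transform_eventually)
  show "((\<lambda>t. gram (x t) (\<lambda>i. Rm (x t) (Jf t i /\<^sub>R t) (v t) (v t)) (\<lambda>j. Jf t j /\<^sub>R t)) \<longlongrightarrow> R0) (at_right 0)"
    unfolding R0_def by (intro gram_tendsto_0 RJ_quotient_tendsto J_quotient_tendsto)
  show "\<forall>\<^sub>F t in at_right 0.
      gram (x t) (\<lambda>i. Rm (x t) (Jf t i /\<^sub>R t) (v t) (v t)) (\<lambda>j. Jf t j /\<^sub>R t) = R t /\<^sub>R t\<^sup>2"
    using eventually_in_I
    by (rule eventually_mono)
      (simp add: R_def RJ_scale vec_eq_iff gram_component g_simps[OF x_mem_U] power2_eq_square)
qed

lemma gram_RJ_Kf_quotient_tendsto: "((\<lambda>t. gram (x t) (RJ t) (Kf t) /\<^sub>R t) \<longlongrightarrow> R0) (at_right 0)"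
proof (rule Lim_transform_eventually)
  show "((\<lambda>t. gram (x t) (\<lambda>i. Rm (x t) (Jf t i /\<^sub>R t) (v t) (v t)) (Kf t)) \<longlongrightarrow> R0) (at_right 0)"
    unfolding R0_def by (intro gram_tendsto_0 RJ_quotient_tendsto K_tendsto)
  show "\<forall>\<^sub>F t in at_right 0.
      gram (x t) (\<lambda>i. Rm (x t) (Jf t i /\<^sub>R t) (v t) (v t)) (Kf t) = gram (x t) (RJ t) (Kf t) /\<^sub>R t"
    using eventually_in_I
    by (rule eventually_mono) (simp add: RJ_scale vec_eq_iff gram_component g_simps[OF x_mem_U])
qed

lemma R0_transpose: "transpose R0 = R0"
  unfolding R0_def gram_transpose[OF x0_mem_U]
  by (simp add: vec_eq_iff gram_component g_sym[OF x0_mem_U, of "f _"]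
      jacobi_operator_self_adjoint[OF x0_mem_U])

lemma L_expansion: "((\<lambda>t. (L t - mat 1) /\<^sub>R t\<^sup>2) \<longlongrightarrow> - R0) (at_right 0)"
proof -
  have "((\<lambda>t. (L t - mat 1) /\<^sub>R t ^ Suc 1) \<longlongrightarrow> (- R0 - transpose R0) /\<^sub>R of_nat (Suc 1)) (at_right 0)"
  proof (rule lhopital_right_0_power)
    have "((\<lambda>t. L t - mat 1) \<longlongrightarrow> gram x0 f f - mat 1) (at_right 0)"
      unfolding L_def by (intro tendsto_diff tendsto_const gram_tendsto_0 K_tendsto)
    then show "((\<lambda>t. L t - mat 1) \<longlongrightarrow> 0) (at_right 0)" by (simp add: frame)
    let ?RK = "\<lambda>t. gram (x t) (RJ t) (Kf t)"
    show "\<forall>\<^sub>F t in at_right 0.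
        ((\<lambda>t. L t - mat 1) has_vector_derivative - ?RK t - transpose (?RK t)) (at t)"
      using eventually_in_I by (rule eventually_mono) (auto intro!: derivative_eq_intros L_deriv)
    have "((\<lambda>t. - (?RK t /\<^sub>R t) - transpose (?RK t /\<^sub>R t)) \<longlongrightarrow> - R0 - transpose R0) (at_right 0)"
      by (intro tendsto_diff tendsto_minus gram_RJ_Kf_quotient_tendsto
          tendsto_transpose)
    then show "((\<lambda>t. (- ?RK t - transpose (?RK t)) /\<^sub>R t ^ 1) \<longlongrightarrow> - R0 - transpose R0) (at_right 0)"
      by (simp add: scaleR_diff_right transpose_scaleR)
  qed
  moreover have "(- R0 - transpose R0) /\<^sub>R of_nat (Suc 1) = - R0"
    by (simp add: R0_transpose vec_eq_iff)
  ultimately show ?thesis by (simp add: power2_eq_square)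
qed

lemma H_expansion: "((\<lambda>t. (H t - t *\<^sub>R mat 1) /\<^sub>R t ^ 3) \<longlongrightarrow> (- 2 / 3) *\<^sub>R R0) (at_right 0)"
proof -
  have "((\<lambda>t. (H t - t *\<^sub>R mat 1) /\<^sub>R t ^ Suc 2) \<longlongrightarrow> (- R0 - R0) /\<^sub>R of_nat (Suc 2)) (at_right 0)"
  proof (rule lhopital_right_0_power)
    have "((\<lambda>t. H t - t *\<^sub>R mat 1) \<longlongrightarrow> gram x0 f (\<lambda>j. 0) - 0 *\<^sub>R mat 1) (at_right 0)"
      unfolding H_def
      by (intro tendsto_diff tendsto_scaleR tendsto_ident_at tendsto_const gram_tendsto_0 K_tendsto J_tendsto)
    then show "((\<lambda>t. H t - t *\<^sub>R mat 1) \<longlongrightarrow> 0) (at_right 0)"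
      by (simp add: gram_zero[OF x0_mem_U])
    show "\<forall>\<^sub>F t in at_right 0. ((\<lambda>t. H t - t *\<^sub>R mat 1) has_vector_derivative L t - R t - mat 1) (at t)"
      using eventually_in_I by (rule eventually_mono) (auto intro!: derivative_eq_intros H_deriv)
    have "((\<lambda>t. (L t - mat 1) /\<^sub>R t\<^sup>2 - R t /\<^sub>R t\<^sup>2) \<longlongrightarrow> - R0 - R0) (at_right 0)"
      by (intro tendsto_diff L_expansion R_quotient_tendsto)
    then show "((\<lambda>t. (L t - R t - mat 1) /\<^sub>R t\<^sup>2) \<longlongrightarrow> - R0 - R0) (at_right 0)"
      by (simp add: scaleR_diff_right algebra_simps)
  qed
  moreover have "(- R0 - R0) /\<^sub>R of_nat (Suc 2) = (- 2 / 3) *\<^sub>R R0" by (simp add: vec_eq_iff)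
  ultimately show ?thesis by (simp add: numeral_3_eq_3 numeral_2_eq_2)
qed

lemma G_expansion: "((\<lambda>t. (G t - t\<^sup>2 *\<^sub>R mat 1) /\<^sub>R t ^ 4) \<longlongrightarrow> (- 1 / 3) *\<^sub>R R0) (at_right 0)"
proof -
  have "((\<lambda>t. (G t - t\<^sup>2 *\<^sub>R mat 1) /\<^sub>R t ^ Suc 3) \<longlongrightarrow> 2 *\<^sub>R ((- 2 / 3) *\<^sub>R R0) /\<^sub>R of_nat (Suc 3)) (at_right 0)"
  proof (rule lhopital_right_0_power)
    have "((\<lambda>t. G t - t\<^sup>2 *\<^sub>R mat 1) \<longlongrightarrow> gram x0 (\<lambda>i. 0) (\<lambda>j. 0) - 0 *\<^sub>R mat 1) (at_right 0)"
      unfolding G_def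
      by (intro tendsto_diff tendsto_scaleR square_tendsto_0_at_right tendsto_const gram_tendsto_0 J_tendsto)
    then show "((\<lambda>t. G t - t\<^sup>2 *\<^sub>R mat 1) \<longlongrightarrow> 0) (at_right 0)"
      by (simp add: gram_zero[OF x0_mem_U])
    show "\<forall>\<^sub>F t in at_right 0. ((\<lambda>t. G t - t\<^sup>2 *\<^sub>R mat 1) has_vector_derivative
        2 *\<^sub>R (H t - t *\<^sub>R mat 1)) (at t)"
      using eventually_in_I
      by (rule eventually_mono) (auto intro!: derivative_eq_intros G_deriv simp: scaleR_diff_right)
    have "((\<lambda>t. 2 *\<^sub>R ((H t - t *\<^sub>R mat 1) /\<^sub>R t ^ 3)) \<longlongrightarrow> 2 *\<^sub>R ((- 2 / 3) *\<^sub>R R0)) (at_right 0)"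
      by (intro tendsto_scaleR tendsto_const H_expansion)
    then show "((\<lambda>t. 2 *\<^sub>R (H t - t *\<^sub>R mat 1) /\<^sub>R t ^ 3) \<longlongrightarrow> 2 *\<^sub>R ((- 2 / 3) *\<^sub>R R0)) (at_right 0)"
      by (simp add: mult.commute)
  qed
  moreover have "2 *\<^sub>R ((- 2 / 3) *\<^sub>R R0) /\<^sub>R of_nat (Suc 3) = (- 1 / 3) *\<^sub>R R0" by (simp add: vec_eq_iff)
  ultimately show ?thesis by (simp add: eval_nat_numeral)
qed

lemma trace_R0: "trace R0 = ricci x0 \<theta>"
  unfolding R0_def ricci_def
  by (rule trace_orthonormal[OF x0_mem_U frame, symmetric]) (rule curvature_linear(1)[OF x0_mem_U])

lemma det_G_second_order: "second_order (\<lambda>t. det (G t) / t ^ (2 * CARD('n))) (- ricci x0 \<theta> / 3)"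
proof -
  have "((\<lambda>t. (G t /\<^sub>R t\<^sup>2 - mat 1) /\<^sub>R t\<^sup>2) \<longlongrightarrow> (- 1 / 3) *\<^sub>R R0) (at_right 0)"
  proof (rule Lim_transform_eventually[OF G_expansion])
    show "\<forall>\<^sub>F t in at_right 0. (G t - t\<^sup>2 *\<^sub>R mat 1) /\<^sub>R t ^ 4 = (G t /\<^sub>R t\<^sup>2 - mat 1) /\<^sub>R t\<^sup>2"
      using eventually_square_nonzero_at_right
      by eventually_elim (simp add: scaleR_diff_right power2_eq_square power4_eq_xxxx field_simps)
  qed
  from second_order_det[OF this, unfolded trace_scaleR trace_R0]
  have "second_order (\<lambda>t. det (G t /\<^sub>R t\<^sup>2)) (- ricci x0 \<theta> / 3)" by simp
  moreover have "det (G t /\<^sub>R t\<^sup>2) = det (G t) / t ^ (2 * CARD('n))" for t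
    by (simp add: det_scaleR power_mult power_inverse divide_inverse_commute)
  ultimately show ?thesis by simp
qed

section \<open>The Riccati equation of the shape operator\<close>

definition "S t = matrix_inv (G t) ** H t"

lemma det_G_deriv:
  assumes t: "t \<in> I" and det: "det (G t) \<noteq> 0"
  shows "((\<lambda>t. det (G t)) has_real_derivative 2 * det (G t) * trace (S t)) (at t)"
  using det_has_real_derivative[of G, OF G_deriv[OF t] det]
  by (simp add: S_def matrix_mult_simps trace_scaleR mult_ac)

lemma trace_S_deriv:
  assumes t: "t \<in> I" and det: "det (G t) \<noteq> 0"
  shows "((\<lambda>t. trace (S t)) has_real_derivative - trace (S t ** S t) - ricci (x t) (v t)) (at t)"
proof -
  have L: "L t = H t ** matrix_inv (G t) ** H t"
    using gram_via_basis[OF x_mem_U[OF t], of "Jf t" "Kf t" "Kf t"] gram_Jf_Kf[OF t] det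
    by (simp add: L_def G_def H_def)
  have ricci: "trace (matrix_inv (G t) ** R t) = ricci (x t) (v t)"
    unfolding ricci_def R_def G_def
    by (rule trace_eq_gram[OF x_mem_U[OF t] _ curvature_linear(1)[OF x_mem_U[OF t]], symmetric])
      (use det in \<open>simp add: G_def\<close>)
  have "(S has_vector_derivative matrix_inv (G t) ** (L t - R t)
      + - (matrix_inv (G t) ** (2 *\<^sub>R H t) ** matrix_inv (G t)) ** H t) (at t)"
    unfolding S_def[abs_def]
    by (rule bounded_bilinear.has_vector_derivative[OF bounded_bilinear_matrix_mult
          has_vector_derivative_matrix_inv[of G, OF G_deriv[OF t] det] H_deriv[OF t]])
  then have "((\<lambda>t. trace (S t)) has_vector_derivative trace (matrix_inv (G t) ** (L t - R t)
      + - (matrix_inv (G t) ** (2 *\<^sub>R H t) ** matrix_inv (G t)) ** H t)) (at t)"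
    by (rule bounded_linear.has_vector_derivative[OF bounded_linear_trace])
  moreover have "matrix_inv (G t) ** (L t - R t)
      + - (matrix_inv (G t) ** (2 *\<^sub>R H t) ** matrix_inv (G t)) ** H t
      = - (S t ** S t) - matrix_inv (G t) ** R t"
    by (simp only: L S_def matrix_mult_simps matrix_mul_assoc) (simp add: scaleR_2)
  moreover have "trace (- (S t ** S t)) = - trace (S t ** S t)"
    using trace_scaleR[of "- 1" "S t ** S t"] by simp
  ultimately show ?thesis
    by (simp add: has_real_derivative_iff_has_vector_derivative trace_sub ricci)
qed

lemma
  assumes t: "t \<in> {0<..<s}" and det: "det (G t) \<noteq> 0"
  shows S_mult_P: "S t ** P = (1 / t) *\<^sub>R P" and P_mult_S: "P ** S t = (1 / t) *\<^sub>R P"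
proof -
  have t0: "t \<noteq> 0" and tI: "t \<in> I" using t by auto
  note inv = matrix_inv_mult[OF det]
  have "matrix_inv (G t) *v (G t *v \<omega>) = \<omega>" by (simp add: matrix_vector_mul_assoc inv)
  then have "t\<^sup>2 *\<^sub>R (matrix_inv (G t) *v \<omega>) = \<omega>" by (simp add: G_mult_\<omega>[OF tI] matrix_vector_mult_scaleR)
  from arg_cong[OF this, of "(*\<^sub>R) (1 / t\<^sup>2)"]
  have inv_\<omega>: "matrix_inv (G t) *v \<omega> = (1 / t\<^sup>2) *\<^sub>R \<omega>" using t0 by simp
  have "S t *v \<omega> = (1 / t) *\<^sub>R \<omega>"
    using t0 by (simp add: S_def matrix_vector_mul_assoc[symmetric] H_mult_\<omega>[OF tI] inv_\<omega>
        matrix_vector_mult_scaleR power2_eq_square)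
  then show "S t ** P = (1 / t) *\<^sub>R P" by (simp add: matrix_mult_outer outer_scaleR_left)
  have "G t ** transpose (matrix_inv (G t)) = mat 1"
    using arg_cong[OF inv(2), of transpose] by (simp add: matrix_transpose_mul G_transpose[OF tI])
  then have "transpose (matrix_inv (G t)) = matrix_inv (G t)" by (rule matrix_inv_unique[symmetric])
  then have "transpose (P ** S t) = H t ** (matrix_inv (G t) ** P)"
    by (simp add: S_def matrix_transpose_mul transpose_outer H_transpose[OF tI] matrix_mul_assoc)
  also have "\<dots> = (1 / t) *\<^sub>R P"
    using t0 by (simp add: matrix_mult_outer inv_\<omega> matrix_vector_mult_scaleR H_mult_\<omega>[OF tI]
        outer_scaleR_left[symmetric] power2_eq_square)
  finally have "transpose (transpose (P ** S t)) = transpose ((1 / t) *\<^sub>R P)" by simp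
  then show "P ** S t = (1 / t) *\<^sub>R P" by (simp add: transpose_scaleR transpose_outer)
qed

lemma G_mult_P: "t \<in> I \<Longrightarrow> G t ** P = t\<^sup>2 *\<^sub>R P"
  by (simp add: matrix_mult_outer G_mult_\<omega> outer_scaleR_left)

lemma shape_operator_deviation:
  fixes \<phi> :: real
  assumes t: "t \<in> {0<..<s}" and det: "det (G t) \<noteq> 0"
  defines "deviation \<equiv>
    trace (S t ** S t) - (1 / t)\<^sup>2 + \<phi>\<^sup>2 * (real CARD('n) - 1) - 2 * \<phi> * (trace (S t) - 1 / t)"
  shows "0 \<le> deviation" "deviation = 0 \<Longrightarrow> H t = t *\<^sub>R P + \<phi> *\<^sub>R (G t - t\<^sup>2 *\<^sub>R P)"
proof -
  have t0: "t \<noteq> 0" and tI: "t \<in> I" using t by auto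
  define W where "W = H t - t *\<^sub>R P - \<phi> *\<^sub>R (G t - t\<^sup>2 *\<^sub>R P)"
  define Z where "Z = S t - (1 / t) *\<^sub>R P - \<phi> *\<^sub>R (mat 1 - P)"
  have "W = G t ** Z"
    using t0 by (simp add: W_def Z_def S_def matrix_mult_simps matrix_mul_assoc matrix_inv_mult[OF det]
        G_mult_P[OF tI] power2_eq_square)
  then have Z: "matrix_inv (G t) ** W = Z" by (simp add: matrix_mul_assoc matrix_inv_mult[OF det])
  have "P ** P = P" "trace P = 1" by (simp_all add: matrix_mult_outer outer_mult_vector trace_outer \<omega>_unit)
  then have deviation: "trace (Z ** Z) = deviation"
    unfolding Z_def deviation_def
    by (rule trace_square_diff_projection[OF _ _ S_mult_P[OF t det] P_mult_S[OF t det]])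
  have W: "transpose W = W"
    by (simp add: W_def transpose_diff transpose_scaleR transpose_outer H_transpose[OF tI] G_transpose[OF tI])
  obtain B :: "real ^ 'n ^ 'n" where "G t = B ** transpose B"
    by (rule gram_factorization[OF x_mem_U[OF tI], of "Jf t", folded G_def])
  note self_adjoint = trace_square_self_adjoint[OF this det W, unfolded Z deviation]
  show "0 \<le> deviation" by (rule self_adjoint(1))
  assume "deviation = 0"
  then have "W = 0" by (rule self_adjoint(2))
  then show "H t = t *\<^sub>R P + \<phi> *\<^sub>R (G t - t\<^sup>2 *\<^sub>R P)" by (simp add: W_def algebra_simps)
qed

lemma riccati_comparison:
  fixes \<kappa> \<phi> :: real and \<Theta> a a' :: "real \<Rightarrow> real"
  assumes det: "\<And>t. t \<in> {0<..<s} \<Longrightarrow> det (G t) = t\<^sup>2 * (\<Theta> t)\<^sup>2"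
    and nonzero: "\<And>t. t \<in> {0<..<s} \<Longrightarrow> \<Theta> t \<noteq> 0"
    and d\<Theta>: "\<And>t. t \<in> {0<..<s} \<Longrightarrow> (\<Theta> has_real_derivative \<Theta> t * a t) (at t)"
    and da: "\<And>t. t \<in> {0<..<s} \<Longrightarrow> (a has_real_derivative a' t) (at t)"
    and t: "t \<in> {0<..<s}" and ricci: "ricci (x t) (v t) = \<kappa>"
  defines "deviation \<equiv> - a' t - \<kappa> + \<phi>\<^sup>2 * (real CARD('n) - 1) - 2 * \<phi> * a t"
  shows "0 \<le> deviation" "deviation = 0 \<Longrightarrow> H t = t *\<^sub>R P + \<phi> *\<^sub>R (G t - t\<^sup>2 *\<^sub>R P)"
proof -
  have det_nonzero: "det (G t) \<noteq> 0" if "t \<in> {0<..<s}" for t using det nonzero that by auto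
  have trace_S: "trace (S t) = a t + 1 / t" if t: "t \<in> {0<..<s}" for t
  proof -
    have "((\<lambda>t. t\<^sup>2 * (\<Theta> t)\<^sup>2) has_real_derivative 2 * (t\<^sup>2 * (\<Theta> t)\<^sup>2) * (a t + 1 / t)) (at t)"
      using t by (auto intro!: derivative_eq_intros d\<Theta>[OF t] simp: power2_eq_square field_simps)
    then have "((\<lambda>t. det (G t)) has_real_derivative 2 * det (G t) * (a t + 1 / t)) (at t)"
      unfolding det[OF t]
      by (rule has_field_derivative_transform_within_open[where S="{0<..<s}"]) (use t det in auto)
    from DERIV_unique[OF this det_G_deriv] show ?thesis using t det_nonzero[OF t] by simp
  qed
  have "((\<lambda>t. a t + 1 / t) has_real_derivative a' t - (1 / t)\<^sup>2) (at t)"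
    using t by (auto intro!: derivative_eq_intros da[OF t] simp: power2_eq_square)
  then have "((\<lambda>t. trace (S t)) has_real_derivative a' t - (1 / t)\<^sup>2) (at t)"
    by (rule has_field_derivative_transform_within_open[where S="{0<..<s}"]) (use t trace_S in auto)
  from DERIV_unique[OF this trace_S_deriv]
  have trace_S2: "trace (S t ** S t) = (1 / t)\<^sup>2 - a' t - \<kappa>"
    using t det_nonzero[OF t] by (simp add: ricci)
  show "0 \<le> deviation" "deviation = 0 \<Longrightarrow> H t = t *\<^sub>R P + \<phi> *\<^sub>R (G t - t\<^sup>2 *\<^sub>R P)"
    using shape_operator_deviation[OF t det_nonzero[OF t], of \<phi>]
    by (simp_all add: deviation_def trace_S2 trace_S[OF t])
qed

lemma gram_of_umbilic:
  assumes umbilic: "\<And>t. t \<in> {0<..<s} \<Longrightarrow> H t = t *\<^sub>R P + \<phi> t *\<^sub>R (G t - t\<^sup>2 *\<^sub>R P)"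
    and F: "\<And>t. t \<in> {0<..<s} \<Longrightarrow> (F has_real_derivative \<phi> t * F t) (at t)"
    and nonzero: "\<And>t. t \<in> {0<..<s} \<Longrightarrow> F t \<noteq> 0" and F_0: "((\<lambda>t. F t / t) \<longlongrightarrow> 1) (at_right 0)"
  shows "t \<in> {0<..<s} \<Longrightarrow> G t = t\<^sup>2 *\<^sub>R P + (F t)\<^sup>2 *\<^sub>R (mat 1 - P)"
proof -
  define N where "N t = inverse ((F t)\<^sup>2) *\<^sub>R (G t - t\<^sup>2 *\<^sub>R P)" for t
  have "(N has_vector_derivative 0) (at t)" if t: "t \<in> {0<..<s}" for t
  proof -
    have "((\<lambda>t. inverse ((F t)\<^sup>2)) has_real_derivative - 2 * \<phi> t * inverse ((F t)\<^sup>2)) (at t)"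
      using nonzero[OF t] by (auto intro!: derivative_eq_intros F[OF t] simp: power2_eq_square field_simps)
    moreover have "((\<lambda>t. G t - t\<^sup>2 *\<^sub>R P) has_vector_derivative 2 *\<^sub>R H t - (2 * t) *\<^sub>R P) (at t)"
      using t by (auto intro!: derivative_eq_intros G_deriv)
    ultimately have "(N has_vector_derivative inverse ((F t)\<^sup>2) *\<^sub>R (2 *\<^sub>R H t - (2 * t) *\<^sub>R P)
        + (- 2 * \<phi> t * inverse ((F t)\<^sup>2)) *\<^sub>R (G t - t\<^sup>2 *\<^sub>R P)) (at t)"
      unfolding N_def[abs_def] by (rule has_vector_derivative_scaleR)
    then show ?thesis by (simp add: umbilic[OF t] algebra_simps)
  qed
  then obtain C where C: "\<And>t. t \<in> {0<..<s} \<Longrightarrow> N t = C"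
    using has_vector_derivative_zero_constant[of "{0<..<s}" N]
    by (metis convex_real_interval(8) has_vector_derivative_at_within)
  have "((\<lambda>t. inverse ((F t / t)\<^sup>2) *\<^sub>R (t\<^sup>2 *\<^sub>R ((G t - t\<^sup>2 *\<^sub>R mat 1) /\<^sub>R t ^ 4) + (mat 1 - P)))
      \<longlongrightarrow> inverse (1\<^sup>2) *\<^sub>R (0 *\<^sub>R ((- 1 / 3) *\<^sub>R R0) + (mat 1 - P))) (at_right 0)"
    by (intro tendsto_intros F_0 square_tendsto_0_at_right G_expansion) simp
  moreover have "\<forall>\<^sub>F t in at_right 0.
      inverse ((F t / t)\<^sup>2) *\<^sub>R (t\<^sup>2 *\<^sub>R ((G t - t\<^sup>2 *\<^sub>R mat 1) /\<^sub>R t ^ 4) + (mat 1 - P)) = C"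
    using eventually_in_I
  proof eventually_elim
    case (elim t)
    then have "inverse ((F t / t)\<^sup>2) *\<^sub>R (t\<^sup>2 *\<^sub>R ((G t - t\<^sup>2 *\<^sub>R mat 1) /\<^sub>R t ^ 4) + (mat 1 - P)) = N t"
      using nonzero[OF elim]
      by (simp add: N_def vec_eq_iff power2_eq_square power4_eq_xxxx field_simps)
    then show ?case by (simp add: C[OF elim])
  qed
  ultimately have "((\<lambda>_. C) \<longlongrightarrow> inverse (1\<^sup>2) *\<^sub>R (0 *\<^sub>R ((- 1 / 3) *\<^sub>R R0) + (mat 1 - P))) (at_right (0::real))"
    by (rule Lim_transform_eventually)
  then have C_eq: "C = mat 1 - P" by (simp add: tendsto_const_iff)
  show "G t = t\<^sup>2 *\<^sub>R P + (F t)\<^sup>2 *\<^sub>R (mat 1 - P)" if t: "t \<in> {0<..<s}"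
    unfolding C_eq[symmetric] C[OF t, symmetric] using nonzero[OF t] by (simp add: N_def)
qed

lemma R0_of_gram:
  assumes G: "\<And>t. t \<in> {0<..<s} \<Longrightarrow> G t = t\<^sup>2 *\<^sub>R P + (F t)\<^sup>2 *\<^sub>R (mat 1 - P)"
    and F: "second_order (\<lambda>t. F t / t) A"
  shows "R0 = (- 6 * A) *\<^sub>R (mat 1 - P)"
proof -
  have "((\<lambda>t. (((F t / t)\<^sup>2 - 1) / t\<^sup>2) *\<^sub>R (mat 1 - P)) \<longlongrightarrow> (2 * A) *\<^sub>R (mat 1 - P)) (at_right 0)"
    using second_order_power[OF F, of 2] by (intro tendsto_intros) (simp add: second_order_def)
  moreover have "\<forall>\<^sub>F t in at_right 0.
      (((F t / t)\<^sup>2 - 1) / t\<^sup>2) *\<^sub>R (mat 1 - P) = (G t - t\<^sup>2 *\<^sub>R mat 1) /\<^sub>R t ^ 4"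
    using eventually_in_I
    by eventually_elim (simp add: G vec_eq_iff power2_eq_square power4_eq_xxxx field_simps)
  ultimately have "((\<lambda>t. (G t - t\<^sup>2 *\<^sub>R mat 1) /\<^sub>R t ^ 4) \<longlongrightarrow> (2 * A) *\<^sub>R (mat 1 - P)) (at_right 0)"
    by (rule Lim_transform_eventually)
  then have "(2 * A) *\<^sub>R (mat 1 - P) = (- 1 / 3) *\<^sub>R R0"
    by (rule tendsto_unique[OF trivial_limit_at_right_real _ G_expansion])
  then have "- 3 *\<^sub>R ((2 * A) *\<^sub>R (mat 1 - P)) = - 3 *\<^sub>R ((- 1 / 3) *\<^sub>R R0)" by (rule arg_cong)
  then show ?thesis by simp
qed

lemma radial_curvature:
  assumes R0: "R0 = \<kappa> *\<^sub>R (mat 1 - P)"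
  shows "g x0 (Rm x0 u \<theta> \<theta>) u = \<kappa> * (g x0 u u - (g x0 u \<theta>)\<^sup>2)"
proof -
  let ?w = "frame_coords x0 f u"
  have "g x0 (Rm x0 u \<theta> \<theta>) u = ?w \<bullet> (R0 *v ?w)"
    unfolding R0_def
    by (rule quadratic_form_orthonormal[OF x0_mem_U frame curvature_linear(1)[OF x0_mem_U]])
  also have "\<dots> = \<kappa> * (?w \<bullet> ?w - (?w \<bullet> \<omega>)\<^sup>2)"
    by (simp add: R0 scaleR_matrix_vector_assoc[symmetric] matrix_vector_mult_diff_rdistrib outer_mult_vector
        inner_diff_right power2_eq_square inner_commute)
  finally show ?thesis by (simp add: \<omega>_def parseval[OF x0_mem_U frame])
qed

end

section \<open>The model densities\<close>

definition model_sin :: "int \<Rightarrow> real \<Rightarrow> real" where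
  "model_sin \<epsilon> t = (if \<epsilon> = 1 then sin t else sinh t)"

definition model_cos :: "int \<Rightarrow> real \<Rightarrow> real" where
  "model_cos \<epsilon> t = (if \<epsilon> = 1 then cos t else cosh t)"

lemma model_density_eq: "model_density \<epsilon> m k = (\<lambda>t. model_sin \<epsilon> t powi (m - 1) * model_cos \<epsilon> t powi k)"
  by (simp add: fun_eq_iff model_density_def model_sin_def model_cos_def)

definition model_log_deriv :: "int \<Rightarrow> int \<Rightarrow> int \<Rightarrow> real \<Rightarrow> real" where
  "model_log_deriv \<epsilon> m k t = (of_int m - 1) * (model_cos \<epsilon> t / model_sin \<epsilon> t)
     - of_int \<epsilon> * of_int k * (model_sin \<epsilon> t / model_cos \<epsilon> t)"

definition model_slope :: "int \<Rightarrow> real \<Rightarrow> real \<Rightarrow> real" where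
  "model_slope \<epsilon> \<xi> t =
     model_cos \<epsilon> t / model_sin \<epsilon> t - of_int \<epsilon> * \<xi> * (model_sin \<epsilon> t / model_cos \<epsilon> t)"

definition model_profile :: "int \<Rightarrow> real \<Rightarrow> real \<Rightarrow> real" where
  "model_profile \<epsilon> \<xi> t = model_sin \<epsilon> t * model_cos \<epsilon> t powr \<xi>"

definition model_defect :: "int \<Rightarrow> int \<Rightarrow> real \<Rightarrow> real" where
  "model_defect m k \<xi> = of_int k + (of_int m - 1) * \<xi>\<^sup>2 - 2 * \<xi> * of_int k"

context
  fixes \<epsilon> :: int assumes \<epsilon>: "\<epsilon> \<in> {1, -1}"
begin

abbreviation (input) "sn \<equiv> model_sin \<epsilon>"
abbreviation (input) "cs \<equiv> model_cos \<epsilon>"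

lemma model_sin_deriv: "(sn has_real_derivative cs t) (at t)"
  and model_cos_deriv: "(cs has_real_derivative - of_int \<epsilon> * sn t) (at t)"
  using \<epsilon> unfolding model_sin_def[abs_def] model_cos_def[abs_def] by (auto intro!: derivative_eq_intros)

lemma model_pythagoras: "(cs t)\<^sup>2 + of_int \<epsilon> * (sn t)\<^sup>2 = 1"
  using \<epsilon> by (auto simp: model_sin_def model_cos_def cosh_square_eq)

lemma model_sin_pos: "t \<in> {0<..<1} \<Longrightarrow> sn t > 0"
  and model_cos_pos: "t \<in> {0<..<1} \<Longrightarrow> cs t > 0"
  using pi_gt3 by (auto simp: model_sin_def model_cos_def intro!: sin_gt_zero cos_gt_zero_pi)

lemma second_order_model_sin: "second_order (\<lambda>t. sn t / t) (- of_int \<epsilon> / 6)"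
  and second_order_model_cos: "second_order cs (- of_int \<epsilon> / 2)"
proof -
  have "second_order (\<lambda>t. sin t / t) (- 1 / 6)" "second_order cos (- 1 / 2)"
    "second_order (\<lambda>t. sinh t / t) (1 / 6)" "second_order cosh (1 / 2)"
    unfolding second_order_def by real_asymp+
  then show "second_order (\<lambda>t. sn t / t) (- of_int \<epsilon> / 6)" "second_order cs (- of_int \<epsilon> / 2)"
    using \<epsilon> by (auto simp: model_sin_def[abs_def] model_cos_def[abs_def])
qed

lemma model_density_second_order:
  assumes m: "m \<ge> 1"
  shows "second_order (\<lambda>t. (model_density \<epsilon> m k t)\<^sup>2 / t ^ (2 * nat (m - 1)))
    (- (of_int \<epsilon> * (of_int m - 1 + 3 * of_int k)) / 3)"
proof -
  have "second_order (\<lambda>t. (sn t / t) ^ (2 * nat (m - 1)) * cs t powi (2 * k))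
     (of_nat (2 * nat (m - 1)) * (- of_int \<epsilon> / 6) + of_int (2 * k) * (- of_int \<epsilon> / 2))"
    by (intro second_order_mult second_order_power second_order_powi second_order_model_sin
        second_order_model_cos)
  moreover have "(sn t / t) ^ (2 * nat (m - 1)) * cs t powi (2 * k) =
      (model_density \<epsilon> m k t)\<^sup>2 / t ^ (2 * nat (m - 1))" for t
  proof -
    have "cs t powi (2 * k) = (cs t powi k)\<^sup>2"
      by (simp add: power_int_mult[of _ k 2, simplified] mult.commute[of 2 k])
    moreover have "sn t powi (m - 1) = sn t ^ nat (m - 1)" using m by (simp add: power_int_def)
    ultimately show ?thesis
      by (simp add: model_density_eq power_divide power_mult_distrib power_mult[symmetric] mult.commute)
  qed
  moreover have "of_nat (2 * nat (m - 1)) * (- of_int \<epsilon> / 6) + of_int (2 * k) * (- of_int \<epsilon> / 2)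
      = - (of_int \<epsilon> * (of_int m - 1 + 3 * of_int k)) / (3::real)"
    using m by (simp add: field_simps)
  ultimately show ?thesis by simp
qed

lemma model_density_deriv:
  assumes t: "t \<in> {0<..<1}"
  shows "(model_density \<epsilon> m k has_real_derivative model_density \<epsilon> m k t * model_log_deriv \<epsilon> m k t) (at t)"
proof -
  note pos = model_sin_pos[OF t] model_cos_pos[OF t]
  have "(model_density \<epsilon> m k has_real_derivative
      (of_int (m - 1) * sn t powi (m - 1 - 1) * cs t) * cs t powi k
      + sn t powi (m - 1) * (of_int k * cs t powi (k - 1) * (- of_int \<epsilon> * sn t))) (at t)"
    unfolding model_density_eq using pos
    by (auto intro!: derivative_eq_intros model_sin_deriv model_cos_deriv)
  moreover have "sn t powi (m - 1 - 1) = sn t powi (m - 1) / sn t" "cs t powi (k - 1) = cs t powi k / cs t"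
    using pos power_int_diff[of "sn t" "m - 1" 1] power_int_diff[of "cs t" k 1] by auto
  ultimately show ?thesis
    by (simp add: model_density_eq model_log_deriv_def algebra_simps diff_divide_distrib)
qed

lemma model_log_deriv_deriv:
  assumes t: "t \<in> {0<..<1}"
  shows "(model_log_deriv \<epsilon> m k has_real_derivative
    - (of_int m - 1) / (sn t)\<^sup>2 - of_int \<epsilon> * of_int k / (cs t)\<^sup>2) (at t)"
proof -
  have "(model_log_deriv \<epsilon> m k has_real_derivative
      (of_int m - 1) * ((- of_int \<epsilon> * sn t * sn t - cs t * cs t) / (sn t * sn t))
      - of_int \<epsilon> * of_int k * ((cs t * cs t - sn t * (- of_int \<epsilon> * sn t)) / (cs t * cs t))) (at t)"
    unfolding model_log_deriv_def[abs_def] using model_sin_pos[OF t] model_cos_pos[OF t]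
    by (intro DERIV_diff DERIV_cmult DERIV_divide model_sin_deriv model_cos_deriv) auto
  moreover have "- of_int \<epsilon> * sn t * sn t - cs t * cs t = - 1" "cs t * cs t - sn t * (- of_int \<epsilon> * sn t) = 1"
    using model_pythagoras[of t] by (simp_all add: power2_eq_square algebra_simps)
  ultimately show ?thesis by (simp add: power2_eq_square)
qed

lemma model_profile_deriv:
  assumes t: "t \<in> {0<..<1}"
  shows "(model_profile \<epsilon> \<xi> has_real_derivative model_slope \<epsilon> \<xi> t * model_profile \<epsilon> \<xi> t) (at t)"
proof -
  note pos = model_sin_pos[OF t] model_cos_pos[OF t]
  have "(model_profile \<epsilon> \<xi> has_real_derivative cs t * cs t powr \<xi>
      + (\<xi> * cs t powr (\<xi> - 1) * (- of_int \<epsilon> * sn t)) * sn t) (at t)"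
    unfolding model_profile_def[abs_def] using pos
    by (intro DERIV_mult model_sin_deriv has_real_derivative_powr[THEN DERIV_chain2] model_cos_deriv)
  moreover have "cs t * cs t powr \<xi> + (\<xi> * cs t powr (\<xi> - 1) * (- of_int \<epsilon> * sn t)) * sn t
      = model_slope \<epsilon> \<xi> t * model_profile \<epsilon> \<xi> t"
    using pos by (simp add: model_profile_def model_slope_def powr_diff field_simps)
  ultimately show ?thesis by (simp only:)
qed

lemma model_profile_second_order:
  "second_order (\<lambda>t. model_profile \<epsilon> \<xi> t / t) (- of_int \<epsilon> * (1 + 3 * \<xi>) / 6)"
proof -
  have "second_order (\<lambda>t. sn t / t * cs t powr \<xi>) (- of_int \<epsilon> / 6 + \<xi> * (- of_int \<epsilon> / 2))"
    by (intro second_order_mult second_order_powr second_order_model_sin second_order_model_cos)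
  then show ?thesis by (simp add: model_profile_def field_simps)
qed

lemma model_riccati_deviation:
  fixes m k :: int
  assumes t: "t \<in> {0<..<1}"
  shows "- (- (of_int m - 1) / (sn t)\<^sup>2 - of_int \<epsilon> * of_int k / (cs t)\<^sup>2)
      - of_int \<epsilon> * (of_int m - 1 + 3 * of_int k) + (model_slope \<epsilon> \<xi> t)\<^sup>2 * (of_int m - 1)
      - 2 * model_slope \<epsilon> \<xi> t * model_log_deriv \<epsilon> m k t
    = (sn t / cs t)\<^sup>2 * model_defect m k \<xi>"
proof -
  note pos = model_sin_pos[OF t] model_cos_pos[OF t]
  define e where "e = real_of_int \<epsilon>"
  define tan where "tan = sn t / cs t"
  define cot where "cot = cs t / sn t"
  have e: "e\<^sup>2 = 1" using \<epsilon> by (auto simp: e_def)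
  have cot_tan: "cot * tan = 1" using pos by (simp add: cot_def tan_def)
  have sn: "1 / (sn t)\<^sup>2 = cot\<^sup>2 + e" and cs: "1 / (cs t)\<^sup>2 = 1 + e * tan\<^sup>2"
    using pos model_pythagoras[of t] by (simp_all add: cot_def tan_def e_def field_simps)
  have "- (- (of_int m - 1) / (sn t)\<^sup>2 - e * of_int k / (cs t)\<^sup>2)
      = (of_int m - 1) * (1 / (sn t)\<^sup>2) + e * of_int k * (1 / (cs t)\<^sup>2)"
    by (simp add: diff_divide_distrib algebra_simps)
  also have "\<dots> = (of_int m - 1) * (cot\<^sup>2 + e) + e * of_int k * (1 + e * tan\<^sup>2)"
    unfolding sn cs ..
  finally have log_deriv': "- (- (of_int m - 1) / (sn t)\<^sup>2 - e * of_int k / (cs t)\<^sup>2)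
      = (of_int m - 1) * (cot\<^sup>2 + e) + e * of_int k * (1 + e * tan\<^sup>2)" .
  have "(of_int m - 1) * (cot\<^sup>2 + e) + e * of_int k * (1 + e * tan\<^sup>2)
      - e * (of_int m - 1 + 3 * of_int k) + (cot - e * \<xi> * tan)\<^sup>2 * (of_int m - 1)
      - 2 * (cot - e * \<xi> * tan) * ((of_int m - 1) * cot - e * of_int k * tan)
    = tan\<^sup>2 * (of_int k + (of_int m - 1) * \<xi>\<^sup>2 - 2 * \<xi> * of_int k)"
    using cot_tan e by algebra
  then show ?thesis
    unfolding e_def[symmetric] log_deriv' model_slope_def model_log_deriv_def model_defect_def
      tan_def[symmetric] cot_def[symmetric] .
qed

end

section \<open>Harmonic spaces with a model density\<close>

locale harmonic_model = riem_chart M c for M :: "('a, 'n::finite) rspace" and c +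
  fixes \<Theta> :: "real \<Rightarrow> real" and \<epsilon> m k :: int
  assumes \<epsilon>: "\<epsilon> \<in> {1, -1}" and m: "m \<ge> 1" and density: "density_function M \<Theta>"
    and \<Theta>: "\<forall>\<^sub>F r in at_right 0. \<Theta> r = model_density \<epsilon> m k r"

locale harmonic_jacobi_frame =
  harmonic_model M c \<Theta> \<epsilon> m k + jacobi_frame M c s \<rho> x0 \<theta> X V J K f
  for M :: "('a, 'n::finite) rspace" and c \<Theta> \<epsilon> m k s \<rho> x0 \<theta> X V J K f +
  assumes s_le_1: "s \<le> 1"
    and det_G: "t \<in> {0<..<s} \<Longrightarrow> det (G t) = t\<^sup>2 * (model_density \<epsilon> m k t)\<^sup>2"

lemma (in harmonic_model) harmonic_jacobi_frame_exists:
  assumes p: "p \<in> dom_of c" and \<theta>: "g (coord c p) \<theta> \<theta> = 1"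
  obtains s \<rho> X V J K f where "harmonic_jacobi_frame M c \<Theta> \<epsilon> m k s \<rho> (coord c p) \<theta> X V J K f"
proof -
  obtain s \<rho> X V J K where "geodesic_variation M c s \<rho> (coord c p) \<theta> X V J K"
    by (rule geodesic_variation_exists[OF coord_mem_U[OF p]])
  then interpret gv: geodesic_variation M c s \<rho> "coord c p" \<theta> X V J K .
  let ?f = "frame_at p"
  have "\<forall>\<^sub>F t in at_right 0.
      det (gram (X \<theta> t) (\<lambda>i. J t (?f i)) (\<lambda>i. J t (?f i))) = t\<^sup>2 * (model_density \<epsilon> m k t)\<^sup>2"
    using gv.det_gram_eq_density_function[OF p refl \<theta> density] \<Theta> by eventually_elim simp
  then obtain b where b: "b > 0" and det: "\<And>t. t \<in> {0<..<b} \<Longrightarrow>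
      det (gram (X \<theta> t) (\<lambda>i. J t (?f i)) (\<lambda>i. J t (?f i))) = t\<^sup>2 * (model_density \<epsilon> m k t)\<^sup>2"
    unfolding eventually_at_right_field by auto
  define s' where "s' = Min {s, b, 1}"
  have s': "0 < s'" "s' \<le> s" "s' \<le> b" "s' \<le> 1" using gv.s b by (simp_all add: s'_def)
  interpret gv': geodesic_variation M c s' \<rho> "coord c p" \<theta> X V J K
    by (rule gv.geodesic_variation_shrink[OF s'(1,2)])
  interpret jf: jacobi_frame M c s' \<rho> "coord c p" \<theta> X V J K ?f
    by unfold_locales (rule \<theta>, rule frame_at_orthonormal[OF p])
  have "harmonic_jacobi_frame M c \<Theta> \<epsilon> m k s' \<rho> (coord c p) \<theta> X V J K ?f"
    by unfold_locales (use s' det in \<open>auto simp: jf.G_def\<close>)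
  then show ?thesis by (rule that)
qed

lemma (in harmonic_jacobi_frame) dimension_at_x0: "m = int CARD('n)"
  and ricci_at_x0: "ricci x0 \<theta> = of_int \<epsilon> * (of_int m - 1 + 3 * of_int k)"
proof -
  let ?h = "\<lambda>t. (model_density \<epsilon> m k t)\<^sup>2 / t ^ (2 * nat (m - 1))"
  have h: "second_order ?h (- (of_int \<epsilon> * (of_int m - 1 + 3 * of_int k)) / 3)"
    by (rule model_density_second_order[OF \<epsilon> m])
  have exponent: "2 * nat m = 2 * nat (m - 1) + 2" using m by simp
  have h_eq: "\<forall>\<^sub>F t in at_right 0. ?h t = det (G t) / t ^ (2 * nat m)"
    using eventually_in_I by eventually_elim (simp add: det_G exponent power_add power2_eq_square)
  have "2 * nat m = 2 * CARD('n)"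
    by (rule power_quotient_tendsto_1_unique[OF Lim_transform_eventually[OF second_order_tendsto_1[OF h] h_eq]
          second_order_tendsto_1[OF det_G_second_order]])
  then show dim: "m = int CARD('n)" using m by simp
  have "- (of_int \<epsilon> * (of_int m - 1 + 3 * of_int k)) / 3 = - ricci x0 \<theta> / 3"
    by (rule second_order_unique[OF h det_G_second_order]) (use h_eq in \<open>simp add: dim\<close>)
  then show "ricci x0 \<theta> = of_int \<epsilon> * (of_int m - 1 + 3 * of_int k)" by simp
qed

context harmonic_model begin

lemma ricci_unit_vector:
  assumes x: "x \<in> U" and \<theta>: "g x \<theta> \<theta> = 1"
  shows "ricci x \<theta> = of_int \<epsilon> * (of_int m - 1 + 3 * of_int k)"
  by (rule harmonic_jacobi_frame_exists[OF point_at(3)[OF x], unfolded point_at(2)[OF x], OF \<theta>])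
    (rule harmonic_jacobi_frame.ricci_at_x0)

lemma harmonic_jacobi_frame_at:
  assumes p: "p \<in> dom_of c"
  obtains s \<rho> \<theta> X V J K f where "harmonic_jacobi_frame M c \<Theta> \<epsilon> m k s \<rho> (coord c p) \<theta> X V J K f"
proof -
  obtain \<theta> where "g (coord c p) \<theta> \<theta> = 1" by (rule unit_vector_exists[OF coord_mem_U[OF p]])
  then show ?thesis by (rule harmonic_jacobi_frame_exists[OF p]) (rule that)
qed

lemma dimension: "p \<in> dom_of c \<Longrightarrow> m = int CARD('n)"
  by (erule harmonic_jacobi_frame_at) (rule harmonic_jacobi_frame.dimension_at_x0)

end

context harmonic_jacobi_frame begin

lemma unit_interval: "t \<in> {0<..<s} \<Longrightarrow> t \<in> {0<..<1}"
  using s_le_1 by auto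

lemma model_comparison:
  assumes t: "t \<in> {0<..<s}"
  shows "0 \<le> (model_sin \<epsilon> t / model_cos \<epsilon> t)\<^sup>2 * model_defect m k \<xi>"
    "model_defect m k \<xi> = 0 \<Longrightarrow>
     H t = t *\<^sub>R P + model_slope \<epsilon> \<xi> t *\<^sub>R (G t - t\<^sup>2 *\<^sub>R P)"
proof -
  have ricci: "ricci (x t) (v t) = of_int \<epsilon> * (of_int m - 1 + 3 * of_int k)"
    using t by (intro ricci_unit_vector x_mem_U unit_speed) auto
  have nonzero: "model_density \<epsilon> m k t \<noteq> 0" if "t \<in> {0<..<s}" for t
    using model_sin_pos model_cos_pos unit_interval[OF that] \<epsilon> by (fastforce simp: model_density_eq)
  note comparison = riccati_comparison[OF det_G nonzero model_density_deriv[OF \<epsilon> unit_interval]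
      model_log_deriv_deriv[OF \<epsilon> unit_interval] t ricci, of "model_slope \<epsilon> \<xi> t"]
  have deviation: "real CARD('n) - 1 = of_int m - 1" by (simp add: dimension_at_x0)
  show "0 \<le> (model_sin \<epsilon> t / model_cos \<epsilon> t)\<^sup>2 * model_defect m k \<xi>"
    "model_defect m k \<xi> = 0 \<Longrightarrow>
     H t = t *\<^sub>R P + model_slope \<epsilon> \<xi> t *\<^sub>R (G t - t\<^sup>2 *\<^sub>R P)"
    using comparison[unfolded deviation model_riccati_deviation[OF \<epsilon> unit_interval[OF t]]] by simp_all
qed

lemma model_defect_nonneg: "0 \<le> model_defect m k \<xi>"
proof -
  have t: "s / 2 \<in> {0<..<s}" "s / 2 \<in> {0<..<1}" using s s_le_1 by auto
  have "0 < (model_sin \<epsilon> (s / 2) / model_cos \<epsilon> (s / 2))\<^sup>2"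
    using model_sin_pos[OF \<epsilon> t(2)] model_cos_pos[OF \<epsilon> t(2)] by simp
  with model_comparison(1)[OF t(1), of \<xi>] show ?thesis by (simp add: zero_le_mult_iff)
qed

lemma model_radial_curvature:
  assumes "model_defect m k \<xi> = 0"
  shows "g x0 (Rm x0 u \<theta> \<theta>) u = of_int \<epsilon> * (1 + 3 * \<xi>) * (g x0 u u - (g x0 u \<theta>)\<^sup>2)"
proof -
  have F: "second_order (\<lambda>t. model_profile \<epsilon> \<xi> t / t) (- of_int \<epsilon> * (1 + 3 * \<xi>) / 6)"
    by (rule model_profile_second_order[OF \<epsilon>])
  have "model_profile \<epsilon> \<xi> t \<noteq> 0" if "t \<in> {0<..<s}" for t
    using model_sin_pos[OF \<epsilon> unit_interval[OF that]] model_cos_pos[OF \<epsilon> unit_interval[OF that]]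
    by (simp add: model_profile_def)
  from gram_of_umbilic[OF model_comparison(2)[OF _ assms] model_profile_deriv[OF \<epsilon> unit_interval] this
      second_order_tendsto_1[OF F]]
  have "R0 = (- 6 * (- of_int \<epsilon> * (1 + 3 * \<xi>) / 6)) *\<^sub>R (mat 1 - P)"
    by (intro R0_of_gram[OF _ F])
  then show ?thesis by (intro radial_curvature) simp
qed

end

context harmonic_model begin

lemma defect_nonneg: "p \<in> dom_of c \<Longrightarrow> 0 \<le> model_defect m k \<xi>"
  by (erule harmonic_jacobi_frame_at) (rule harmonic_jacobi_frame.model_defect_nonneg)

lemma sectional_curvature_of_defect:
  assumes p: "p \<in> dom_of c" and uv: "u \<noteq> v" "independent {u, v}" and defect: "model_defect m k \<xi> = 0"
  shows "sectional_curvature M c (coord c p) u v = of_int \<epsilon> * (1 + 3 * \<xi>)"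
proof (rule sectional_curvature_of_radial[OF coord_mem_U[OF p] uv])
  fix \<theta> assume "g (coord c p) \<theta> \<theta> = 1"
  then show "g (coord c p) (Rm (coord c p) u \<theta> \<theta>) u =
      of_int \<epsilon> * (1 + 3 * \<xi>) * (g (coord c p) u u - (g (coord c p) u \<theta>)\<^sup>2)"
    by (rule harmonic_jacobi_frame_exists[OF p])
      (rule harmonic_jacobi_frame.model_radial_curvature[OF _ defect])
qed

end

theorem lemma1p7:
  fixes M :: "('a, 'n::finite) rspace" and \<Theta> :: "real \<Rightarrow> real" and \<epsilon> m k :: int
  assumes "\<epsilon> \<in> {1, -1}" and "m \<ge> 1"
    and "harmonic_space M"
    and "density_function M \<Theta>"
    and "\<forall>\<^sub>F r in at_right 0. \<Theta> r = model_density \<epsilon> m k r"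
  shows "(m = int CARD('n) \<and> 0 \<le> k \<and> k \<le> m - 1)
       \<and> (k = 0 \<longrightarrow> constant_sectional_curvature M (of_int \<epsilon>))
       \<and> (k = m - 1 \<longrightarrow> constant_sectional_curvature M (4 * of_int \<epsilon>))"
proof -
  have manifold: "riemannian_manifold M" using assms(3) by (simp add: harmonic_space_def)
  then have model: "harmonic_model M c \<Theta> \<epsilon> m k" if "c \<in> atlas M" for c
    using assms that by (simp add: harmonic_model_def harmonic_model_axioms_def riem_chart_def)
  have "points M \<noteq> {}" "(\<Union>c\<in>atlas M. dom_of c) = points M"
    using manifold by (auto simp: riemannian_manifold_def smooth_manifold_def)
  then obtain c p where c: "c \<in> atlas M" and p: "p \<in> dom_of c" by blast
  note defect_nonneg = harmonic_model.defect_nonneg[OF model[OF c] p]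
  have "m = int CARD('n)" by (rule harmonic_model.dimension[OF model[OF c] p])
  moreover have "0 \<le> k" using defect_nonneg[of 0] by (simp add: model_defect_def)
  moreover have "k \<le> m - 1" using defect_nonneg[of 1] by (simp add: model_defect_def)
  moreover have "constant_sectional_curvature M (of_int \<epsilon> * (1 + 3 * \<xi>))" if "model_defect m k \<xi> = 0" for \<xi>
    using harmonic_model.sectional_curvature_of_defect[OF model] that
    by (auto simp: constant_sectional_curvature_def)
  from this[of 0] this[of 1]
  have "k = 0 \<longrightarrow> constant_sectional_curvature M (of_int \<epsilon>)"
    "k = m - 1 \<longrightarrow> constant_sectional_curvature M (4 * of_int \<epsilon>)"
    by (simp_all add: model_defect_def mult.commute)
  ultimately show ?thesis by blast
qed

end
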